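(* Let $P\subset\mathcal{G}^d$ with $|P|=n$, let $0\leq i<d$ and let $\bar y\in\mathbb{R}^i$. Consider the following procedure: for $\kappa=1,2,\dots,n/2$, compute $D_P(\kappa)$ and its intersection with the affine subspace $S_{\bar y}=\{\bar y\circ\bar x:\bar x\in\mathbb{R}^{d-i}\}$; if the intersection is empty, stop; otherwise compute $a_\kappa=\min\{w_{i+1}:w\in D_P(\kappa)\cap S_{\bar y}\}$ and $b_\kappa=\max\{w_{i+1}:w\in D_P(\kappa)\cap S_{\bar y}\}$ (where $w_{i+1}$ is the $(i+1)$-th coordinate). Return the collection $\{[a_\kappa,b_\kappa]\}$. This procedure runs in time polynomial in $n$ and $\upsilon$ and exponential in $d$, and returns a collection of nested intervals ($[a_{\kappa'},b_{\kappa'}]\subset[a_\kappa,b_\kappa]$ for $\kappa<\kappa'$) such that for any closed interval $I\subset\mathbb{R}$ it holds that $\mathsf{TDC}_{\bar y}(I)=\max\{\kappa: I\cap[a_\kappa,b_\kappa]\neq\emptyset\}$.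
   Context: $\mathcal{G}\subset[0,1]$ is a grid of granularity $2^{-\upsilon}$. Tukey depth $\mathrm{TD}(x,P)=\min_{u\in\mathbb{S}^{d-1}}|\{p\in P:\langle p,u\rangle\leq\langle x,u\rangle\}|$; $D_P(\kappa)=\{x:\mathrm{TD}(x,P)\geq\kappa\}$ (a convex polytope). $\bar y\circ\bar x$ denotes concatenation. For $x\in\mathbb{R}$, $\mathsf{TDC}_{\bar y}(x)=\max_{\bar z\in\mathbb{R}^{d-1-i}}\mathrm{TD}(\bar y\circ x\circ\bar z,P)$, and for a closed interval $I$, $\mathsf{TDC}_{\bar y}(I)=\max_{x\in I}\mathsf{TDC}_{\bar y}(x)$.
   Formalization: The loop bound n/2 is rounded up (rounded down, the claim fails for odd n, e.g. one point on a line); the maximum of an empty set is 0; time is counted in exact real operations for real ȳ, and in bit operations for rational ȳ, polynomially also in the bit size of ȳ. *)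

theory Defs
  imports "HOL-Analysis.Analysis" "HOL-Library.Monad_Syntax" "HOL-Library.Log_Nat"
begin

section \<open>Tukey depth\<close>

text \<open>A point of d-dimensional space is a real list of length d, so that concatenation is
  \<^term>\<open>(@)\<close> and d may vary inside a formula. Coordinates are counted from 0, so the
  (i+1)-th coordinate of w is \<open>w ! i\<close>.\<close>

definition inner_list :: "real list \<Rightarrow> real list \<Rightarrow> real" where
  "inner_list u v = sum_list (map2 (*) u v)"

definition unit_sphere :: "nat \<Rightarrow> real list set" where
  "unit_sphere d = {u. length u = d \<and> inner_list u u = 1}"

definition grid :: "nat \<Rightarrow> real set" where
  "grid \<upsilon> = {real k / 2 ^ \<upsilon> |k. k \<le> 2 ^ \<upsilon>}"

definition grid_points :: "nat \<Rightarrow> nat \<Rightarrow> real list set" where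
  "grid_points \<upsilon> d = {p. length p = d \<and> set p \<subseteq> grid \<upsilon>}"

definition TD :: "nat \<Rightarrow> real list set \<Rightarrow> real list \<Rightarrow> nat" where
  "TD d P x = Min ((\<lambda>u. card {p \<in> P. inner_list p u \<le> inner_list x u}) ` unit_sphere d)"

definition depth_region :: "nat \<Rightarrow> real list set \<Rightarrow> nat \<Rightarrow> real list set" where
  "depth_region d P \<kappa> = {x. length x = d \<and> \<kappa> \<le> TD d P x}"

definition extensions :: "nat \<Rightarrow> real list \<Rightarrow> real list set" where
  "extensions d y = {y @ x |x. length x = d - length y}"

definition TDC :: "nat \<Rightarrow> real list set \<Rightarrow> real list \<Rightarrow> real \<Rightarrow> nat" where
  "TDC d P y x = Max ((\<lambda>z. TD d P (y @ [x] @ z)) ` {z. length z = d - 1 - length y})"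

definition TDC_interval :: "nat \<Rightarrow> real list set \<Rightarrow> real list \<Rightarrow> real set \<Rightarrow> nat" where
  "TDC_interval d P y I = Max (TDC d P y ` I)"

definition is_minimum :: "real \<Rightarrow> real set \<Rightarrow> bool" where
  "is_minimum a A \<longleftrightarrow> a \<in> A \<and> (\<forall>t\<in>A. a \<le> t)"

definition is_maximum :: "real \<Rightarrow> real set \<Rightarrow> bool" where
  "is_maximum b A \<longleftrightarrow> b \<in> A \<and> (\<forall>t\<in>A. t \<le> b)"

text \<open>The entry for \<open>\<kappa>\<close> of the returned list, whose entries are numbered from 1.\<close>

definition nth_interval :: "(real \<times> real) list \<Rightarrow> nat \<Rightarrow> real set" where
  "nth_interval Js \<kappa> = {fst (Js ! (\<kappa> - 1)) .. snd (Js ! (\<kappa> - 1))}"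

text \<open>The output that the loop over \<open>\<kappa> = 1, 2, \<dots>, n/2\<close> must produce, where n/2 is rounded up
  (a point of an odd set can have depth (n+1)/2, for instance the median when d = 1).\<close>

definition correct_output :: "nat \<Rightarrow> real list set \<Rightarrow> real list \<Rightarrow> (real \<times> real) list \<Rightarrow> bool" where
  "correct_output d P y Js \<longleftrightarrow>
     length Js \<le> (card P + 1) div 2 \<and>
     (\<forall>\<kappa>\<in>{1..length Js}.
        let W = (\<lambda>w. w ! length y) ` (depth_region d P \<kappa> \<inter> extensions d y)
        in is_minimum (fst (Js ! (\<kappa> - 1))) W \<and> is_maximum (snd (Js ! (\<kappa> - 1))) W) \<and>
     (length Js < (card P + 1) div 2 \<longrightarrow>
        depth_region d P (length Js + 1) \<inter> extensions d y = {})"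


section \<open>Cost model\<close>

text \<open>Programs are written in a step-counting monad. Every recursive call of a
  list program and every call of a named subprogram is charged one step; an arithmetic operation or
  comparison on numbers a, b is charged \<open>(1 + sz a + sz b)\<^sup>2\<close>. The parameter \<open>sz\<close> selects the
  model: \<open>sz = (\<lambda>_. 0)\<close> counts exact real operations (real RAM), and \<open>sz = bit_size\<close>
  counts bit operations on rationals in lowest terms. The square accounts for schoolbook
  multiplication and for the Euclidean algorithm. Natural numbers
  occur only as dimensions, positions and loop counters.\<close>

datatype 'a timed = Timed (val: 'a) (time: nat)

definition ret :: "'a \<Rightarrow> 'a timed" where
  "ret x = Timed x 0"

definition bind_timed :: "'a timed \<Rightarrow> ('a \<Rightarrow> 'b timed) \<Rightarrow> 'b timed" where
  "bind_timed m f = (case f (val m) of Timed y k \<Rightarrow> Timed y (time m + k))"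

adhoc_overloading Monad_Syntax.bind \<rightleftharpoons> bind_timed

definition tick :: "'a timed \<Rightarrow> 'a timed" where
  "tick m = (case m of Timed x k \<Rightarrow> Timed x (k + 1))"

definition bit_size :: "real \<Rightarrow> nat" where
  "bit_size x = (case quotient_of (inv real_of_rat x) of
     (a, b) \<Rightarrow> nat (bitlen \<bar>a\<bar>) + nat (bitlen b))"


section \<open>List programs\<close>

primrec length_t :: "'a list \<Rightarrow> nat timed" where
  "length_t [] = tick (ret 0)"
| "length_t (x # xs) = tick (do { k \<leftarrow> length_t xs; ret (Suc k) })"

primrec append_t :: "'a list \<Rightarrow> 'a list \<Rightarrow> 'a list timed" where
  "append_t [] ys = tick (ret ys)"
| "append_t (x # xs) ys = tick (do { zs \<leftarrow> append_t xs ys; ret (x # zs) })"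

primrec map_t :: "('a \<Rightarrow> 'b timed) \<Rightarrow> 'a list \<Rightarrow> 'b list timed" where
  "map_t f [] = tick (ret [])"
| "map_t f (x # xs) = tick (do { y \<leftarrow> f x; ys \<leftarrow> map_t f xs; ret (y # ys) })"

primrec map2_t :: "('a \<Rightarrow> 'b \<Rightarrow> 'c timed) \<Rightarrow> 'a list \<Rightarrow> 'b list \<Rightarrow> 'c list timed" where
  "map2_t f [] ys = tick (ret [])"
| "map2_t f (x # xs) ys = tick (case ys of
     [] \<Rightarrow> ret []
   | y # ys' \<Rightarrow> do { z \<leftarrow> f x y; zs \<leftarrow> map2_t f xs ys'; ret (z # zs) })"

primrec concat_t :: "'a list list \<Rightarrow> 'a list timed" where
  "concat_t [] = tick (ret [])"
| "concat_t (xs # xss) = tick (do { ys \<leftarrow> concat_t xss; append_t xs ys })"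

primrec all_t :: "('a \<Rightarrow> bool timed) \<Rightarrow> 'a list \<Rightarrow> bool timed" where
  "all_t p [] = tick (ret True)"
| "all_t p (x # xs) = tick (do { b \<leftarrow> p x; if b then all_t p xs else ret False })"

primrec nth_t :: "'a list \<Rightarrow> nat \<Rightarrow> 'a timed" where
  "nth_t [] j = tick (ret undefined)"
| "nth_t (x # xs) j = tick (case j of 0 \<Rightarrow> ret x | Suc j' \<Rightarrow> nth_t xs j')"

primrec drop_t :: "nat \<Rightarrow> 'a list \<Rightarrow> 'a list timed" where
  "drop_t j [] = tick (ret [])"
| "drop_t j (x # xs) = tick (case j of 0 \<Rightarrow> ret (x # xs) | Suc j' \<Rightarrow> drop_t j' xs)"

primrec delete_t :: "nat \<Rightarrow> 'a list \<Rightarrow> 'a list timed" where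
  "delete_t j [] = tick (ret [])"
| "delete_t j (x # xs) = tick (case j of
     0 \<Rightarrow> ret xs
   | Suc j' \<Rightarrow> do { ys \<leftarrow> delete_t j' xs; ret (x # ys) })"

primrec update_t :: "nat \<Rightarrow> 'a \<Rightarrow> 'a list \<Rightarrow> 'a list timed" where
  "update_t j a [] = tick (ret [])"
| "update_t j a (x # xs) = tick (case j of
     0 \<Rightarrow> ret (a # xs)
   | Suc j' \<Rightarrow> do { ys \<leftarrow> update_t j' a xs; ret (x # ys) })"

primrec replicate_t :: "nat \<Rightarrow> 'a \<Rightarrow> 'a list timed" where
  "replicate_t 0 a = tick (ret [])"
| "replicate_t (Suc k) a = tick (do { xs \<leftarrow> replicate_t k a; ret (a # xs) })"

primrec upto_t :: "nat \<Rightarrow> nat list timed" where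
  "upto_t 0 = tick (ret [])"
| "upto_t (Suc k) = tick (do { xs \<leftarrow> upto_t k; append_t xs [k] })"

text \<open>All sublists (not necessarily contiguous) of length k.\<close>

primrec sublists_t :: "'a list \<Rightarrow> nat \<Rightarrow> 'a list list timed" where
  "sublists_t [] k = tick (ret (if k = 0 then [[]] else []))"
| "sublists_t (x # xs) k = tick (case k of
     0 \<Rightarrow> ret [[]]
   | Suc k' \<Rightarrow> do {
       A \<leftarrow> sublists_t xs k';
       A' \<leftarrow> map_t (\<lambda>s. tick (ret (x # s))) A;
       B \<leftarrow> sublists_t xs k;
       append_t A' B })"


section \<open>The procedure\<close>

context
  fixes sz :: "real \<Rightarrow> nat"
begin

definition arith_cost :: "real \<Rightarrow> real \<Rightarrow> nat" where
  "arith_cost a b = (1 + sz a + sz b)\<^sup>2"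

definition add_t :: "real \<Rightarrow> real \<Rightarrow> real timed" where
  "add_t a b = Timed (a + b) (arith_cost a b)"

definition sub_t :: "real \<Rightarrow> real \<Rightarrow> real timed" where
  "sub_t a b = Timed (a - b) (arith_cost a b)"

definition mult_t :: "real \<Rightarrow> real \<Rightarrow> real timed" where
  "mult_t a b = Timed (a * b) (arith_cost a b)"

definition div_t :: "real \<Rightarrow> real \<Rightarrow> real timed" where
  "div_t a b = Timed (a / b) (arith_cost a b)"

definition le_t :: "real \<Rightarrow> real \<Rightarrow> bool timed" where
  "le_t a b = Timed (a \<le> b) (arith_cost a b)"

definition eq_t :: "real \<Rightarrow> real \<Rightarrow> bool timed" where
  "eq_t a b = Timed (a = b) (arith_cost a b)"

primrec sum_t :: "real list \<Rightarrow> real timed" where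
  "sum_t [] = tick (ret 0)"
| "sum_t (x # xs) = tick (do { s \<leftarrow> sum_t xs; add_t x s })"

definition inner_t :: "real list \<Rightarrow> real list \<Rightarrow> real timed" where
  "inner_t u v = tick (do { ps \<leftarrow> map2_t mult_t u v; sum_t ps })"

definition negate_t :: "real list \<Rightarrow> real list timed" where
  "negate_t u = tick (map_t (sub_t 0) u)"

text \<open>Minimum and maximum of the nonempty list \<open>x # xs\<close>.\<close>

primrec min_t :: "real \<Rightarrow> real list \<Rightarrow> real timed" where
  "min_t x [] = tick (ret x)"
| "min_t x (y # ys) = tick (do { b \<leftarrow> le_t x y; min_t (if b then x else y) ys })"

primrec max_t :: "real \<Rightarrow> real list \<Rightarrow> real timed" where
  "max_t x [] = tick (ret x)"
| "max_t x (y # ys) = tick (do { b \<leftarrow> le_t x y; max_t (if b then y else x) ys })"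

primrec insort_t :: "real \<Rightarrow> real list \<Rightarrow> real list timed" where
  "insort_t x [] = tick (ret [x])"
| "insort_t x (y # ys) = tick (do {
     b \<leftarrow> le_t x y;
     if b then ret (x # y # ys) else do { zs \<leftarrow> insort_t x ys; ret (y # zs) } })"

primrec sort_t :: "real list \<Rightarrow> real list timed" where
  "sort_t [] = tick (ret [])"
| "sort_t (x # xs) = tick (do { ys \<leftarrow> sort_t xs; insort_t x ys })"

text \<open>Flips the sign of every second entry.\<close>

primrec alternate_t :: "real list \<Rightarrow> real list timed" where
  "alternate_t [] = tick (ret [])"
| "alternate_t (x # xs) = tick (do { ys \<leftarrow> alternate_t xs; zs \<leftarrow> negate_t ys; ret (x # zs) })"

text \<open>Matrices are lists of rows. The cofactors of a missing first row above M, where M has d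
  columns and d - 1 rows; this vector is orthogonal to all rows of M (the generalized cross
  product), and it is zero iff they are linearly dependent.\<close>

definition cofactors_t ::
    "(real list list \<Rightarrow> real timed) \<Rightarrow> nat \<Rightarrow> real list list \<Rightarrow> real list timed" where
  "cofactors_t det_f d M = tick (do {
     js \<leftarrow> upto_t d;
     ms \<leftarrow> map_t (\<lambda>j. do { M' \<leftarrow> map_t (delete_t j) M; det_f M' }) js;
     alternate_t ms })"

primrec det_t :: "nat \<Rightarrow> real list list \<Rightarrow> real timed" where
  "det_t 0 M = tick (ret 1)"
| "det_t (Suc k) M = tick (case M of
     [] \<Rightarrow> ret 0
   | r # M' \<Rightarrow> do { cs \<leftarrow> cofactors_t (det_t k) (Suc k) M'; inner_t r cs })"

definition differences_t :: "real list list \<Rightarrow> real list list timed" where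
  "differences_t ps = tick (do {
     vss \<leftarrow> map_t (\<lambda>p. map_t (\<lambda>q. map2_t sub_t p q) ps) ps;
     concat_t vss })"

definition unit_vectors_t :: "nat \<Rightarrow> real list list timed" where
  "unit_vectors_t d = tick (do {
     js \<leftarrow> upto_t d;
     map_t (\<lambda>j. do { zs \<leftarrow> replicate_t d 0; update_t j 1 zs }) js })"

text \<open>The candidate normals of bounding hyperplanes of a depth region: up to scaling these are
  the directions orthogonal to d - 1 independent vectors, each a difference of two data points
  or a unit vector. The unit vectors make the arrangement of the hyperplanes
  orthogonal to these vectors pointed, even when the data lie in a proper affine subspace.\<close>

definition normals_t :: "nat \<Rightarrow> real list list \<Rightarrow> real list list timed" where
  "normals_t d ps = tick (do {
     vs \<leftarrow> differences_t ps;
     es \<leftarrow> unit_vectors_t d;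
     gs \<leftarrow> append_t vs es;
     Ms \<leftarrow> sublists_t gs (d - 1);
     us \<leftarrow> map_t (cofactors_t (det_t (d - 1)) d) Ms;
     us' \<leftarrow> map_t negate_t us;
     append_t us us' })"

text \<open>A pair \<open>(u, t)\<close> stands for the halfspace of all w with \<open>inner_list u w \<ge> t\<close>. For each
  candidate normal u, t is the \<open>\<kappa>\<close>-th smallest value of u on the data.\<close>

definition depth_region_t ::
    "nat \<Rightarrow> real list list \<Rightarrow> nat \<Rightarrow> (real list \<times> real) list timed" where
  "depth_region_t d ps \<kappa> = tick (do {
     us \<leftarrow> normals_t d ps;
     map_t (\<lambda>u. do {
       ts \<leftarrow> map_t (inner_t u) ps;
       ss \<leftarrow> sort_t ts;
       t \<leftarrow> nth_t ss (\<kappa> - 1);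
       ret (u, t) }) us })"

text \<open>The intersection with the extensions of y, as halfspaces in the remaining coordinates.
  The lists in \<open>inner_t y u\<close> may differ in length; the longer one is truncated.\<close>

definition intersect_t ::
    "real list \<Rightarrow> (real list \<times> real) list \<Rightarrow> (real list \<times> real) list timed" where
  "intersect_t y hs = tick (do {
     i \<leftarrow> length_t y;
     map_t (\<lambda>(u, t). do {
       s \<leftarrow> inner_t y u;
       t' \<leftarrow> sub_t t s;
       u' \<leftarrow> drop_t i u;
       ret (u', t') }) hs })"

text \<open>Cramer's rule for the system \<open>inner_list u x = t\<close> with m equations and unknowns.\<close>

definition solve_t :: "nat \<Rightarrow> (real list \<times> real) list \<Rightarrow> real list option timed" where
  "solve_t m cs = tick (do {
     A \<leftarrow> map_t (\<lambda>(u, t). ret u) cs;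
     D \<leftarrow> det_t m A;
     singular \<leftarrow> eq_t D 0;
     if singular then ret None
     else do {
       js \<leftarrow> upto_t m;
       xs \<leftarrow> map_t (\<lambda>j. do {
         A' \<leftarrow> map_t (\<lambda>(u, t). update_t j t u) cs;
         D' \<leftarrow> det_t m A';
         div_t D' D }) js;
       ret (Some xs) } })"

definition feasible_t :: "(real list \<times> real) list \<Rightarrow> real list \<Rightarrow> bool timed" where
  "feasible_t hs x = tick (all_t (\<lambda>(u, t). do { s \<leftarrow> inner_t u x; le_t t s }) hs)"

primrec collect_feasible_t ::
    "(real list \<times> real) list \<Rightarrow> real list option list \<Rightarrow> real list list timed" where
  "collect_feasible_t hs [] = tick (ret [])"
| "collect_feasible_t hs (c # cs) = tick (do {
     xs \<leftarrow> collect_feasible_t hs cs;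
     case c of
       None \<Rightarrow> ret xs
     | Some x \<Rightarrow> do { b \<leftarrow> feasible_t hs x; ret (if b then x # xs else xs) } })"

text \<open>The vertices of the polytope in m-dimensional space given by the halfspaces hs.\<close>

definition vertices_t :: "nat \<Rightarrow> (real list \<times> real) list \<Rightarrow> real list list timed" where
  "vertices_t m hs = tick (do {
     Ss \<leftarrow> sublists_t hs m;
     cs \<leftarrow> map_t (solve_t m) Ss;
     collect_feasible_t hs cs })"

text \<open>The range of the first coordinate over a polytope, or \<^term>\<open>None\<close> if it is empty.\<close>

definition range_t :: "nat \<Rightarrow> (real list \<times> real) list \<Rightarrow> (real \<times> real) option timed" where
  "range_t m hs = tick (do {
     vs \<leftarrow> vertices_t m hs;
     ts \<leftarrow> map_t (\<lambda>v. nth_t v 0) vs;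
     case ts of
       [] \<Rightarrow> ret None
     | t # ts' \<Rightarrow> do { a \<leftarrow> min_t t ts'; b \<leftarrow> max_t t ts'; ret (Some (a, b)) } })"

text \<open>The loop, with r iterations left and the current value of \<open>\<kappa>\<close>.\<close>

primrec loop_t ::
    "nat \<Rightarrow> nat \<Rightarrow> nat \<Rightarrow> real list list \<Rightarrow> real list \<Rightarrow> (real \<times> real) list timed" where
  "loop_t 0 \<kappa> d ps y = tick (ret [])"
| "loop_t (Suc r) \<kappa> d ps y = tick (do {
     hs \<leftarrow> depth_region_t d ps \<kappa>;
     hs' \<leftarrow> intersect_t y hs;
     i \<leftarrow> length_t y;
     J \<leftarrow> range_t (d - i) hs';
     case J of
       None \<Rightarrow> ret []
     | Some ab \<Rightarrow> do { Js \<leftarrow> loop_t r (\<kappa> + 1) d ps y; ret (ab # Js) } })"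

definition nested_intervals_t ::
    "nat \<Rightarrow> real list list \<Rightarrow> real list \<Rightarrow> (real \<times> real) list timed" where
  "nested_intervals_t d ps y = tick (do {
     n \<leftarrow> length_t ps;
     loop_t ((n + 1) div 2) 1 d ps y })"

end

end

theory Submission
  imports Defs "HOL-Library.Sublist" "Jordan_Normal_Form.Determinant"
begin

text \<open>Fix a point w. For each rank \<open>\<kappa>\<close>, the difference between the \<open>\<kappa>\<close>-th smallest value of a direction u on
  the data and the value of u at w is linear in u on every closed cell of the central arrangement of
  hyperplanes orthogonal to the differences of data points and to the unit vectors, because the order
  of the data does not change inside a cell. The arrangement is pointed, so if this difference is
  positive anywhere, it is positive on a ray; up to scaling the rays are the generalized cross products
  of d - 1 of the vectors. Hence the candidate halfspaces cut out exactly the depth region.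
  The slice is a bounded polytope, so its extreme first coordinates are attained at vertices, and
  Cramer's rule finds them. Since the slices are nested and convex, the intervals answer all depth queries;
  a direction in general position shows that no depth exceeds (n+1)/2.

  For the running time only the number H of halfspaces matters: the binomial coefficient
  of \<open>n\<^sup>2 + d\<close> over d - 1 is at most \<open>(n + 2)\<close> to the power O(d), so that even \<open>H\<^sup>d\<close> stays below \<open>(n + 2)\<close>
  to the power \<open>O(d\<^sup>2)\<close>. Fractions are never assumed to be reduced: numerator and denominator are
  bounded by \<open>2\<^sup>b\<close>, and b is essentially additive under all arithmetic operations.\<close>

section \<open>Evaluation of list programs\<close>

text \<open>The ray argument is used for two functions of u. For the \<kappa>-th smallest value
  minus the value at w, it turns any violated direction into a violated candidate. For the linear
  function \<open>- inner_list u w\<close> it shows that the candidate normals leave no unbounded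
  direction, so slices are bounded even when the data lie in a proper affine subspace. Dependent
  vectors produce the zero normal, whose halfspace is the whole space, so the program needs no test
  for it.

  Spanning, rays and vertices are all expressed through determinants of lists of rows, because the
  dimension changes between d, d - 1 and d - i inside one argument. Correctness does not look at
  costs, and the cost analysis is done once, in an abstract model of number sizes of which the real
  RAM and the bit model are instances.

  The delicate numerical point is a factor like \<open>k ^ k\<close>: in the number of halfspaces it
  would grow to order \<open>k ^ (k * k)\<close> when systems of up to d halfspaces are enumerated,
  which no \<open>(n + 2) ^ (c * (d + 1)\<^sup>2)\<close> covers for fixed n. Hence the binomial
  coefficient is estimated so that k enters only through a power of 2.\<close>

lemma val_ret [simp]: "val (ret x) = x" and time_ret [simp]: "time (ret x) = 0"
  by (simp_all add: ret_def)

lemma val_bind [simp]: "val (bind_timed m f) = val (f (val m))"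
  and time_bind [simp]: "time (bind_timed m f) = time m + time (f (val m))"
  by (simp_all add: bind_timed_def split: timed.split)

lemma val_tick [simp]: "val (tick m) = val m" and time_tick [simp]: "time (tick m) = time m + 1"
  by (simp_all add: tick_def split: timed.split)

lemma val_length_t [simp]: "val (length_t xs) = length xs"
  by (induction xs) auto

lemma time_length_t: "time (length_t xs) = length xs + 1"
  by (induction xs) auto

lemma val_append_t [simp]: "val (append_t xs ys) = xs @ ys"
  by (induction xs) auto

lemma time_append_t: "time (append_t xs ys) = length xs + 1"
  by (induction xs) auto

lemma val_map_t [simp]: "val (map_t f xs) = map (\<lambda>x. val (f x)) xs"
  by (induction xs) auto

lemma time_map_t_le:
  assumes "\<And>x. x \<in> set xs \<Longrightarrow> time (f x) \<le> T"
  shows "time (map_t f xs) \<le> (length xs + 1) * (T + 1)"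
  using assms
proof (induction xs)
  case (Cons x xs)
  have "time (f x) \<le> T" "time (map_t f xs) \<le> (length xs + 1) * (T + 1)"
    using Cons by auto
  then show ?case by simp
qed simp

lemma val_map2_t [simp]: "val (map2_t f xs ys) = map2 (\<lambda>x y. val (f x y)) xs ys"
  by (induction xs arbitrary: ys) (auto split: list.split)

lemma time_map2_t_le:
  assumes "\<And>x y. x \<in> set xs \<Longrightarrow> y \<in> set ys \<Longrightarrow> time (f x y) \<le> T"
  shows "time (map2_t f xs ys) \<le> (length xs + 1) * (T + 1)"
  using assms
proof (induction xs arbitrary: ys)
  case (Cons x xs)
  show ?case
  proof (cases ys)
    case (Cons y ys')
    have "time (f x y) \<le> T" "time (map2_t f xs ys') \<le> (length xs + 1) * (T + 1)"
      using Cons Cons.prems Cons.IH[of ys'] by auto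
    then show ?thesis using Cons by simp
  qed simp
qed simp

lemma val_concat_t [simp]: "val (concat_t xss) = concat xss"
  by (induction xss) auto

lemma time_concat_t_le:
  assumes "\<And>xs. xs \<in> set xss \<Longrightarrow> length xs \<le> k"
  shows "time (concat_t xss) \<le> (length xss + 1) * (k + 2)"
  using assms
proof (induction xss)
  case (Cons xs xss)
  have "length xs \<le> k" "time (concat_t xss) \<le> (length xss + 1) * (k + 2)"
    using Cons by auto
  then show ?case by (simp add: time_append_t)
qed simp

lemma val_all_t [simp]: "val (all_t p xs) = (\<forall>x\<in>set xs. val (p x))"
  by (induction xs) auto

lemma time_all_t_le:
  assumes "\<And>x. x \<in> set xs \<Longrightarrow> time (p x) \<le> T"
  shows "time (all_t p xs) \<le> (length xs + 1) * (T + 1)"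
  using assms
proof (induction xs)
  case (Cons x xs)
  have "time (p x) \<le> T" "time (all_t p xs) \<le> (length xs + 1) * (T + 1)"
    using Cons by auto
  then show ?case by simp
qed simp

lemma val_nth_t [simp]: "j < length xs \<Longrightarrow> val (nth_t xs j) = xs ! j"
  by (induction xs arbitrary: j) (auto split: nat.split)

lemma time_nth_t_le: "time (nth_t xs j) \<le> length xs + 1"
  by (induction xs arbitrary: j) (auto split: nat.split)

lemma val_drop_t [simp]: "val (drop_t j xs) = drop j xs"
  by (induction xs arbitrary: j) (auto split: nat.split)

lemma time_drop_t_le: "time (drop_t j xs) \<le> length xs + 1"
  by (induction xs arbitrary: j) (auto split: nat.split)

lemma val_delete_t [simp]: "val (delete_t j xs) = take j xs @ drop (Suc j) xs"
  by (induction xs arbitrary: j) (auto split: nat.split)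

lemma time_delete_t_le: "time (delete_t j xs) \<le> length xs + 1"
  by (induction xs arbitrary: j) (auto split: nat.split)

lemma val_update_t [simp]: "val (update_t j a xs) = xs[j := a]"
  by (induction xs arbitrary: j) (auto split: nat.split)

lemma time_update_t_le: "time (update_t j a xs) \<le> length xs + 1"
  by (induction xs arbitrary: j) (auto split: nat.split)

lemma val_replicate_t [simp]: "val (replicate_t k a) = replicate k a"
  by (induction k) auto

lemma time_replicate_t: "time (replicate_t k a) = k + 1"
  by (induction k) auto

lemma val_upto_t [simp]: "val (upto_t k) = [0..<k]"
  by (induction k) auto

lemma time_upto_t_le: "time (upto_t k) \<le> (k + 1) * (k + 1)"
  by (induction k) (auto simp: time_append_t)

primrec k_sublists :: "'a list \<Rightarrow> nat \<Rightarrow> 'a list list" where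
  "k_sublists [] k = (if k = 0 then [[]] else [])"
| "k_sublists (x # xs) k = (case k of
     0 \<Rightarrow> [[]] | Suc k' \<Rightarrow> map ((#) x) (k_sublists xs k') @ k_sublists xs k)"

lemma val_sublists_t [simp]: "val (sublists_t xs k) = k_sublists xs k"
  by (induction xs arbitrary: k) (auto split: nat.split simp: comp_def)

text \<open>Described by index sets, since the lists of directions and halfspaces may contain
  repetitions; this form also matches \<open>subseq_conv_nths\<close>, by which sublists of filtered
  lists are recognized as enumerated.\<close>

lemma set_k_sublists: "set (k_sublists xs k) = {nths xs N |N. length (nths xs N) = k}"
proof (induction xs arbitrary: k)
  case (Cons x xs)
  show ?case
  proof (cases k)
    case 0
    have "nths (x # xs) {} = []" by simp
    then show ?thesis using 0 by (auto intro!: exI[of _ "{}"])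
  next
    case (Suc k')
    have "{nths (x # xs) N |N. length (nths (x # xs) N) = k} =
       (#) x ` {nths xs N |N. length (nths xs N) = k'} \<union> {nths xs N |N. length (nths xs N) = k}"
      (is "?A = ?B \<union> ?C")
    proof (intro equalityI subsetI)
      fix s assume "s \<in> ?A"
      then show "s \<in> ?B \<union> ?C" using Suc by (auto simp: nths_Cons split: if_splits)
    next
      fix s assume "s \<in> ?B \<union> ?C"
      then consider N where "s = x # nths xs N" "length (nths xs N) = k'"
        | N where "s = nths xs N" "length (nths xs N) = k" by auto
      then show "s \<in> ?A"
      proof cases
        case 1
        then have "s = nths (x # xs) (insert 0 (Suc ` N))" by (simp add: nths_Cons image_iff)
        moreover have "length s = k" using 1 Suc by simp
        ultimately show ?thesis by blast
      next
        case 2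
        then have "s = nths (x # xs) (Suc ` N)" by (simp add: nths_Cons image_iff)
        moreover have "length s = k" using 2 by simp
        ultimately show ?thesis by blast
      qed
    qed
    then show ?thesis using Cons Suc by simp
  qed
qed auto

lemma length_k_sublists: "length (k_sublists xs k) = length xs choose k"
  by (induction xs arbitrary: k) (auto split: nat.split)

lemma binomial_le_power: "n choose k \<le> (n + 1) ^ k"
proof (cases "k \<le> n")
  case True
  then have "n choose k \<le> n ^ k" by (rule binomial_le_pow)
  also have "\<dots> \<le> (n + 1) ^ k" by (rule power_mono) auto
  finally show ?thesis .
qed (simp add: binomial_eq_0)

text \<open>The two leading terms of the binomial expansion. They mirror the recursion of
  \<open>sublists_t\<close>, where the head is either skipped or taken.\<close>

lemma binomial_first_terms: "N ^ (k + 2) + (k + 2) * N ^ (k + 1) \<le> (N + 1) ^ (k + 2)" for N :: nat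
proof (induction k)
  case (Suc k)
  have "N ^ (Suc k + 2) + (Suc k + 2) * N ^ (Suc k + 1) \<le> (N + 1) * (N ^ (k + 2) + (k + 2) * N ^ (k + 1))"
    by (simp add: algebra_simps)
  also have "\<dots> \<le> (N + 1) * (N + 1) ^ (k + 2)" using Suc by (intro mult_left_mono) auto
  finally show ?case by simp
qed (simp add: power2_eq_square)

lemma time_sublists_t_le: "time (sublists_t xs k) \<le> 4 * (length xs + 2) ^ (k + 1)"
proof (induction xs arbitrary: k)
  case Nil
  have "(1::nat) \<le> 2 ^ (k+1)" by simp
  then show ?case by (simp del: power_Suc)
next
  case (Cons x xs)
  let ?n = "length xs + 2"
  show ?case
  proof (cases k)
    case (Suc k')
    have 1: "time (map_t (\<lambda>s. tick (ret (x # s))) (k_sublists xs k')) \<le> ((length xs choose k') + 1) * 2"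
      using time_map_t_le[of "k_sublists xs k'" "\<lambda>s. tick (ret (x # s))" 1] by (simp add: length_k_sublists)
    have c: "(length xs choose k') \<le> ?n ^ k'"
      using binomial_le_power[of "length xs" k'] power_mono[of "length xs + 1" ?n k'] by simp
    have p: "1 \<le> ?n ^ k'" by simp
    have b: "?n ^ (k' + 2) + (k' + 2) * ?n ^ (k' + 1) \<le> (?n + 1) ^ (k' + 2)"
      by (rule binomial_first_terms)
    have "time (sublists_t (x # xs) k)
       \<le> 1 + 4 * ?n ^ (k' + 1) + 4 * ?n ^ (k' + 2) + 3 * (length xs choose k') + 3"
      using Cons.IH[of k'] Cons.IH[of "Suc k'"] 1
      by (simp add: Suc time_append_t length_k_sublists)
    also have "\<dots> \<le> 4 * ?n ^ (k' + 1) + 4 * ?n ^ (k' + 2) + 8 * ?n ^ k'"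
      using c p by linarith
    \<comment> \<open>Since \<open>?n\<close> is at least 2, the copying costs fit into a second
      multiple of \<open>?n ^ (k' + 1)\<close>, and the coefficient \<open>k' + 2 \<ge> 2\<close> of
      the binomial bound provides it.\<close>
    also have "\<dots> \<le> 4 * ?n ^ (k' + 1) + 4 * ?n ^ (k' + 2) + 4 * ?n ^ (k' + 1)" by simp
    also have "\<dots> \<le> 4 * (?n ^ (k' + 2) + (k' + 2) * ?n ^ (k' + 1))" by simp
    also have "\<dots> \<le> 4 * (?n + 1) ^ (k' + 2)" using b by (rule mult_left_mono) simp
    finally show ?thesis using Suc by (simp add: add.commute)
  qed simp
qed

section \<open>Values of the programs on numbers\<close>

lemma val_arith [simp]:
  "val (add_t sz a b) = a + b" "val (sub_t sz a b) = a - b" "val (mult_t sz a b) = a * b"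
  "val (div_t sz a b) = a / b" "val (le_t sz a b) = (a \<le> b)" "val (eq_t sz a b) = (a = b)"
  by (simp_all add: add_t_def sub_t_def mult_t_def div_t_def le_t_def eq_t_def)

lemma time_arith [simp]:
  "time (add_t sz a b) = arith_cost sz a b" "time (sub_t sz a b) = arith_cost sz a b"
  "time (mult_t sz a b) = arith_cost sz a b" "time (div_t sz a b) = arith_cost sz a b"
  "time (le_t sz a b) = arith_cost sz a b" "time (eq_t sz a b) = arith_cost sz a b"
  by (simp_all add: add_t_def sub_t_def mult_t_def div_t_def le_t_def eq_t_def)

lemma val_sum_t [simp]: "val (sum_t sz xs) = sum_list xs"
  by (induction xs) auto

lemma val_inner_t [simp]: "val (inner_t sz u v) = inner_list u v"
  by (simp add: inner_t_def inner_list_def)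

lemma val_negate_t [simp]: "val (negate_t sz u) = map uminus u"
  by (simp add: negate_t_def)

lemma val_min_t: "val (min_t sz x ys) = Min (set (x # ys))"
proof (induction ys arbitrary: x)
  case (Cons y ys)
  have "Min (set ((if x \<le> y then x else y) # ys)) = Min (set (x # y # ys))"
    by (cases "ys = []") (auto simp: min_def)
  then show ?case using Cons by simp
qed simp

lemma val_max_t: "val (max_t sz x ys) = Max (set (x # ys))"
proof (induction ys arbitrary: x)
  case (Cons y ys)
  have "Max (set ((if x \<le> y then y else x) # ys)) = Max (set (x # y # ys))"
    by (cases "ys = []") (auto simp: max_def)
  then show ?case using Cons by simp
qed simp

lemma val_insort_t [simp]: "val (insort_t sz x ys) = insort x ys"
  by (induction ys) auto

lemma val_sort_t [simp]: "val (sort_t sz xs) = sort xs"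
  by (induction xs) auto

primrec alternate :: "real list \<Rightarrow> real list" where
  "alternate [] = []"
| "alternate (x # xs) = x # map uminus (alternate xs)"

lemma val_alternate_t [simp]: "val (alternate_t sz xs) = alternate xs"
  by (induction xs) auto

lemma length_alternate [simp]: "length (alternate xs) = length xs"
  by (induction xs) auto

lemma nth_alternate: "j < length xs \<Longrightarrow> alternate xs ! j = (-1) ^ j * xs ! j"
  by (induction xs arbitrary: j) (auto simp: nth_Cons split: nat.split)

section \<open>Determinants and cofactors\<close>

hide_const (open) Determinants.det Finite_Cartesian_Product.mat Finite_Cartesian_Product.row
  Finite_Cartesian_Product.vec
unbundle no vec_syntax
unbundle no inner_syntax

lemma inner_list_eq_sum:
  "length u = n \<Longrightarrow> length v = n \<Longrightarrow> inner_list u v = (\<Sum>i<n. u ! i * v ! i)"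
  by (simp add: inner_list_def sum_list_sum_nth atLeast0LessThan)

lemma inner_list_commute: "inner_list u v = inner_list v u"
proof -
  have "map2 (*) u v = map2 (*) v u" for u v :: "real list"
    by (induction u arbitrary: v) (auto split: list.split simp: mult.commute zip_Cons)
  then show ?thesis by (simp add: inner_list_def)
qed

definition rows_mat :: "nat \<Rightarrow> real list list \<Rightarrow> real mat" where
  "rows_mat k M = mat k k (\<lambda>(i, j). M ! i ! j)"

definition mat_rows :: "nat \<Rightarrow> nat \<Rightarrow> real list list \<Rightarrow> bool" where
  "mat_rows k d M \<longleftrightarrow> length M = k \<and> (\<forall>r\<in>set M. length r = d)"

lemma rows_mat_carrier [simp]: "rows_mat k M \<in> carrier_mat k k"
  by (simp add: rows_mat_def)

definition cofactors :: "nat \<Rightarrow> real list list \<Rightarrow> real list" where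
  "cofactors d M = alternate (map (\<lambda>j. det (rows_mat (d - 1)
     (map (\<lambda>r. take j r @ drop (Suc j) r) M))) [0..<d])"

lemma length_cofactors [simp]: "length (cofactors d M) = d"
  by (simp add: cofactors_def)

text \<open>Laplace expansion along the prepended row: the minors do not involve r, so the
  determinant is a linear function of r, and the cofactors are its coefficients.\<close>

lemma inner_cofactors:
  assumes M: "mat_rows k (Suc k) M" and r: "length r = Suc k"
  shows "inner_list r (cofactors (Suc k) M) = det (rows_mat (Suc k) (r # M))"
proof -
  let ?A = "rows_mat (Suc k) (r # M)"
  have c: "cofactor ?A 0 j = cofactors (Suc k) M ! j" if j: "j < Suc k" for j
  proof -
    have "mat_delete ?A 0 j = rows_mat k (map (\<lambda>r. take j r @ drop (Suc j) r) M)"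
      using M j by (intro eq_matI)
        (auto simp: mat_delete_def rows_mat_def mat_rows_def nth_append min_def)
    then show ?thesis using j
      by (simp add: cofactor_def cofactors_def nth_alternate del: upt_Suc)
  qed
  have "det ?A = (\<Sum>j<Suc k. ?A $$ (0, j) * cofactor ?A 0 j)"
    by (rule laplace_expansion_row) auto
  also have "\<dots> = (\<Sum>j<Suc k. r ! j * cofactors (Suc k) M ! j)"
    by (intro sum.cong refl) (simp add: c, simp add: rows_mat_def)
  also have "\<dots> = inner_list r (cofactors (Suc k) M)"
    using r by (simp add: inner_list_eq_sum[of _ "Suc k"])
  finally show ?thesis by simp
qed

text \<open>The two claims need a joint induction: a determinant of size \<open>Suc k\<close> calls
  cofactors with minors of size k, while the cofactors of the next stage call determinants of size
  \<open>Suc k\<close>. In the step the determinant claim is therefore proved first and for all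
  matrices.\<close>

lemma val_det_t: "mat_rows k k M \<Longrightarrow> val (det_t sz k M) = det (rows_mat k M)"
  and val_cofactors_t:
    "mat_rows k (Suc k) M \<Longrightarrow> val (cofactors_t sz (det_t sz k) (Suc k) M) = cofactors (Suc k) M"
proof (induction k arbitrary: M)
  case 0
  {
    case 1 then show ?case by simp
  next
    case 2 then show ?case by (simp add: cofactors_t_def cofactors_def mat_rows_def rows_mat_def)
  }
next
  case (Suc k)
  have det: "val (det_t sz (Suc k) M) = det (rows_mat (Suc k) M)" if "mat_rows (Suc k) (Suc k) M" for M
  proof -
    from that obtain r M' where M: "M = r # M'" "length r = Suc k" "mat_rows k (Suc k) M'"
      by (auto simp: mat_rows_def length_Suc_conv)
    then show ?thesis by (simp add: Suc.IH(2) inner_cofactors)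
  qed
  {
    case 1 then show ?case by (rule det)
  next
    case 2
    then have "mat_rows (Suc k) (Suc k) (map (\<lambda>r. take j r @ drop (Suc j) r) M)"
      if "j < Suc (Suc k)" for j
      using that by (auto simp: mat_rows_def min_def)
    then have "val (det_t sz (Suc k) (map (\<lambda>r. take j r @ drop (Suc j) r) M)) =
        det (rows_mat (Suc k) (map (\<lambda>r. take j r @ drop (Suc j) r) M))"
      if "j < Suc (Suc k)" for j
      using that det by blast
    then show ?case
      by (auto simp: cofactors_t_def cofactors_def simp del: upt_Suc det_t.simps upto_t.simps intro!: arg_cong[where f = alternate])
  }
qed

lemma det_rows_mat_eq_0_iff:
  assumes M: "mat_rows k k M"
  shows "det (rows_mat k M) = 0 \<longleftrightarrow>
    (\<exists>v. length v = k \<and> v \<noteq> replicate k 0 \<and> (\<forall>r\<in>set M. inner_list r v = 0))"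
proof -
  have row: "(rows_mat k M *\<^sub>v vec_of_list v) $ i = inner_list (M ! i) v"
    if "length v = k" "i < k" for v i
    using M that by (simp add: rows_mat_def mat_rows_def scalar_prod_def inner_list_eq_sum[of _ k]
        row_def vec_of_list_index atLeast0LessThan)
  have zero: "vec_of_list v = 0\<^sub>v k \<longleftrightarrow> v = replicate k 0" if "length v = k" for v :: "real list"
    using that by (auto simp: vec_eq_iff list_eq_iff_nth_eq vec_of_list_index)
  have mult: "rows_mat k M *\<^sub>v vec_of_list v = 0\<^sub>v k \<longleftrightarrow> (\<forall>r\<in>set M. inner_list r v = 0)"
    if v: "length v = k" for v
  proof -
    have "rows_mat k M *\<^sub>v vec_of_list v = 0\<^sub>v k \<longleftrightarrow> (\<forall>i<k. inner_list (M ! i) v = 0)"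
      using row[OF v] by (auto simp: vec_eq_iff rows_mat_def)
    then show ?thesis using M by (auto simp: mat_rows_def all_set_conv_all_nth)
  qed
  have "det (rows_mat k M) = 0 \<longleftrightarrow>
    (\<exists>v. v \<in> carrier_vec k \<and> v \<noteq> 0\<^sub>v k \<and> rows_mat k M *\<^sub>v v = 0\<^sub>v k)"
    by (rule det_0_iff_vec_prod_zero) simp
  also have "\<dots> \<longleftrightarrow> (\<exists>v. length v = k \<and> vec_of_list v \<noteq> 0\<^sub>v k \<and> rows_mat k M *\<^sub>v vec_of_list v = 0\<^sub>v k)"
  proof
    assume "\<exists>v. v \<in> carrier_vec k \<and> v \<noteq> 0\<^sub>v k \<and> rows_mat k M *\<^sub>v v = 0\<^sub>v k"
    then obtain v where v: "v \<in> carrier_vec k" "v \<noteq> 0\<^sub>v k" "rows_mat k M *\<^sub>v v = 0\<^sub>v k" by auto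
    then show "\<exists>v. length v = k \<and> vec_of_list v \<noteq> 0\<^sub>v k \<and> rows_mat k M *\<^sub>v vec_of_list v = 0\<^sub>v k"
      by (intro exI[of _ "list_of_vec v"]) (auto simp: vec_list)
  next
    assume "\<exists>v. length v = k \<and> vec_of_list v \<noteq> 0\<^sub>v k \<and> rows_mat k M *\<^sub>v vec_of_list v = 0\<^sub>v k"
    then obtain v where "length v = k" "vec_of_list v \<noteq> 0\<^sub>v k" "rows_mat k M *\<^sub>v vec_of_list v = 0\<^sub>v k"
      by auto
    then show "\<exists>v. v \<in> carrier_vec k \<and> v \<noteq> 0\<^sub>v k \<and> rows_mat k M *\<^sub>v v = 0\<^sub>v k"
      by (intro exI[of _ "vec_of_list v"]) (auto intro: carrier_vecI)
  qed
  finally show ?thesis using zero mult by auto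
qed

text \<open>Prepending r to M repeats a row, so the determinant in \<open>inner_cofactors\<close>
  vanishes.\<close>

lemma cofactors_orthogonal:
  assumes M: "mat_rows k (Suc k) M" and r: "r \<in> set M"
  shows "inner_list r (cofactors (Suc k) M) = 0"
proof -
  obtain i where i: "i < k" "M ! i = r"
    using M r by (auto simp: mat_rows_def in_set_conv_nth)
  have "det (rows_mat (Suc k) (r # M)) = 0"
    by (rule det_identical_rows[of _ "Suc k" 0 "Suc i"])
      (use i M in \<open>auto simp: rows_mat_def row_def mat_rows_def\<close>)
  then show ?thesis using inner_cofactors[OF M] M r by (auto simp: mat_rows_def)
qed

text \<open>The right-hand side is written as \<open>inner_list r x\<close>, so overwriting entry j
  of every row replaces column j of the matrix by its product with x, as Cramer's rule
  requires.\<close>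

lemma cramer_rows:
  assumes M: "mat_rows k k M" and x: "length x = k" and j: "j < k"
  shows "det (rows_mat k (map (\<lambda>r. r[j := inner_list r x]) M)) = x ! j * det (rows_mat k M)"
proof -
  have "rows_mat k (map (\<lambda>r. r[j := inner_list r x]) M) =
      replace_col (rows_mat k M) (rows_mat k M *\<^sub>v vec_of_list x) j"
    using assms by (intro eq_matI) (auto simp: replace_col_def rows_mat_def mat_rows_def
        scalar_prod_def inner_list_eq_sum[of _ k] row_def vec_of_list_index atLeast0LessThan nth_list_update)
  also have "det \<dots> = x ! j * det (rows_mat k M)"
    using cramer_lemma_mat[of "rows_mat k M" k "vec_of_list x" j] x j
    by (simp add: vec_of_list_index carrier_vecI)
  finally show ?thesis .
qed

section \<open>Linear algebra with lists\<close>

definition axpy :: "real list \<Rightarrow> real \<Rightarrow> real list \<Rightarrow> real list" where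
  "axpy u s v = map2 (\<lambda>a b. a + s * b) u v"

lemma length_axpy [simp]: "length (axpy u s v) = min (length u) (length v)"
  by (simp add: axpy_def)

lemma inner_axpy:
  assumes "length g = n" "length u = n" "length v = n"
  shows "inner_list g (axpy u s v) = inner_list g u + s * inner_list g v"
  using assms by (simp add: inner_list_eq_sum[of _ n] axpy_def sum_distrib_left algebra_simps
      flip: sum.distrib)

lemma inner_axpy_left:
  assumes "length g = n" "length u = n" "length v = n"
  shows "inner_list (axpy u s v) g = inner_list u g + s * inner_list v g"
  using inner_axpy[OF assms] by (simp add: inner_list_commute)

lemma axpy_zero [simp]: "length u = length v \<Longrightarrow> axpy u 0 v = u"
  by (simp add: axpy_def list_eq_iff_nth_eq)

lemma inner_scale: "inner_list g (map ((*) c) u) = c * inner_list g u"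
proof (induction g arbitrary: u)
  case (Cons a g)
  then show ?case by (cases u) (auto simp: inner_list_def algebra_simps)
qed (simp add: inner_list_def)

lemma inner_uminus: "inner_list g (map uminus u) = - inner_list g u"
proof (induction g arbitrary: u)
  case (Cons a g)
  then show ?case by (cases u) (auto simp: inner_list_def algebra_simps)
qed (simp add: inner_list_def)

lemma inner_uminus_left: "inner_list (map uminus u) g = - inner_list u g"
  using inner_uminus by (simp add: inner_list_commute)

lemma inner_zero [simp]: "inner_list g (replicate k 0) = 0" "inner_list (replicate k 0) g = 0"
proof -
  show "inner_list g (replicate k 0) = 0" for g
    using inner_scale[of g 0 "replicate k 0"] by simp
  then show "inner_list (replicate k 0) g = 0" by (simp add: inner_list_commute)
qed

text \<open>The dual way of saying that A spans the m-dimensional space; it avoids linear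
  combinations of lists and, for m rows, is the nonvanishing of a determinant.\<close>

definition trivial_kernel :: "nat \<Rightarrow> real list set \<Rightarrow> bool" where
  "trivial_kernel m A \<longleftrightarrow>
     (\<forall>v. length v = m \<and> (\<forall>r\<in>A. inner_list r v = 0) \<longrightarrow> v = replicate m 0)"

lemma trivial_kernel_det:
  "mat_rows m m M \<Longrightarrow> trivial_kernel m (set M) \<longleftrightarrow> det (rows_mat m M) \<noteq> 0"
  by (auto simp: det_rows_mat_eq_0_iff trivial_kernel_def)

text \<open>Padding with zero rows gives a square matrix, and expansion along a zero row gives
  determinant 0.\<close>

lemma few_rows_kernel:
  assumes "\<forall>r\<in>set M. length r = m" and "length M < m"
  shows "\<not> trivial_kernel m (set M)"
proof
  let ?k = "length M"
  let ?M = "M @ replicate (m - ?k) (replicate m 0)"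
  assume "trivial_kernel m (set M)"
  then have "trivial_kernel m (set ?M)" by (auto simp: trivial_kernel_def)
  moreover have "det (rows_mat m ?M) = (\<Sum>j<m. rows_mat m ?M $$ (?k, j) * cofactor (rows_mat m ?M) ?k j)"
    using assms by (intro laplace_expansion_row) auto
  moreover have "rows_mat m ?M $$ (?k, j) = 0" if "j < m" for j
    using assms that by (simp add: rows_mat_def nth_append)
  moreover have "mat_rows m m ?M" using assms by (auto simp: mat_rows_def)
  ultimately show False using trivial_kernel_det[of m ?M] by simp
qed

definition unit_list :: "nat \<Rightarrow> nat \<Rightarrow> real list" where
  "unit_list m j = (replicate m 0)[j := 1]"

lemma length_unit_list [simp]: "length (unit_list m j) = m"
  by (simp add: unit_list_def)

lemma nth_unit_list: "i < m \<Longrightarrow> unit_list m j ! i = (if i = j then 1 else 0)"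
  by (simp add: unit_list_def nth_list_update)

lemma inner_unit_list:
  assumes "j < m" "length v = m"
  shows "inner_list (unit_list m j) v = v ! j"
proof -
  have "inner_list (unit_list m j) v = (\<Sum>i<m. unit_list m j ! i * v ! i)"
    using assms by (intro inner_list_eq_sum) auto
  also have "\<dots> = (\<Sum>i<m. if i = j then v ! i else 0)"
    by (intro sum.cong) (auto simp: nth_unit_list)
  finally show ?thesis using assms by simp
qed

lemma trivial_kernel_units:
  assumes "unit_list m ` {..<m} \<subseteq> A"
  shows "trivial_kernel m A"
  unfolding trivial_kernel_def
proof safe
  fix v :: "real list" assume v: "m = length v" "\<forall>r\<in>A. inner_list r v = 0"
  have "v ! j = 0" if "j < m" for j
    using v assms that inner_unit_list[of j m v] by force
  then show "v = replicate (length v) 0" using v by (simp add: list_eq_iff_nth_eq)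
qed

text \<open>Steinitz exchange: as many of the unit vectors as possible are replaced by members of L.\<close>

lemma spanning_sublist:
  assumes L: "\<forall>r\<in>set L. length r = m" and ker: "trivial_kernel m (set L)"
  obtains I where "length (nths L I) = m" "det (rows_mat m (nths L I)) \<noteq> 0"
proof -
  \<comment> \<open>E completes the chosen members of L to m vectors with trivial kernel, that is,
    to a basis. The unit vectors serve as E for the empty choice.\<close>
  define ok where "ok I \<longleftrightarrow> I \<subseteq> {..<length L} \<and> card I \<le> m \<and>
    (\<exists>E. length E = m - card I \<and> (\<forall>r\<in>set E. length r = m) \<and>
       trivial_kernel m (set (nths L I) \<union> set E))" for I
  have "ok {}"
    unfolding ok_def by (auto intro!: exI[of _ "map (unit_list m) [0..<m]"] trivial_kernel_units)
  moreover have "\<forall>I. ok I \<longrightarrow> card I < Suc m" by (auto simp: ok_def)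
  ultimately obtain I where I: "ok I" and max: "\<And>J. ok J \<Longrightarrow> card J \<le> card I"
    using ex_has_greatest_nat[of ok "{}" card "Suc m"] by blast
  obtain E where E: "length E = m - card I" "\<forall>r\<in>set E. length r = m"
      "trivial_kernel m (set (nths L I) \<union> set E)"
    and sub: "I \<subseteq> {..<length L}" "card I \<le> m"
    using I by (auto simp: ok_def)
  have finI: "finite I" using sub finite_subset by blast
  have len: "length (nths L J) = card J" if "J \<subseteq> {..<length L}" for J
  proof -
    have "{i. i < length L \<and> i \<in> J} = J" using that by auto
    then show ?thesis by (simp add: length_nths)
  qed
  have lenL: "length r = m" if "r \<in> set (nths L J)" for r J
    using that L set_nths_subset by force
  have "card I = m"
  proof (rule ccontr)
    assume "card I \<noteq> m"
    then obtain e E' where e: "E = e # E'" using E sub by (cases E) auto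
    \<comment> \<open>Without e only m - 1 vectors remain, so a nonzero v is orthogonal to all of
      them. Any member g of L that is not orthogonal to v can take the place of e.\<close>
    have "\<not> trivial_kernel m (set (nths L I @ E'))"
      using E e sub lenL len by (intro few_rows_kernel) auto
    then obtain v where v: "length v = m" "v \<noteq> replicate m 0"
        "\<forall>r\<in>set (nths L I) \<union> set E'. inner_list r v = 0"
      by (auto simp: trivial_kernel_def)
    have ev: "inner_list e v \<noteq> 0" using E v e by (auto simp: trivial_kernel_def)
    obtain g where g: "g \<in> set L" "inner_list g v \<noteq> 0"
      using ker v by (auto simp: trivial_kernel_def)
    then obtain j where j: "j < length L" "L ! j = g" by (auto simp: in_set_conv_nth)
    have "j \<notin> I" using j g v by (auto simp: set_nths)
    have ins: "set (nths L (insert j I)) = insert g (set (nths L I))"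
      using j by (auto simp: set_nths)
    have "trivial_kernel m (set (nths L (insert j I)) \<union> set E')"
      unfolding trivial_kernel_def
    proof safe
      fix w assume w: "m = length w" "\<forall>r\<in>set (nths L (insert j I)) \<union> set E'. inner_list r w = 0"
      \<comment> \<open>The shift along v makes w orthogonal to e as well, hence the sum is zero.
        Pairing it with g, which is orthogonal to w but not to v, then forces s = 0.\<close>
      define s where "s = - inner_list e w / inner_list e v"
      have s: "inner_list r (axpy w s v) = inner_list r w + s * inner_list r v" if "length r = m" for r
        using inner_axpy[OF that] w v by auto
      have "axpy w s v = replicate m 0"
        using E(3) unfolding trivial_kernel_def
      proof (elim allE impE conjE)
        have "inner_list r (axpy w s v) = 0" if "r \<in> set (nths L I) \<union> set E" for r
        proof (cases "r = e")
          case True then show ?thesis using s[of e] E e ev by (simp add: s_def)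
        next
          case False
          then have "inner_list r w = 0" "inner_list r v = 0" using that w v ins e by auto
          moreover have "length r = m" using that E lenL by auto
          ultimately show ?thesis using s by simp
        qed
        then show "length (axpy w s v) = m \<and> (\<forall>r\<in>set (nths L I) \<union> set E. inner_list r (axpy w s v) = 0)"
          using w v by simp
      qed
      then have "inner_list g (axpy w s v) = 0" by simp
      moreover have "inner_list g w = 0" using w ins by auto
      ultimately have "s = 0" using s[of g] g L by auto
      then show "w = replicate (length w) 0" using \<open>axpy w s v = replicate m 0\<close> w v by simp
    qed
    then have "ok (insert j I)"
      unfolding ok_def using sub j \<open>j \<notin> I\<close> finI \<open>card I \<noteq> m\<close> E e by (auto intro!: exI[of _ E'])
    from max[OF this] show False using \<open>j \<notin> I\<close> finI by simp
  qed
  then have "E = []" "length (nths L I) = m" using E len sub by auto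
  moreover have "mat_rows m m (nths L I)" using calculation lenL by (simp add: mat_rows_def)
  ultimately show thesis using that E trivial_kernel_det by auto
qed

section \<open>Vertices and rays\<close>

lemma finite_argmin:
  fixes q :: "'a \<Rightarrow> real"
  assumes "finite B" "B \<noteq> {}"
  obtains h where "h \<in> B" "\<And>k. k \<in> B \<Longrightarrow> q h \<le> q k"
  using ex_is_arg_min_if_finite[OF assms, of q] by (auto simp: is_arg_min_linorder)

definition feasible :: "nat \<Rightarrow> (real list \<times> real) set \<Rightarrow> real list set" where
  "feasible m H = {x. length x = m \<and> (\<forall>(u, t)\<in>H. t \<le> inner_list u x)}"

text \<open>The ratio test of the simplex method: along v the tight constraints stay tight, and the
  constraint with the smallest ratio is the first to block the way. It was not tight at x, because v
  is orthogonal to the tight ones.\<close>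

lemma feasible_pivot:
  assumes H: "finite H" "\<forall>(u, t)\<in>H. length u = m" and x: "x \<in> feasible m H"
    and v: "length v = m" "\<forall>(u, t)\<in>H. inner_list u x = t \<longrightarrow> inner_list u v = 0"
    and neg: "\<exists>(u, t)\<in>H. inner_list u v < 0"
  obtains s where "s \<ge> 0" "axpy x s v \<in> feasible m H"
    "{h\<in>H. inner_list (fst h) x = snd h} \<subset> {h\<in>H. inner_list (fst h) (axpy x s v) = snd h}"
proof -
  define B where "B = {h\<in>H. inner_list (fst h) v < 0}"
  define q where "q h = (snd h - inner_list (fst h) x) / inner_list (fst h) v" for h
  have lx: "length x = m" using x by (simp add: feasible_def)
  have "finite B" "B \<noteq> {}" using H neg by (auto simp: B_def)
  then obtain h where h: "h \<in> B" "\<And>k. k \<in> B \<Longrightarrow> q h \<le> q k"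
    using finite_argmin by metis
  have ge: "snd k \<le> inner_list (fst k) x" if "k \<in> H" for k
    using x that by (auto simp: feasible_def)
  have q: "q k \<ge> 0" if "k \<in> B" for k
    using that ge[of k] by (auto simp: B_def q_def divide_nonpos_neg)
  have ax: "inner_list (fst k) (axpy x s v) = inner_list (fst k) x + s * inner_list (fst k) v" if "k \<in> H" for k s
    using that H v lx by (intro inner_axpy) auto
  have tight: "inner_list (fst k) (axpy x (q k) v) = snd k" if "k \<in> B" for k
    using that ax[of k] by (auto simp: B_def q_def)
  show thesis
  proof (rule that)
    show "q h \<ge> 0" using q h by blast
    have "snd k \<le> inner_list (fst k) (axpy x (q h) v)" if k: "k \<in> H" for k
    proof (cases "k \<in> B")
      case True
      then have "inner_list (fst k) v < 0" by (simp add: B_def)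
      then have "q k * inner_list (fst k) v \<le> q h * inner_list (fst k) v"
        using h(2)[OF True] by (intro mult_right_mono_neg) auto
      then show ?thesis using ax[OF k, of "q h"] ax[OF k, of "q k"] tight[OF True] by linarith
    next
      case False
      then have "0 \<le> q h * inner_list (fst k) v" using k \<open>q h \<ge> 0\<close> by (simp add: B_def)
      then show ?thesis using ax[OF k, of "q h"] ge[OF k] by linarith
    qed
    then show "axpy x (q h) v \<in> feasible m H" using lx v by (auto simp: feasible_def)
    have "h \<in> H" "inner_list (fst h) v < 0" using h by (auto simp: B_def)
    moreover have "inner_list (fst h) x \<noteq> snd h"
      using \<open>h \<in> H\<close> v \<open>inner_list (fst h) v < 0\<close> by (cases h) force
    moreover have "inner_list (fst k) (axpy x (q h) v) = snd k" if "k \<in> H" "inner_list (fst k) x = snd k" for k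
      using ax[OF that(1), of "q h"] that v by (cases k) force
    ultimately show "{k\<in>H. inner_list (fst k) x = snd k} \<subset> {k\<in>H. inner_list (fst k) (axpy x (q h) v) = snd k}"
      using tight[OF h(1)] by blast
  qed
qed

text \<open>The recession cone is zero. This form of boundedness ignores the right-hand sides, so it
  also makes sense for infeasible systems and can be shown before feasibility is known.\<close>

definition bounded_system :: "nat \<Rightarrow> (real list \<times> real) set \<Rightarrow> bool" where
  "bounded_system m H \<longleftrightarrow>
     (\<forall>v. length v = m \<and> v \<noteq> replicate m 0 \<longrightarrow> (\<exists>(u, t)\<in>H. inner_list u v < 0))"

text \<open>Among the feasible points that are at least as good as x, one with the most tight constraints
  is a vertex: otherwise it could be moved orthogonally to them until one more gets tight.\<close>

lemma feasible_vertex: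
  assumes hs: "\<forall>(u, t)\<in>set hs. length u = m" and bd: "bounded_system m (set hs)"
    and x: "x \<in> feasible m (set hs)" and c: "length c = m"
  obtains S x' where "S \<in> set (k_sublists hs m)" "det (rows_mat m (map fst S)) \<noteq> 0"
    "\<forall>(u, t)\<in>set S. inner_list u x' = t" "x' \<in> feasible m (set hs)" "inner_list c x' \<le> inner_list c x"
proof -
  define tight where "tight z = {h\<in>set hs. inner_list (fst h) z = snd h}" for z
  define ok where "ok z \<longleftrightarrow> z \<in> feasible m (set hs) \<and> inner_list c z \<le> inner_list c x" for z
  have "\<forall>z. ok z \<longrightarrow> card (tight z) < Suc (card (set hs))"
    by (auto simp: tight_def less_Suc_eq_le intro!: card_mono)
  moreover have "ok x" using x by (simp add: ok_def)
  ultimately obtain z where z: "ok z" and max: "\<And>y. ok y \<Longrightarrow> card (tight y) \<le> card (tight z)"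
    using ex_has_greatest_nat[of ok x "\<lambda>z. card (tight z)" "Suc (card (set hs))"] by blast
  have lz: "length z = m" using z by (simp add: ok_def feasible_def)
  define T where "T = filter (\<lambda>h. inner_list (fst h) z = snd h) hs"
  have "trivial_kernel m (set (map fst T))"
  proof (rule ccontr)
    assume "\<not> trivial_kernel m (set (map fst T))"
    then obtain v0 where v0: "length v0 = m" "v0 \<noteq> replicate m 0" "\<forall>h\<in>set T. inner_list (fst h) v0 = 0"
      by (auto simp: trivial_kernel_def)
    \<comment> \<open>Of the two opposite directions in the kernel, the one that does not increase
      the objective c is taken.\<close>
    define v where "v = (if inner_list c v0 \<le> 0 then v0 else map uminus v0)"
    have neg0: "map uminus v0 \<noteq> replicate m 0"
    proof
      assume *: "map uminus v0 = replicate m 0"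
      have "v0 = map uminus (map uminus v0)" by (simp add: comp_def)
      then show False using v0 by (simp add: *)
    qed
    have v: "length v = m" "v \<noteq> replicate m 0" "\<forall>h\<in>set T. inner_list (fst h) v = 0" "inner_list c v \<le> 0"
      using v0 neg0 by (auto simp: v_def inner_uminus)
    obtain s where s: "s \<ge> 0" "axpy z s v \<in> feasible m (set hs)" "tight z \<subset> tight (axpy z s v)"
    proof (rule feasible_pivot[of "set hs" m z v])
      show "\<exists>(u, t)\<in>set hs. inner_list u v < 0" using bd v by (auto simp: bounded_system_def)
      show "\<forall>(u, t)\<in>set hs. inner_list u z = t \<longrightarrow> inner_list u v = 0"
        using v by (auto simp: T_def)
    qed (use hs z v in \<open>auto simp: ok_def tight_def\<close>)
    have "s * inner_list c v \<le> 0" using s v by (simp add: mult_nonneg_nonpos)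
    then have "ok (axpy z s v)" using s z inner_axpy[OF c lz v(1), of s] by (auto simp: ok_def)
    moreover have "card (tight z) < card (tight (axpy z s v))"
      using s by (intro psubset_card_mono) (auto simp: tight_def)
    ultimately show False using max by (simp add: leD)
  qed
  moreover have "\<forall>r\<in>set (map fst T). length r = m" using hs by (auto simp: T_def)
  ultimately obtain I where I: "length (nths (map fst T) I) = m" "det (rows_mat m (nths (map fst T) I)) \<noteq> 0"
    using spanning_sublist by blast
  define S where "S = nths T I"
  \<comment> \<open>A subsequence of the tight constraints is one of hs, so this system is among
    those that the program enumerates.\<close>
  have "subseq S hs" unfolding S_def T_def
    by (rule subseq_order.order_trans[OF _ subseq_filter_left]) (auto simp: subseq_conv_nths)
  show thesis
  proof (rule that)
    show "S \<in> set (k_sublists hs m)"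
      using \<open>subseq S hs\<close> I unfolding set_k_sublists subseq_conv_nths
      by (auto simp: S_def nths_map)
    show "\<forall>(u, t)\<in>set S. inner_list u z = t"
      using set_nths_subset[of T I] by (auto simp: S_def T_def)
  qed (use I z in \<open>auto simp: S_def nths_map ok_def\<close>)
qed

text \<open>The directions compatible with u: the closure of the cell containing u in the arrangement of
  the hyperplanes orthogonal to the members of G.\<close>

definition cell :: "nat \<Rightarrow> real list set \<Rightarrow> real list \<Rightarrow> real list set" where
  "cell d G u = {v. length v = d \<and> (\<forall>g\<in>G. (inner_list g u \<ge> 0 \<longrightarrow> inner_list g v \<ge> 0) \<and>
      (inner_list g u \<le> 0 \<longrightarrow> inner_list g v \<le> 0))}"

text \<open>B collects the hyperplanes that strictly separate u from v; outside the closed cell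
  there is at least one. The first one hit when moving from u along v determines s; until then no
  sign flips, and s > 0 because u is on none of them.\<close>

lemma cell_pivot:
  assumes G: "finite G" "\<forall>g\<in>G. length g = d" and u: "length u = d"
    and v: "length v = d" "\<forall>g\<in>G. inner_list g u = 0 \<longrightarrow> inner_list g v = 0" and nv: "v \<notin> cell d G u"
  obtains s where "s > 0" "axpy u s v \<in> cell d G u"
    "{g\<in>G. inner_list g u = 0} \<subset> {g\<in>G. inner_list g (axpy u s v) = 0}"
proof -
  define B where "B = {g\<in>G. inner_list g u * inner_list g v < 0}"
  define q where "q g = - inner_list g u / inner_list g v" for g
  have "B \<noteq> {}"
  proof
    assume "B = {}"
    then have "v \<in> cell d G u"
      using v unfolding cell_def B_def by (force simp: mult_less_0_iff order.order_iff_strict)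
    then show False using nv by simp
  qed
  then obtain g where g: "g \<in> B" "\<And>k. k \<in> B \<Longrightarrow> q g \<le> q k"
    using finite_argmin[of B q] G by (auto simp: B_def)
  have ax: "inner_list k (axpy u s v) = inner_list k u + s * inner_list k v" if "k \<in> G" for k s
    using that G u v by (intro inner_axpy) auto
  have pos: "q k > 0" if "k \<in> B" for k
    using that by (auto simp: B_def q_def mult_less_0_iff divide_neg_pos divide_pos_neg)
  have tight: "inner_list k (axpy u (q k) v) = 0" if "k \<in> B" for k
    using that ax[of k] by (auto simp: B_def q_def)
  show thesis
  proof (rule that)
    show "q g > 0" using g pos by blast
    have "(inner_list k u \<ge> 0 \<longrightarrow> inner_list k (axpy u (q g) v) \<ge> 0) \<and>
          (inner_list k u \<le> 0 \<longrightarrow> inner_list k (axpy u (q g) v) \<le> 0)" if k: "k \<in> G" for k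
    proof (cases "k \<in> B")
      case True
      define a b where "a = inner_list k u" and "b = inner_list k v"
      have 1: "a + q k * b = 0" using tight[OF True] ax[OF k] by (simp add: a_def b_def)
      have 2: "a * b < 0" using True by (simp add: B_def a_def b_def)
      have 3: "q g \<le> q k" using g True by blast
      have "a > 0 \<Longrightarrow> q k * b \<le> q g * b" "a < 0 \<Longrightarrow> q k * b \<ge> q g * b"
        using 2 3 by (auto simp: mult_less_0_iff intro: mult_right_mono_neg mult_right_mono)
      moreover have "a \<noteq> 0" using 2 by auto
      ultimately have "a > 0 \<and> a + q g * b \<ge> 0 \<or> a < 0 \<and> a + q g * b \<le> 0"
        using 1 by linarith
      then show ?thesis using ax[OF k, of "q g"] unfolding a_def b_def by auto
    next
      case False
      define a b where "a = inner_list k u" and "b = inner_list k v"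
      have "a * b \<ge> 0" "a = 0 \<Longrightarrow> b = 0" using False k v by (auto simp: B_def a_def b_def)
      then have "(a \<ge> 0 \<and> q g * b \<ge> 0) \<or> (a \<le> 0 \<and> q g * b \<le> 0)" "a = 0 \<Longrightarrow> q g * b = 0"
        using \<open>q g > 0\<close> by (auto simp: zero_le_mult_iff mult_le_0_iff)
      then show ?thesis using ax[OF k, of "q g"] unfolding a_def b_def by fastforce
    qed
    then show "axpy u (q g) v \<in> cell d G u" using u v by (auto simp: cell_def)
    have "g \<in> G" "inner_list g u \<noteq> 0" using g by (auto simp: B_def)
    moreover have "inner_list k (axpy u (q g) v) = 0" if "k \<in> G" "inner_list k u = 0" for k
      using ax[OF that(1), of "q g"] that v by simp
    ultimately show "{k\<in>G. inner_list k u = 0} \<subset> {k\<in>G. inner_list k (axpy u (q g) v) = 0}"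
      using tight[OF g(1)] by blast
  qed
qed

text \<open>The members of G orthogonal to u become spanning when g is added, so k of them are
  independent and the vectors orthogonal to these form a line. Both u and the generalized cross
  product lie on this line.\<close>

lemma parallel_cofactors:
  assumes G: "\<forall>g\<in>set G. length g = Suc k" and u: "length u = Suc k" and g: "length g = Suc k" "inner_list g u \<noteq> 0"
    and ker: "trivial_kernel (Suc k) (insert g {h\<in>set G. inner_list h u = 0})"
  obtains M c where "M \<in> set (k_sublists G k)" "c \<noteq> 0" "cofactors (Suc k) M = map ((*) c) u"
proof -
  define Z where "Z = filter (\<lambda>h. inner_list h u = 0) G"
  have len: "\<forall>r\<in>set (g # Z). length r = Suc k" using G g by (auto simp: Z_def)
  obtain I where I: "length (nths (g # Z) I) = Suc k" "det (rows_mat (Suc k) (nths (g # Z) I)) \<noteq> 0"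
    using spanning_sublist[OF len] ker by (auto simp: Z_def)
  define M where "M = nths Z {j. Suc j \<in> I}"
  have setM: "set M \<subseteq> set Z" unfolding M_def by (rule set_nths_subset)
  \<comment> \<open>The basis must use g: all other candidates are orthogonal to the nonzero vector
    u.\<close>
  have "0 \<in> I"
  proof (rule ccontr)
    assume "0 \<notin> I"
    then have eq: "nths (g # Z) I = M" by (simp add: nths_Cons M_def)
    then have "mat_rows (Suc k) (Suc k) M" using I len setM by (auto simp: mat_rows_def)
    then have "trivial_kernel (Suc k) (set M)" using I eq trivial_kernel_det by simp
    then have "u = replicate (Suc k) 0" using u setM by (auto simp: trivial_kernel_def Z_def)
    then show False using g by (metis inner_zero(1))
  qed
  then have eq: "nths (g # Z) I = g # M" by (simp add: nths_Cons M_def)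
  have M: "mat_rows k (Suc k) M" using I eq setM len by (auto simp: mat_rows_def)
  have gM: "mat_rows (Suc k) (Suc k) (g # M)" using M g by (auto simp: mat_rows_def)
  \<comment> \<open>With this factor the cofactors minus c times u are orthogonal to g; they are
    orthogonal to M in any case, and hence zero.\<close>
  define c where "c = inner_list g (cofactors (Suc k) M) / inner_list g u"
  have gc: "inner_list g (cofactors (Suc k) M) \<noteq> 0" using I inner_cofactors[OF M g(1)] eq by simp
  have "axpy (cofactors (Suc k) M) (- c) u = replicate (Suc k) 0"
  proof -
    have "inner_list r (axpy (cofactors (Suc k) M) (- c) u) = 0" if "r \<in> set (g # M)" for r
    proof -
      have "length r = Suc k" using that gM by (auto simp: mat_rows_def)
      then have "inner_list r (axpy (cofactors (Suc k) M) (- c) u) =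
          inner_list r (cofactors (Suc k) M) + (- c) * inner_list r u"
        using u by (intro inner_axpy) auto
      moreover have "r \<in> set M \<Longrightarrow> inner_list r u = 0" using setM by (auto simp: Z_def)
      ultimately show ?thesis
        using that cofactors_orthogonal[OF M] g by (auto simp: c_def)
    qed
    then show ?thesis using trivial_kernel_det[OF gM] I eq u by (auto simp: trivial_kernel_def)
  qed
  then have "cofactors (Suc k) M ! i - c * u ! i = 0" if "i < Suc k" for i
    using that u nth_map[of i "zip (cofactors (Suc k) M) u"]
    by (auto simp: axpy_def list_eq_iff_nth_eq simp del: replicate_Suc upt_Suc)
  then have "cofactors (Suc k) M = map ((*) c) u" using u by (auto simp: list_eq_iff_nth_eq)
  moreover have "subseq M G" unfolding M_def Z_def
    by (rule subseq_order.order_trans[OF _ subseq_filter_left]) (auto simp: subseq_conv_nths)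
  then have "M \<in> set (k_sublists G k)" using M by (auto simp: set_k_sublists subseq_conv_nths mat_rows_def)
  moreover have "c \<noteq> 0" using gc g by (simp add: c_def)
  ultimately show thesis using that by blast
qed

text \<open>Among the directions where f is positive, one that is orthogonal to the most members of G lies
  on a ray.\<close>

lemma positive_on_ray:
  assumes G: "\<forall>g\<in>set G. length g = Suc k" and span: "trivial_kernel (Suc k) (set G)"
    and lin: "\<And>u. length u = Suc k \<Longrightarrow> \<exists>a. length a = Suc k \<and> (\<forall>v\<in>cell (Suc k) (set G) u. f v = inner_list a v)"
    and u: "length u = Suc k" "f u > 0"
  obtains M where "M \<in> set (k_sublists G k)"
    "f (cofactors (Suc k) M) > 0 \<or> f (map uminus (cofactors (Suc k) M)) > 0"
proof -
  define zs where "zs z = {g\<in>set G. inner_list g z = 0}" for z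
  define ok where "ok z \<longleftrightarrow> length z = Suc k \<and> f z > 0" for z
  have "\<forall>z. ok z \<longrightarrow> card (zs z) < Suc (card (set G))"
    by (auto simp: zs_def less_Suc_eq_le intro!: card_mono)
  moreover have "ok u" using u by (simp add: ok_def)
  ultimately obtain z where z: "ok z" and max: "\<And>y. ok y \<Longrightarrow> card (zs y) \<le> card (zs z)"
    using ex_has_greatest_nat[of ok u "\<lambda>z. card (zs z)" "Suc (card (set G))"] by blast
  have max': "\<not> zs z \<subset> zs y" if "ok y" for y
    using max[OF that] psubset_card_mono[of "zs y" "zs z"] by (auto simp: zs_def)
  have lz: "length z = Suc k" "f z > 0" using z by (auto simp: ok_def)
  obtain a where a: "length a = Suc k" "\<And>v. v \<in> cell (Suc k) (set G) z \<Longrightarrow> f v = inner_list a v"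
    using lin lz by blast
  have "z \<in> cell (Suc k) (set G) z" using lz by (simp add: cell_def)
  then have az: "inner_list a z > 0" using a lz by simp
  then have "z \<noteq> replicate (Suc k) 0" by (metis inner_zero(1) less_irrefl)
  then obtain g where g: "g \<in> set G" "inner_list g z \<noteq> 0"
    using span lz unfolding trivial_kernel_def by blast
  \<comment> \<open>This says that z spans a ray: the common kernel of \<open>zs z\<close> is a
    line, on which g does not vanish.\<close>
  have "trivial_kernel (Suc k) (insert g (zs z))"
  proof (rule ccontr)
    assume "\<not> ?thesis"
    then obtain v where v: "length v = Suc k" "v \<noteq> replicate (Suc k) 0" "inner_list g v = 0"
        "\<forall>h\<in>zs z. inner_list h v = 0"
      by (auto simp: trivial_kernel_def)
    \<comment> \<open>If w left the closed cell, moving from z along w would gain a zero while f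
      stays positive. If \<open>inner_list a w\<close> were positive, w itself would have all zeros
      of z and also g. Both contradict the choice of z.\<close>
    have key: "w \<in> cell (Suc k) (set G) z \<and> inner_list a w = 0"
      if w: "length w = Suc k" "inner_list g w = 0" "\<forall>h\<in>zs z. inner_list h w = 0" "inner_list a w \<ge> 0" for w
    proof -
      have "w \<in> cell (Suc k) (set G) z"
      proof (rule ccontr)
        assume "w \<notin> cell (Suc k) (set G) z"
        then obtain s where s: "s > 0" "axpy z s w \<in> cell (Suc k) (set G) z" "zs z \<subset> zs (axpy z s w)"
          using cell_pivot[of "set G" "Suc k" z w] G lz w unfolding zs_def by auto
        have "f (axpy z s w) = inner_list a z + s * inner_list a w"
          using a s inner_axpy[OF a(1) lz(1) w(1)] by simp
        moreover have "s * inner_list a w \<ge> 0" using s w by simp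
        ultimately have "f (axpy z s w) > 0" using az by linarith
        then have "ok (axpy z s w)" using lz w by (simp add: ok_def)
        then show False using max' s by blast
      qed
      moreover have "inner_list a w = 0"
      proof (rule ccontr)
        assume "inner_list a w \<noteq> 0"
        then have "ok w" using w a calculation by (auto simp: ok_def)
        moreover have "zs z \<subset> zs w" using w g by (auto simp: zs_def)
        ultimately show False using max' by blast
      qed
      ultimately show ?thesis by blast
    qed
    have nv: "inner_list h (map uminus v) = - inner_list h v" for h by (rule inner_uminus)
    have both: "v \<in> cell (Suc k) (set G) z \<and> map uminus v \<in> cell (Suc k) (set G) z"
    proof (cases "inner_list a v \<ge> 0")
      case True
      then have "v \<in> cell (Suc k) (set G) z \<and> inner_list a v = 0" using key v by blast
      then show ?thesis using key[of "map uminus v"] v nv by auto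
    next
      case False
      then show ?thesis using key[of "map uminus v"] v nv by auto
    qed
    \<comment> \<open>A vector that lies in the closed cell together with its negative is orthogonal
      to all of G. Here the arrangement being pointed is used.\<close>
    have "inner_list h v = 0" if "h \<in> set G" for h
      using both that nv[of h] unfolding cell_def by fastforce
    then show False using span v by (auto simp: trivial_kernel_def)
  qed
  then obtain M c where M: "M \<in> set (k_sublists G k)" "c \<noteq> 0" "cofactors (Suc k) M = map ((*) c) z"
    using parallel_cofactors[OF G lz(1), of g] g G unfolding zs_def by auto
  \<comment> \<open>The cross product is a multiple of z of unknown sign, and f is positive on
    positive multiples only; hence both the cofactors and their negatives are candidates.\<close>
  have pos: "f (map ((*) b) z) > 0" if "b > 0" for b
  proof -
    have "map ((*) b) z \<in> cell (Suc k) (set G) z"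
      using that lz by (auto simp: cell_def inner_scale zero_le_mult_iff mult_le_0_iff)
    then show ?thesis using a az that by (simp add: inner_scale)
  qed
  have "map uminus (map ((*) c) z) = map ((*) (- c)) z" by simp
  then have "f (cofactors (Suc k) M) > 0 \<or> f (map uminus (cofactors (Suc k) M)) > 0"
    using pos[of c] pos[of "- c"] M by (cases "c > 0") (auto simp del: map_map)
  then show thesis using that M by blast
qed

section \<open>Tukey depth regions\<close>

lemma unit_sphere_nonempty: "0 < d \<Longrightarrow> unit_list d 0 \<in> unit_sphere d"
  by (simp add: unit_sphere_def inner_unit_list nth_unit_list)

lemma inner_scale_left: "inner_list (map ((*) c) u) g = c * inner_list u g"
  using inner_scale by (simp add: inner_list_commute)

lemma inner_self_pos:
  assumes "length u = d" "u \<noteq> replicate d 0"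
  shows "inner_list u u > 0"
proof -
  obtain j where j: "j < d" "u ! j \<noteq> 0" using assms by (auto simp: list_eq_iff_nth_eq)
  then have "0 < (\<Sum>i<d. u ! i * u ! i)" by (intro sum_pos2[of _ j]) (auto simp: zero_less_mult_iff)
  then show ?thesis using assms inner_list_eq_sum[of u d u] by simp
qed

context
  fixes d :: nat and P :: "real list set"
  assumes d: "0 < d" and finP: "finite P" and lenP: "\<forall>p\<in>P. length p = d"
begin

lemma finite_counts: "finite ((\<lambda>u. card {p \<in> P. inner_list p u \<le> inner_list x u}) ` unit_sphere d)"
  by (rule finite_subset[of _ "{..card P}"]) (auto intro!: card_mono simp: finP)

lemma TD_ge_sphere:
  "\<kappa> \<le> TD d P x \<longleftrightarrow> (\<forall>u\<in>unit_sphere d. \<kappa> \<le> card {p \<in> P. inner_list p u \<le> inner_list x u})"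
  using unit_sphere_nonempty[OF d] finite_counts unfolding TD_def by (subst Min_ge_iff) auto

text \<open>The counts are invariant under positive scaling of u. Quantifying over nonzero vectors
  fits the generalized cross products, which are not normalized.\<close>

lemma TD_ge:
  "\<kappa> \<le> TD d P x \<longleftrightarrow> (\<forall>u. length u = d \<and> u \<noteq> replicate d 0 \<longrightarrow>
     \<kappa> \<le> card {p \<in> P. inner_list u p \<le> inner_list u x})"
  unfolding TD_ge_sphere
proof safe
  fix u :: "real list" assume *: "\<forall>v\<in>unit_sphere (length u). \<kappa> \<le> card {p \<in> P. inner_list p v \<le> inner_list x v}"
    and u: "u \<noteq> replicate (length u) 0" "d = length u"
  define c where "c = 1 / sqrt (inner_list u u)"
  have pos: "inner_list u u > 0" using inner_self_pos u by blast
  then have c: "c > 0" "c * c * inner_list u u = 1"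
    by (simp_all add: c_def field_simps)
  have "inner_list (map ((*) c) u) (map ((*) c) u) = c * c * inner_list u u"
    by (simp add: inner_scale inner_scale_left)
  then have "map ((*) c) u \<in> unit_sphere (length u)" using c by (simp add: unit_sphere_def)
  then have "\<kappa> \<le> card {p \<in> P. inner_list p (map ((*) c) u) \<le> inner_list x (map ((*) c) u)}" using * by blast
  also have "{p \<in> P. inner_list p (map ((*) c) u) \<le> inner_list x (map ((*) c) u)} =
     {p \<in> P. inner_list u p \<le> inner_list u x}"
    using c(1) by (simp add: inner_scale inner_list_commute[of u])
  finally show "\<kappa> \<le> card {p \<in> P. inner_list u p \<le> inner_list u x}" .
next
  fix u assume *: "\<forall>u. length u = d \<and> u \<noteq> replicate d 0 \<longrightarrow> \<kappa> \<le> card {p \<in> P. inner_list u p \<le> inner_list u x}"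
    and u: "u \<in> unit_sphere d"
  have "u \<noteq> replicate d 0" using u inner_zero(1)[of u d] by (auto simp: unit_sphere_def simp del: inner_zero)
  then show "\<kappa> \<le> card {p \<in> P. inner_list p u \<le> inner_list x u}"
    using * u by (auto simp: unit_sphere_def inner_list_commute)
qed

text \<open>On the moment curve, being orthogonal to v means that t is a root of the polynomial with
  coefficient list v.\<close>

lemma moment_curve: "inner_list v (map (\<lambda>j. t ^ j) [0..<length v]) = poly (Poly v) t"
proof (induction v)
  case (Cons a v)
  have "map (\<lambda>j. t ^ j) [0..<length (a # v)] = 1 # map ((*) t) (map (\<lambda>j. t ^ j) [0..<length v])"
    by (simp add: map_upt_Suc del: upt_Suc)
  then show ?case using Cons inner_scale[of v t] by (simp add: inner_list_def del: upt_Suc map_map)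
qed (simp add: inner_list_def)

text \<open>Each member of V excludes only finitely many parameters t of the moment curve, and a
  point of the curve is nonzero because its first coordinate is 1.\<close>

lemma generic_direction:
  assumes "finite V" "\<forall>v\<in>V. length v = d \<and> v \<noteq> replicate d 0"
  obtains u where "length u = d" "u \<noteq> replicate d 0" "\<forall>v\<in>V. inner_list v u \<noteq> 0"
proof -
  have "Poly v \<noteq> 0" if "v \<in> V" for v
    using assms that by (auto simp: Poly_eq_0)
  then have "finite (\<Union>v\<in>V. {t. poly (Poly v) t = 0})"
    using assms poly_roots_finite by blast
  from ex_new_if_finite[OF infinite_UNIV_char_0 this]
  obtain t where "t \<notin> (\<Union>v\<in>V. {t. poly (Poly v) t = 0})" by (rule exE)
  then have t: "\<forall>v\<in>V. poly (Poly v) t \<noteq> 0" by simp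
  define u where "u = map (\<lambda>j. t ^ j) [0..<d]"
  have "u ! 0 \<noteq> replicate d 0 ! 0" using d by (simp add: u_def)
  then have "u \<noteq> replicate d 0" by metis
  moreover have "inner_list v u \<noteq> 0" if "v \<in> V" for v
    using t that assms moment_curve[of v t] by (auto simp: u_def)
  ultimately show thesis using that[of u] by (auto simp: u_def)
qed

text \<open>In a direction that separates x from all other data points, the two opposite closed
  halfspaces bounded at x have at most x in common. Their counts add up to at most n + 1, and the
  depth is at most the smaller one.\<close>

lemma TD_le_half:
  assumes x: "length x = d"
  shows "TD d P x \<le> (card P + 1) div 2"
proof -
  have "length (axpy p (-1) x) = d \<and> axpy p (-1) x \<noteq> replicate d 0" if "p \<in> P - {x}" for p
  proof -
    have "p ! i = x ! i" if "axpy p (-1) x = replicate d 0" "i < d" for i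
      using that \<open>p \<in> P - {x}\<close> lenP x by (auto simp: axpy_def list_eq_iff_nth_eq)
    then show ?thesis using that lenP x by (auto simp: list_eq_iff_nth_eq)
  qed
  then obtain u where u: "length u = d" "u \<noteq> replicate d 0" "\<forall>p\<in>P - {x}. inner_list (axpy p (-1) x) u \<noteq> 0"
    using generic_direction[of "(\<lambda>p. axpy p (-1) x) ` (P - {x})"] finP by auto
  have ne: "inner_list u p \<noteq> inner_list u x" if "p \<in> P" "p \<noteq> x" for p
    using u that inner_axpy_left[of u d p x "-1"] lenP x by (auto simp: inner_list_commute)
  have mu: "map uminus u \<noteq> replicate d 0"
  proof
    assume "map uminus u = replicate d 0"
    then have "map uminus (map uminus u) = replicate d 0" by simp
    then show False using u by (simp add: comp_def)
  qed
  let ?A = "{p \<in> P. inner_list u p \<le> inner_list u x}" and ?B = "{p \<in> P. inner_list u x \<le> inner_list u p}"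
  have "TD d P x \<le> card ?A" using TD_ge[of "TD d P x" x] u by simp
  moreover have "TD d P x \<le> card ?B"
    using TD_ge[of "TD d P x" x] u mu by (auto simp: inner_uminus_left dest!: spec[of _ "map uminus u"])
  moreover have "card ?A + card ?B = card (?A \<union> ?B) + card (?A \<inter> ?B)"
    using finP by (intro card_Un_Int) auto
  moreover have "card (?A \<union> ?B) \<le> card P" using finP by (intro card_mono) auto
  moreover have "card (?A \<inter> ?B) \<le> card {x}" using ne by (intro card_mono) (auto intro: ccontr)
  ultimately show ?thesis by simp
qed

lemma TD_le_card: "TD d P x \<le> card P"
proof -
  have "TD d P x \<le> card {p \<in> P. inner_list p (unit_list d 0) \<le> inner_list x (unit_list d 0)}"
    using TD_ge_sphere[of "TD d P x" x] unit_sphere_nonempty[OF d] by simp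
  also have "\<dots> \<le> card P" using finP by (intro card_mono) auto
  finally show ?thesis .
qed

end

section \<open>Order statistics in a direction and the candidate normals\<close>

lemma sorted_nth_le_iff:
  fixes ss :: "real list"
  shows "sorted ss \<Longrightarrow> 1 \<le> k \<Longrightarrow> k \<le> length ss \<Longrightarrow>
    ss ! (k - 1) \<le> a \<longleftrightarrow> k \<le> length (filter (\<lambda>t. t \<le> a) ss)"
proof (induction ss arbitrary: k)
  case (Cons x ss)
  show ?case
  proof (cases "x \<le> a")
    case True
    show ?thesis
    proof (cases "k = 1")
      case False
      then obtain j where "k = Suc j" "1 \<le> j" using Cons.prems by (cases k) auto
      then show ?thesis using True Cons.IH[of j] Cons.prems by (auto simp: nth_Cons split: nat.split)
    qed (simp add: True)
  next
    case False
    then have "filter (\<lambda>t. t \<le> a) (x # ss) = []" using Cons.prems by (auto simp: filter_empty_conv)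
    moreover have "x \<le> (x # ss) ! (k - 1)" using Cons.prems sorted_nth_mono[of "x # ss" 0 "k - 1"] by simp
    ultimately show ?thesis using False Cons.prems by (auto simp del: filter.simps)
  qed
qed simp

definition order_stat :: "real list list \<Rightarrow> nat \<Rightarrow> real list \<Rightarrow> real" where
  "order_stat ps \<kappa> u = sort (map (inner_list u) ps) ! (\<kappa> - 1)"

lemma order_stat_le_iff:
  assumes "distinct ps" "1 \<le> \<kappa>" "\<kappa> \<le> length ps"
  shows "order_stat ps \<kappa> u \<le> a \<longleftrightarrow> \<kappa> \<le> card {p \<in> set ps. inner_list u p \<le> a}"
proof -
  have "order_stat ps \<kappa> u \<le> a \<longleftrightarrow> \<kappa> \<le> length (filter (\<lambda>t. t \<le> a) (sort (map (inner_list u) ps)))"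
    unfolding order_stat_def using assms by (intro sorted_nth_le_iff) auto
  also have "length (filter (\<lambda>t. t \<le> a) (sort (map (inner_list u) ps))) =
      length (filter (\<lambda>t. t \<le> a) (map (inner_list u) ps))"
    by (simp flip: size_mset)
  also have "\<dots> = length (filter (\<lambda>p. inner_list u p \<le> a) ps)"
    by (simp add: filter_map comp_def)
  also have "\<dots> = card {p \<in> set ps. inner_list u p \<le> a}"
    using assms distinct_card[of "filter (\<lambda>p. inner_list u p \<le> a) ps"] by simp
  finally show ?thesis .
qed

definition directions :: "nat \<Rightarrow> real list list \<Rightarrow> real list list" where
  "directions d ps = concat (map (\<lambda>p. map (\<lambda>q. map2 (-) p q) ps) ps) @ map (unit_list d) [0..<d]"

definition normals :: "nat \<Rightarrow> real list list \<Rightarrow> real list list" where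
  "normals d ps = (let us = map (cofactors d) (k_sublists (directions d ps) (d - 1))
     in us @ map (map uminus) us)"

lemma length_directions:
  assumes "\<forall>p\<in>set ps. length p = d" "g \<in> set (directions d ps)"
  shows "length g = d"
  using assms by (auto simp: directions_def)

lemma mat_rows_directions:
  assumes "\<forall>p\<in>set ps. length p = d" "M \<in> set (k_sublists (directions d ps) k)"
  shows "mat_rows k d M"
  using assms length_directions[OF assms(1)] set_nths_subset[of "directions d ps"]
  by (force simp: mat_rows_def set_k_sublists)

lemma length_normals: "u \<in> set (normals d ps) \<Longrightarrow> length u = d"
  by (auto simp: normals_def Let_def)

lemma val_differences_t:
  "val (differences_t sz ps) = concat (map (\<lambda>p. map (\<lambda>q. map2 (-) p q) ps) ps)"
  by (simp add: differences_t_def)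

lemma val_unit_vectors_t: "val (unit_vectors_t d) = map (unit_list d) [0..<d]"
  by (simp add: unit_vectors_t_def unit_list_def del: upt_Suc replicate_Suc replicate_t.simps upto_t.simps)

lemma val_normals_t:
  assumes "\<forall>p\<in>set ps. length p = Suc k"
  shows "val (normals_t sz (Suc k) ps) = normals (Suc k) ps"
proof -
  have "map (\<lambda>M. val (cofactors_t sz (det_t sz k) (Suc k) M)) (k_sublists (directions (Suc k) ps) k) =
      map (cofactors (Suc k)) (k_sublists (directions (Suc k) ps) k)"
    by (rule map_cong[OF refl], rule val_cofactors_t) (rule mat_rows_directions[OF assms])
  then show ?thesis
    by (simp add: normals_t_def normals_def val_differences_t val_unit_vectors_t Let_def directions_def[symmetric] del: map_map upt_Suc)
qed

lemma val_depth_region_t: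
  assumes "\<forall>p\<in>set ps. length p = Suc k" "1 \<le> \<kappa>" "\<kappa> \<le> length ps"
  shows "val (depth_region_t sz (Suc k) ps \<kappa>) = map (\<lambda>u. (u, order_stat ps \<kappa> u)) (normals (Suc k) ps)"
  using assms by (simp add: depth_region_t_def val_normals_t order_stat_def)

lemma trivial_kernel_directions: "trivial_kernel d (set (directions d ps))"
  by (rule trivial_kernel_units) (auto simp: directions_def)

text \<open>Serves two purposes: violated depth constraints in
  \<open>depth_region_halfspaces\<close>, and unbounded directions in
  \<open>bounded_intersect\<close>.\<close>

lemma normal_on_ray:
  assumes ps: "\<forall>p\<in>set ps. length p = Suc k"
    and lin: "\<And>u. length u = Suc k \<Longrightarrow>
       \<exists>a. length a = Suc k \<and> (\<forall>v\<in>cell (Suc k) (set (directions (Suc k) ps)) u. f v = inner_list a v)"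
    and u: "length u = Suc k" "f u > 0"
  shows "\<exists>v\<in>set (normals (Suc k) ps). f v > 0"
proof -
  obtain M where "M \<in> set (k_sublists (directions (Suc k) ps) k)"
      "f (cofactors (Suc k) M) > 0 \<or> f (map uminus (cofactors (Suc k) M)) > 0"
    using positive_on_ray[OF _ trivial_kernel_directions lin u] length_directions[OF ps] by blast
  then show ?thesis by (force simp: normals_def Let_def)
qed

lemma inner_diff:
  assumes "length p = n" "length q = n" "length u = n"
  shows "inner_list (map2 (-) p q) u = inner_list p u - inner_list q u"
  using assms by (simp add: inner_list_eq_sum[of _ n] sum_subtractf algebra_simps)

text \<open>On a cell the order of the data by inner product is constant, so the order statistic is the
  inner product with one fixed data point.\<close>

lemma order_stat_cell:
  assumes ps: "\<forall>p\<in>set ps. length p = d" and \<kappa>: "1 \<le> \<kappa>" "\<kappa> \<le> length ps" and u: "length u = d"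
  obtains q where "q \<in> set ps" "\<forall>v\<in>cell d (set (directions d ps)) u. order_stat ps \<kappa> v = inner_list q v"
proof -
  define ps' where "ps' = sort_key (inner_list u) ps"
  have len: "length ps' = length ps" and set: "set ps' = set ps" by (simp_all add: ps'_def)
  have "order_stat ps \<kappa> v = inner_list (ps' ! (\<kappa> - 1)) v" if v: "v \<in> cell d (set (directions d ps)) u" for v
  proof -
    have lv: "length v = d" using v by (simp add: cell_def)
    \<comment> \<open>Since \<open>q - p\<close> is one of the directions, ties may appear on the
      closed cell, but no inversions.\<close>
    have mono: "inner_list v p \<le> inner_list v q"
      if "p \<in> set ps" "q \<in> set ps" "inner_list u p \<le> inner_list u q" for p q
    proof -
      have "map2 (-) q p \<in> set (directions d ps)" using that by (auto simp: directions_def)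
      then have "inner_list (map2 (-) q p) u \<ge> 0 \<longrightarrow> inner_list (map2 (-) q p) v \<ge> 0"
        using v by (auto simp: cell_def)
      then show ?thesis
        using that ps u lv inner_diff[of q d p] by (simp add: inner_list_commute)
    qed
    have "sorted_wrt (\<lambda>p q. inner_list u p \<le> inner_list u q) ps'"
      unfolding ps'_def using sorted_sort_key[of "inner_list u" ps] by (simp add: sorted_map)
    then have "sorted_wrt (\<lambda>p q. inner_list v p \<le> inner_list v q) ps'"
      by (rule sorted_wrt_mono_rel[rotated]) (use mono set in blast)
    then have "sorted (map (inner_list v) ps')" by (simp add: sorted_map)
    moreover have "mset (map (inner_list v) ps') = mset (map (inner_list v) ps)" by (simp add: ps'_def)
    ultimately have "sort (map (inner_list v) ps) = map (inner_list v) ps'"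
      by (intro properties_for_sort) auto
    then show ?thesis using \<kappa> len by (simp add: order_stat_def inner_list_commute)
  qed
  moreover have "ps' ! (\<kappa> - 1) \<in> set ps" using \<kappa> len set nth_mem[of "\<kappa> - 1" ps'] by simp
  ultimately show thesis using that by blast
qed

text \<open>Dependent vectors have a zero cross product, so the zero vector can be a candidate
  normal although the depth quantifies over nonzero directions. Its constraint reads 0 \<le>
  0.\<close>

lemma order_stat_zero:
  assumes "1 \<le> \<kappa>" "\<kappa> \<le> length ps"
  shows "order_stat ps \<kappa> (replicate d 0) = 0"
proof -
  have "sort (map (inner_list (replicate d 0)) ps) ! (\<kappa> - 1) \<in> set (map (inner_list (replicate d 0)) ps)"
    using assms nth_mem[of "\<kappa> - 1" "sort (map (inner_list (replicate d 0)) ps)"] by simp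
  then show ?thesis by (auto simp: order_stat_def)
qed

context
  fixes k :: nat and ps :: "real list list"
  assumes dist: "distinct ps" and lenps: "\<forall>p\<in>set ps. length p = Suc k"
begin

text \<open>A count of at least \<kappa> is an upper bound on the \<kappa>-th smallest value. This
  turns the region into an intersection of halfspaces, from which its convexity is read off
  later.\<close>

lemma depth_region_order_stat:
  assumes \<kappa>: "1 \<le> \<kappa>" "\<kappa> \<le> length ps"
  shows "depth_region (Suc k) (set ps) \<kappa> =
    {w. length w = Suc k \<and> (\<forall>u. length u = Suc k \<longrightarrow> order_stat ps \<kappa> u \<le> inner_list u w)}"
proof -
  have "\<kappa> \<le> TD (Suc k) (set ps) w \<longleftrightarrow>
      (\<forall>u. length u = Suc k \<longrightarrow> order_stat ps \<kappa> u \<le> inner_list u w)" for w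
  proof -
    have "\<kappa> \<le> TD (Suc k) (set ps) w \<longleftrightarrow>
        (\<forall>u. length u = Suc k \<and> u \<noteq> replicate (Suc k) 0 \<longrightarrow> order_stat ps \<kappa> u \<le> inner_list u w)"
      unfolding order_stat_le_iff[OF dist \<kappa>] using lenps by (intro TD_ge) auto
    moreover have "order_stat ps \<kappa> (replicate (Suc k) 0) \<le> inner_list (replicate (Suc k) 0) w"
      unfolding order_stat_zero[OF \<kappa>] inner_zero by simp
    ultimately show ?thesis by blast
  qed
  then show ?thesis by (simp add: depth_region_def)
qed

text \<open>If u violates its constraint at w, then
  \<open>order_stat ps \<kappa> u - inner_list u w\<close> is positive. On each cell this is the
  inner product with q - w for a single data point q, so the ray argument finds a candidate that is
  violated too.\<close>

lemma depth_region_halfspaces: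
  assumes \<kappa>: "1 \<le> \<kappa>" "\<kappa> \<le> length ps"
  shows "feasible (Suc k) (set (val (depth_region_t sz (Suc k) ps \<kappa>))) = depth_region (Suc k) (set ps) \<kappa>"
proof -
  have ray: "\<exists>v\<in>set (normals (Suc k) ps). order_stat ps \<kappa> v > inner_list v w"
    if w: "length w = Suc k" and u: "length u = Suc k" "order_stat ps \<kappa> u > inner_list u w" for u w
  proof -
    have "\<exists>v\<in>set (normals (Suc k) ps). order_stat ps \<kappa> v - inner_list v w > 0"
    proof (rule normal_on_ray[OF lenps, where f = "\<lambda>v. order_stat ps \<kappa> v - inner_list v w"])
      fix u :: "real list" assume "length u = Suc k"
      then obtain q where q: "q \<in> set ps"
          "\<forall>v\<in>cell (Suc k) (set (directions (Suc k) ps)) u. order_stat ps \<kappa> v = inner_list q v"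
        using order_stat_cell[OF lenps \<kappa>] by blast
      then show "\<exists>a. length a = Suc k \<and> (\<forall>v\<in>cell (Suc k) (set (directions (Suc k) ps)) u.
          order_stat ps \<kappa> v - inner_list v w = inner_list a v)"
        using w lenps
        by (intro exI[of _ "map2 (-) q w"])
          (auto simp: inner_diff[of _ "Suc k"] cell_def inner_list_commute[of _ w])
    qed (use u in auto)
    then show ?thesis by auto
  qed
  have "(\<forall>u. length u = Suc k \<longrightarrow> order_stat ps \<kappa> u \<le> inner_list u w) \<longleftrightarrow>
      (\<forall>u\<in>set (normals (Suc k) ps). order_stat ps \<kappa> u \<le> inner_list u w)" if "length w = Suc k" for w
  proof (intro iffI ballI allI impI)
    fix u :: "real list" assume *: "\<forall>u\<in>set (normals (Suc k) ps). order_stat ps \<kappa> u \<le> inner_list u w" "length u = Suc k"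
    show "order_stat ps \<kappa> u \<le> inner_list u w"
    proof (rule ccontr)
      assume "\<not> order_stat ps \<kappa> u \<le> inner_list u w"
      then show False using ray[OF that *(2)] *(1) by (auto simp: not_le[symmetric])
    qed
  qed (simp add: length_normals)
  then show ?thesis
    by (auto simp: depth_region_order_stat[OF \<kappa>] feasible_def val_depth_region_t[OF lenps \<kappa>])
qed

end

section \<open>The intervals\<close>

lemma set_val_collect_feasible_t:
  "set (val (collect_feasible_t sz hs cs)) = {x. Some x \<in> set cs \<and> (\<forall>(u, t)\<in>set hs. t \<le> inner_list u x)}"
  by (induction cs) (auto simp: feasible_t_def case_prod_unfold split: option.splits)

lemma val_solve_t:
  assumes "length S = m" "\<forall>(u, t)\<in>set S. length u = m"
  shows "val (solve_t sz m S) = (if det (rows_mat m (map fst S)) = 0 then None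
    else Some (map (\<lambda>j. det (rows_mat m (map (\<lambda>(u, t). u[j := t]) S)) / det (rows_mat m (map fst S))) [0..<m]))"
proof -
  have "mat_rows m m (map fst S)" "mat_rows m m (map (\<lambda>(u, t). u[j := t]) S)" for j
    using assms by (auto simp: mat_rows_def)
  moreover have "map (\<lambda>(u, t). u) S = map fst S" by (auto simp: case_prod_unfold)
  ultimately show ?thesis
    by (simp add: solve_t_def val_det_t case_prod_unfold)
qed

lemma val_solve_t_vertex:
  assumes S: "length S = m" "\<forall>(u, t)\<in>set S. length u = m" and x: "length x = m"
    and "det (rows_mat m (map fst S)) \<noteq> 0" "\<forall>(u, t)\<in>set S. inner_list u x = t"
  shows "val (solve_t sz m S) = Some x"
proof -
  have eq: "map (\<lambda>(u, t). u[j := t]) S = map (\<lambda>r. r[j := inner_list r x]) (map fst S)" for j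
    using assms by (auto simp: case_prod_unfold)
  have "mat_rows m m (map fst S)" using S by (auto simp: mat_rows_def)
  then have "det (rows_mat m (map (\<lambda>(u, t). u[j := t]) S)) / det (rows_mat m (map fst S)) = x ! j" if "j < m" for j
    using assms that unfolding eq by (simp add: cramer_rows del: map_map)
  then have "map (\<lambda>j. det (rows_mat m (map (\<lambda>(u, t). u[j := t]) S)) / det (rows_mat m (map fst S))) [0..<m] = x"
    using x by (intro nth_equalityI) auto
  then show ?thesis using assms by (simp add: val_solve_t)
qed

text \<open>Every computed point is feasible, and \<open>feasible_vertex\<close> with the first unit
  vector and its negative as objectives bounds every feasible point by computed ones from both
  sides. In particular a nonempty system has a vertex, so an empty list of vertices means
  infeasibility.\<close>

lemma range_t_correct:
  assumes hs: "\<forall>(u, t)\<in>set hs. length u = m" and m: "0 < m" and bd: "bounded_system m (set hs)"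
  defines "W \<equiv> (\<lambda>x. x ! 0) ` feasible m (set hs)"
  shows "case val (range_t sz m hs) of
     None \<Rightarrow> W = {} | Some (a, b) \<Rightarrow> is_minimum a W \<and> is_maximum b W"
proof -
  define vs where "vs = val (vertices_t sz m hs)"
  have sub: "length S = m \<and> (\<forall>(u, t)\<in>set S. length u = m)" if "S \<in> set (k_sublists hs m)" for S
    using that hs set_nths_subset[of hs] by (fastforce simp: set_k_sublists)
  have vs: "set vs = {x. Some x \<in> (\<lambda>S. val (solve_t sz m S)) ` set (k_sublists hs m) \<and>
      (\<forall>(u, t)\<in>set hs. t \<le> inner_list u x)}"
    by (simp add: vs_def vertices_t_def set_val_collect_feasible_t)
  have feas: "x \<in> feasible m (set hs)" if x: "x \<in> set vs" for x
  proof -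
    obtain S where "S \<in> set (k_sublists hs m)" "val (solve_t sz m S) = Some x"
        "\<forall>(u, t)\<in>set hs. t \<le> inner_list u x"
      using x unfolding vs by (auto dest: sym)
    then show ?thesis using sub[of S] by (auto simp: val_solve_t feasible_def split: if_splits)
  qed
  have vertex: "\<exists>x'\<in>set vs. inner_list c x' \<le> inner_list c x"
    if x: "x \<in> feasible m (set hs)" "length c = m" for x c
  proof -
    obtain S x' where S: "S \<in> set (k_sublists hs m)" "det (rows_mat m (map fst S)) \<noteq> 0"
      "\<forall>(u, t)\<in>set S. inner_list u x' = t" "x' \<in> feasible m (set hs)" "inner_list c x' \<le> inner_list c x"
      using feasible_vertex[OF hs bd x] by metis
    then have "val (solve_t sz m S) = Some x'"
      using sub[OF S(1)] by (intro val_solve_t_vertex) (auto simp: feasible_def)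
    then have "Some x' \<in> (\<lambda>S. val (solve_t sz m S)) ` set (k_sublists hs m)"
      using S(1) by (intro image_eqI[of _ _ S]) simp_all
    then have "x' \<in> set vs" using S(4) by (simp add: vs feasible_def)
    then show ?thesis using S(5) by (rule bexI[rotated])
  qed
  have lower: "\<exists>x'\<in>set vs. x' ! 0 \<le> x ! 0" if x: "x \<in> feasible m (set hs)" for x
  proof -
    obtain x' where "x' \<in> set vs" "inner_list (unit_list m 0) x' \<le> inner_list (unit_list m 0) x"
      using vertex[OF x length_unit_list] by blast
    then show ?thesis using x feas m by (auto simp: inner_unit_list feasible_def)
  qed
  have upper: "\<exists>x'\<in>set vs. x' ! 0 \<ge> x ! 0" if x: "x \<in> feasible m (set hs)" for x
  proof -
    obtain x' where "x' \<in> set vs"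
        "inner_list (map uminus (unit_list m 0)) x' \<le> inner_list (map uminus (unit_list m 0)) x"
      using vertex[OF x, of "map uminus (unit_list m 0)"] by auto
    then show ?thesis using x feas m by (auto simp: inner_unit_list inner_uminus_left feasible_def)
  qed
  define ts where "ts = map (\<lambda>x. x ! 0) vs"
  have ts: "val (map_t (\<lambda>v. nth_t v 0) vs) = ts"
    using feas m by (auto simp: ts_def feasible_def)
  have range: "val (range_t sz m hs) = (case ts of [] \<Rightarrow> None | t # ts' \<Rightarrow> Some (Min (set ts), Max (set ts)))"
    using ts by (auto simp: range_t_def vs_def[symmetric] val_min_t val_max_t split: list.split)
  have sub_W: "set ts \<subseteq> W" using feas by (auto simp: ts_def W_def)
  show ?thesis
  proof (cases "ts = []")
    case True
    then have "W = {}" using lower by (auto simp: W_def ts_def)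
    then show ?thesis using True by (simp add: range)
  next
    case False
    have "is_minimum (Min (set ts)) W"
      unfolding is_minimum_def
    proof (intro conjI ballI)
      show "Min (set ts) \<in> W" using sub_W False Min_in[of "set ts"] by auto
      fix t assume "t \<in> W"
      then obtain x' where "x' \<in> set ts" "x' \<le> t" using lower unfolding W_def ts_def set_map by blast
      moreover from this have "Min (set ts) \<le> x'" by simp
      ultimately show "Min (set ts) \<le> t" by linarith
    qed
    moreover have "is_maximum (Max (set ts)) W"
      unfolding is_maximum_def
    proof (intro conjI ballI)
      show "Max (set ts) \<in> W" using sub_W False Max_in[of "set ts"] by auto
      fix t assume "t \<in> W"
      then obtain x' where "x' \<in> set ts" "x' \<ge> t" using upper unfolding W_def ts_def set_map by blast
      moreover from this have "Max (set ts) \<ge> x'" by simp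
      ultimately show "Max (set ts) \<ge> t" by linarith
    qed
    ultimately show ?thesis using False by (auto simp: range split: list.split)
  qed
qed

section \<open>Slices of depth regions with a fixed prefix\<close>

lemma val_intersect_t:
  "val (intersect_t sz y hs) = map (\<lambda>(u, t). (drop (length y) u, t - inner_list y u)) hs"
  by (simp add: intersect_t_def case_prod_unfold)

text \<open>\<open>inner_list y u\<close> reads only the first \<open>length y\<close> entries of u,
  because \<open>zip\<close> truncates the longer list.\<close>

lemma inner_append:
  "length u = length y + length x \<Longrightarrow>
    inner_list u (y @ x) = inner_list y u + inner_list (drop (length y) u) x"
proof (induction y arbitrary: u)
  case (Cons a y)
  then show ?case by (cases u) (auto simp: inner_list_def)
qed (simp add: inner_list_def)

lemma append_in_feasible:
  assumes "length y < d" "\<forall>(u, t)\<in>set hs. length u = d"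
  shows "y @ x \<in> feasible d (set hs) \<longleftrightarrow>
    x \<in> feasible (d - length y) (set (val (intersect_t sz y hs)))"
proof (cases "length x = d - length y")
  case True
  then have "inner_list u (y @ x) = inner_list y u + inner_list (drop (length y) u) x"
    if "(u, t) \<in> set hs" for u t
    using assms that by (intro inner_append) auto
  then have "(\<forall>(u, t)\<in>set hs. t \<le> inner_list u (y @ x)) \<longleftrightarrow>
      (\<forall>(u, t)\<in>set hs. t - inner_list y u \<le> inner_list (drop (length y) u) x)"
    by (fastforce simp: algebra_simps)
  then show ?thesis using True assms
    by (simp add: feasible_def val_intersect_t case_prod_unfold)
qed (use assms in \<open>auto simp: feasible_def\<close>)

context
  fixes k :: nat and ps :: "real list list" and y :: "real list"
  assumes dist: "distinct ps" and lenps: "\<forall>p\<in>set ps. length p = Suc k" and y: "length y < Suc k"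
begin

definition slice :: "nat \<Rightarrow> real set" where
  "slice \<kappa> = (\<lambda>w. w ! length y) ` (depth_region (Suc k) (set ps) \<kappa> \<inter> extensions (Suc k) y)"

text \<open>Padding v with zeros lifts it to a direction w of the full space. The function
  \<open>- inner_list u w\<close> is linear everywhere and positive at the negative of w, so the ray
  argument yields a normal that decreases along w.\<close>

lemma bounded_intersect:
  assumes \<kappa>: "1 \<le> \<kappa>" "\<kappa> \<le> length ps"
  shows "bounded_system (Suc k - length y)
     (set (val (intersect_t sz y (val (depth_region_t sz (Suc k) ps \<kappa>)))))"
  unfolding bounded_system_def
proof (intro allI impI, elim conjE)
  fix v :: "real list"
  assume v: "length v = Suc k - length y" "v \<noteq> replicate (Suc k - length y) 0"
  define w where "w = replicate (length y) 0 @ v"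
  have lw: "length w = Suc k" using v y by (simp add: w_def)
  have inner_w: "inner_list u w = inner_list (drop (length y) u) v" if "length u = Suc k" for u
    using that v y inner_append[of u "replicate (length y) 0" v] by (simp add: w_def)
  have "w \<noteq> replicate (Suc k) 0"
  proof
    assume "w = replicate (Suc k) 0"
    then have "drop (length y) w = replicate (Suc k - length y) 0" by (simp del: replicate_Suc)
    then show False using v by (simp add: w_def)
  qed
  then have pos: "- inner_list (map uminus w) w > 0"
    using inner_self_pos lw by (simp add: inner_uminus_left)
  have "\<exists>u\<in>set (normals (Suc k) ps). - inner_list u w > 0"
  proof (rule normal_on_ray[OF lenps, where f = "\<lambda>u. - inner_list u w" and u = "map uminus w"])
    fix u :: "real list" assume "length u = Suc k"
    show "\<exists>a. length a = Suc k \<and>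
        (\<forall>v\<in>cell (Suc k) (set (directions (Suc k) ps)) u. - inner_list v w = inner_list a v)"
      using lw by (intro exI[of _ "map uminus w"]) (auto simp: inner_uminus_left inner_list_commute[of _ w])
  qed (use pos lw in auto)
  then obtain u where u: "u \<in> set (normals (Suc k) ps)" "inner_list u w < 0" by auto
  then have "inner_list (drop (length y) u) v < 0" using inner_w length_normals by auto
  then show "\<exists>(u, t)\<in>set (val (intersect_t sz y (val (depth_region_t sz (Suc k) ps \<kappa>)))). inner_list u v < 0"
    using u by (force simp: val_intersect_t val_depth_region_t[OF lenps \<kappa>])
qed

definition range_at :: "(real \<Rightarrow> nat) \<Rightarrow> nat \<Rightarrow> (real \<times> real) option" where
  "range_at sz \<kappa> = val (range_t sz (Suc k - length y)
     (val (intersect_t sz y (val (depth_region_t sz (Suc k) ps \<kappa>)))))"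

lemma range_at_correct:
  assumes \<kappa>: "1 \<le> \<kappa>" "\<kappa> \<le> length ps"
  shows "case range_at sz \<kappa> of None \<Rightarrow> slice \<kappa> = {}
    | Some (a, b) \<Rightarrow> is_minimum a (slice \<kappa>) \<and> is_maximum b (slice \<kappa>)"
proof -
  let ?hs = "val (depth_region_t sz (Suc k) ps \<kappa>)"
  let ?hs' = "val (intersect_t sz y ?hs)"
  have len: "\<forall>(u, t)\<in>set ?hs. length u = Suc k"
    using length_normals by (auto simp: val_depth_region_t[OF lenps \<kappa>])
  have len': "\<forall>(u, t)\<in>set ?hs'. length u = Suc k - length y"
    using len by (auto simp: val_intersect_t)
  have "slice \<kappa> = (\<lambda>x. (y @ x) ! length y) ` feasible (Suc k - length y) (set ?hs')"
  proof -
    have "depth_region (Suc k) (set ps) \<kappa> \<inter> extensions (Suc k) y =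
        (\<lambda>x. y @ x) ` feasible (Suc k - length y) (set ?hs')"
      unfolding depth_region_halfspaces[OF dist lenps \<kappa>, of sz, symmetric]
      using append_in_feasible[OF y len, of _ sz] by (auto simp: extensions_def) (auto simp: feasible_def)
    then show ?thesis by (simp add: slice_def image_image)
  qed
  also have "\<dots> = (\<lambda>x. x ! 0) ` feasible (Suc k - length y) (set ?hs')"
    using y by (intro image_cong) (auto simp: nth_append)
  finally have eq: "slice \<kappa> = \<dots>" .
  show ?thesis
    unfolding range_at_def eq using y by (intro range_t_correct len' bounded_intersect \<kappa>) simp
qed

lemma loop_t_correct:
  assumes "Js = val (loop_t sz r \<kappa> (Suc k) ps y)"
  shows "length Js \<le> r \<and> (\<forall>j<length Js. range_at sz (\<kappa> + j) = Some (Js ! j)) \<and>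
    (length Js < r \<longrightarrow> range_at sz (\<kappa> + length Js) = None)"
  using assms
proof (induction r arbitrary: \<kappa> Js)
  case (Suc r)
  show ?case
  proof (cases "range_at sz \<kappa>")
    case None
    then show ?thesis using Suc.prems by (simp add: range_at_def)
  next
    case (Some ab)
    then have "Js = ab # val (loop_t sz r (\<kappa> + 1) (Suc k) ps y)"
      using Suc.prems by (simp add: range_at_def)
    then show ?thesis using Suc.IH[OF refl, of "\<kappa> + 1"] Some
      by (auto simp: nth_Cons split: nat.split)
  qed
qed simp

lemma slice_antimono: "\<kappa> \<le> \<kappa>' \<Longrightarrow> slice \<kappa>' \<subseteq> slice \<kappa>"
  by (auto simp: slice_def depth_region_def)

lemma slice_iff:
  "x \<in> slice \<kappa> \<longleftrightarrow> (\<exists>z. length z = Suc k - 1 - length y \<and> \<kappa> \<le> TD (Suc k) (set ps) (y @ [x] @ z))"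
proof
  assume "x \<in> slice \<kappa>"
  then obtain w where w: "length w = Suc k - length y" "\<kappa> \<le> TD (Suc k) (set ps) (y @ w)" "x = (y @ w) ! length y"
    by (auto simp: slice_def extensions_def depth_region_def)
  then obtain z where "w = x # z" using y by (cases w) (auto simp: nth_append)
  then show "\<exists>z. length z = Suc k - 1 - length y \<and> \<kappa> \<le> TD (Suc k) (set ps) (y @ [x] @ z)"
    using w(1,2) by (intro exI[of _ z]) auto
next
  assume "\<exists>z. length z = Suc k - 1 - length y \<and> \<kappa> \<le> TD (Suc k) (set ps) (y @ [x] @ z)"
  then obtain z where z: "length z = Suc k - 1 - length y" "\<kappa> \<le> TD (Suc k) (set ps) (y @ [x] @ z)" by auto
  have "length (x # z) = Suc k - length y" using z y by simp
  then have "y @ [x] @ z \<in> extensions (Suc k) y" unfolding extensions_def by force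
  moreover have "y @ [x] @ z \<in> depth_region (Suc k) (set ps) \<kappa>" using z y by (simp add: depth_region_def)
  ultimately show "x \<in> slice \<kappa>"
    unfolding slice_def by (intro image_eqI[of _ _ "y @ [x] @ z"]) auto
qed

text \<open>The segment between the two witnesses keeps the prefix y and stays inside every
  halfspace of the region. A slice therefore fills the whole interval between its extreme
  values.\<close>

lemma slice_convex:
  assumes \<kappa>: "1 \<le> \<kappa>" "\<kappa> \<le> length ps" and ab: "a \<in> slice \<kappa>" "b \<in> slice \<kappa>" and t: "a \<le> t" "t \<le> b"
  shows "t \<in> slice \<kappa>"
proof (cases "a = b")
  case False
  obtain w where w: "length w = Suc k - 1 - length y" "\<kappa> \<le> TD (Suc k) (set ps) (y @ [a] @ w)"
    using ab slice_iff by blast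
  obtain w' where w': "length w' = Suc k - 1 - length y" "\<kappa> \<le> TD (Suc k) (set ps) (y @ [b] @ w')"
    using ab slice_iff by blast
  define s where "s = (t - a) / (b - a)"
  have s: "0 \<le> s" "s \<le> 1" "a + s * (b - a) = t" using t False by (auto simp: s_def)
  let ?x = "y @ [a] @ w" and ?x' = "y @ [b] @ w'"
  define z where "z = axpy w s (axpy w' (-1) w)"
  have eq: "y @ [t] @ z = axpy ?x s (axpy ?x' (-1) ?x)"
  proof -
    have append: "axpy (u @ u') r (v @ v') = axpy u r v @ axpy u' r v'" if "length u = length v" for u u' v v' r
      using that by (simp add: axpy_def)
    have "axpy y s (axpy y (-1) y) = y" by (rule nth_equalityI) (auto simp: axpy_def)
    moreover have "axpy [a] s (axpy [b] (-1) [a]) = [t]" using s by (simp add: axpy_def)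
    ultimately show ?thesis by (simp only: append z_def length_axpy min.idem list.size)
  qed
  have lx: "length ?x = Suc k" "length ?x' = Suc k" using w w' y by auto
  have mem: "?x \<in> depth_region (Suc k) (set ps) \<kappa>" "?x' \<in> depth_region (Suc k) (set ps) \<kappa>"
    using w w' lx by (simp_all add: depth_region_def)
  have "order_stat ps \<kappa> u \<le> inner_list u (y @ [t] @ z)" if u: "length u = Suc k" for u
  proof -
    have 1: "order_stat ps \<kappa> u \<le> inner_list u ?x" "order_stat ps \<kappa> u \<le> inner_list u ?x'"
      using mem u unfolding depth_region_order_stat[OF dist lenps \<kappa>] by blast+
    have "inner_list u (y @ [t] @ z) = inner_list u ?x + s * inner_list u (axpy ?x' (-1) ?x)"
      unfolding eq using lx u by (intro inner_axpy[where n = "Suc k"]) auto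
    also have "inner_list u (axpy ?x' (-1) ?x) = inner_list u ?x' + (-1) * inner_list u ?x"
      using lx u by (intro inner_axpy[where n = "Suc k"]) auto
    finally have "inner_list u (y @ [t] @ z) = (1 - s) * inner_list u ?x + s * inner_list u ?x'"
      by (simp add: algebra_simps)
    also have "\<dots> \<ge> (1 - s) * order_stat ps \<kappa> u + s * order_stat ps \<kappa> u"
      using 1 s by (intro add_mono mult_left_mono) auto
    finally show ?thesis by (simp add: algebra_simps)
  qed
  moreover have "length (y @ [t] @ z) = Suc k" using w w' y by (simp add: z_def)
  ultimately have "y @ [t] @ z \<in> depth_region (Suc k) (set ps) \<kappa>"
    unfolding depth_region_order_stat[OF dist lenps \<kappa>] by blast
  then show ?thesis unfolding slice_iff using w w'
    by (intro exI[of _ z]) (auto simp: depth_region_def z_def)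
qed (use ab t in auto)

lemma finite_TD_values: "finite (range (TD (Suc k) (set ps)))"
proof (rule finite_subset)
  show "range (TD (Suc k) (set ps)) \<subseteq> {..card (set ps)}"
    using TD_le_card[of "Suc k" "set ps"] lenps by auto
qed simp

text \<open>The maximum is over infinitely many z but only finitely many depths, so
  \<open>Max\<close> is a genuine maximum.\<close>

lemma TDC_ge: "\<kappa> \<le> TDC (Suc k) (set ps) y x \<longleftrightarrow> x \<in> slice \<kappa>"
proof -
  have "finite ((\<lambda>z. TD (Suc k) (set ps) (y @ [x] @ z)) ` {z. length z = Suc k - 1 - length y})"
    by (rule finite_subset[OF _ finite_TD_values]) auto
  moreover have "replicate (Suc k - 1 - length y) 0 \<in> {z. length z = Suc k - 1 - length y}" by simp
  ultimately show ?thesis unfolding TDC_def slice_iff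
    by (subst Max_ge_iff) blast+
qed

lemma TDC_le: "TDC (Suc k) (set ps) y x \<le> (length ps + 1) div 2"
proof -
  obtain z where z: "length z = Suc k - 1 - length y" "TDC (Suc k) (set ps) y x \<le> TD (Suc k) (set ps) (y @ [x] @ z)"
    using TDC_ge[of "TDC (Suc k) (set ps) y x" x] slice_iff by auto
  moreover have "TD (Suc k) (set ps) (y @ [x] @ z) \<le> (card (set ps) + 1) div 2"
    using z y lenps by (intro TD_le_half) auto
  ultimately show ?thesis using dist by (simp add: distinct_card)
qed

lemma TDC_interval_ge:
  assumes "I \<noteq> {}"
  shows "\<kappa> \<le> TDC_interval (Suc k) (set ps) y I \<longleftrightarrow> I \<inter> slice \<kappa> \<noteq> {}"
proof -
  have "finite (TDC (Suc k) (set ps) y ` I)"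
    by (rule finite_subset[of _ "{..(length ps + 1) div 2}"]) (use TDC_le in auto)
  then show ?thesis unfolding TDC_interval_def using assms
    by (subst Max_ge_iff) (auto simp: TDC_ge)
qed

text \<open>All claims rest on each returned interval being a full slice: it has the same end
  points, and slices are convex. Nesting is then the monotonicity of depth regions.\<close>

lemma nested_intervals_correct:
  fixes sz :: "real \<Rightarrow> nat"
  defines "Js \<equiv> val (nested_intervals_t sz (Suc k) ps y)"
  shows "correct_output (Suc k) (set ps) y Js"
    and "1 \<le> \<kappa> \<Longrightarrow> \<kappa> \<le> \<kappa>' \<Longrightarrow> \<kappa>' \<le> length Js \<Longrightarrow> nth_interval Js \<kappa>' \<subseteq> nth_interval Js \<kappa>"
    and "I \<noteq> {} \<Longrightarrow> TDC_interval (Suc k) (set ps) y I =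
      Max (insert 0 {\<kappa>\<in>{1..length Js}. I \<inter> nth_interval Js \<kappa> \<noteq> {}})"
proof -
  let ?r = "(length ps + 1) div 2"
  have r: "\<kappa> \<le> length ps" if "\<kappa> \<le> ?r" "1 \<le> \<kappa>" for \<kappa> using that by (cases "length ps") auto
  have "Js = val (loop_t sz ?r 1 (Suc k) ps y)"
    by (simp add: Js_def nested_intervals_t_def)
  note loop = loop_t_correct[OF this]
  have len: "length Js \<le> ?r" using loop by blast
  have J: "is_minimum (fst (Js ! (\<kappa> - 1))) (slice \<kappa>) \<and> is_maximum (snd (Js ! (\<kappa> - 1))) (slice \<kappa>)"
    if "1 \<le> \<kappa>" "\<kappa> \<le> length Js" for \<kappa>
  proof -
    have "\<kappa> - 1 < length Js" "\<kappa> = 1 + (\<kappa> - 1)" using that by auto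
    then have "range_at sz \<kappa> = Some (Js ! (\<kappa> - 1))" using loop by metis
    then show ?thesis using range_at_correct[of \<kappa> sz] that len r[of \<kappa>] by (auto split: prod.splits)
  qed
  have stop: "slice (length Js + 1) = {}" if "length Js < ?r"
    using loop that range_at_correct[of "length Js + 1" sz] r[of "length Js + 1"] by simp
  show "correct_output (Suc k) (set ps) y Js"
    unfolding correct_output_def Let_def slice_def[symmetric]
    unfolding distinct_card[OF dist] using J len stop by (simp add: slice_def)
  have interval: "nth_interval Js \<kappa> = slice \<kappa>" if "1 \<le> \<kappa>" "\<kappa> \<le> length Js" for \<kappa>
  proof (intro equalityI subsetI)
    fix t assume "t \<in> nth_interval Js \<kappa>"
    then show "t \<in> slice \<kappa>"
      using J[OF that] slice_convex[of \<kappa> _ _ t] r[of \<kappa>] that len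
      by (auto simp: nth_interval_def is_minimum_def is_maximum_def)
  next
    fix t assume "t \<in> slice \<kappa>"
    then show "t \<in> nth_interval Js \<kappa>"
      using J[OF that] by (auto simp: nth_interval_def is_minimum_def is_maximum_def)
  qed
  show "nth_interval Js \<kappa>' \<subseteq> nth_interval Js \<kappa>" if "1 \<le> \<kappa>" "\<kappa> \<le> \<kappa>'" "\<kappa>' \<le> length Js" for \<kappa> \<kappa>'
    using that interval[of \<kappa>] interval[of \<kappa>'] slice_antimono[of \<kappa> \<kappa>'] by simp
  show "TDC_interval (Suc k) (set ps) y I =
      Max (insert 0 {\<kappa>\<in>{1..length Js}. I \<inter> nth_interval Js \<kappa> \<noteq> {}})" if I: "I \<noteq> {}" for I
  proof -
    have mem: "\<kappa> \<in> {\<kappa>\<in>{1..length Js}. I \<inter> nth_interval Js \<kappa> \<noteq> {}} \<longleftrightarrow>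
        1 \<le> \<kappa> \<and> \<kappa> \<le> TDC_interval (Suc k) (set ps) y I" for \<kappa>
    proof -
      \<comment> \<open>Nothing is lost beyond the output: if the loop stopped early, all later
        slices lie in an empty one, and if it ran through, the bound (n + 1)/2 on the depth leaves
        no further value of \<kappa>.\<close>
      have "\<kappa> \<le> length Js" if x: "x \<in> slice \<kappa>" for x
      proof (rule ccontr)
        assume *: "\<not> \<kappa> \<le> length Js"
        then have "slice \<kappa> \<subseteq> slice (length Js + 1)" by (intro slice_antimono) simp
        moreover have "\<kappa> \<le> ?r" using x TDC_ge[of \<kappa> x] TDC_le[of x] by linarith
        ultimately show False using stop x * by auto
      qed
      then have "I \<inter> slice \<kappa> \<noteq> {} \<Longrightarrow> \<kappa> \<le> length Js" by blast
      then show ?thesis using interval[of \<kappa>] TDC_interval_ge[OF I, of \<kappa>] by auto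
    qed
    \<comment> \<open>With 0 inserted, the set consists of all numbers up to the depth of I; 0 is
      the value for an I that meets no interval.\<close>
    show ?thesis
      using mem by (intro Max_eqI[symmetric]) (auto simp: Suc_le_eq)
  qed
qed

end

section \<open>Arithmetic cost and the size of numbers\<close>

text \<open>G b is the set of numbers of size level at most b: all numbers in the real RAM, and the fractions
  with numerator and denominator at most \<open>2\<^sup>b\<close> in the bit model.\<close>

locale size_model =
  fixes sz :: "real \<Rightarrow> nat" and G :: "nat \<Rightarrow> real set" and B C q :: nat
  assumes level_mono: "a \<le> b \<Longrightarrow> G a \<subseteq> G b"
    and level_zero: "0 \<in> G 0" and level_one: "1 \<in> G 0"
    and level_add: "x \<in> G a \<Longrightarrow> z \<in> G b \<Longrightarrow> x + z \<in> G (a + b + 1)"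
    and level_mult: "x \<in> G a \<Longrightarrow> z \<in> G b \<Longrightarrow> x * z \<in> G (a + b)"
    and level_div: "x \<in> G a \<Longrightarrow> z \<in> G b \<Longrightarrow> x / z \<in> G (a + b)"
    and level_uminus: "x \<in> G a \<Longrightarrow> - x \<in> G a"
    and cost: "x \<in> G B \<Longrightarrow> z \<in> G B \<Longrightarrow> arith_cost sz x z \<le> C"
    and C_pos: "1 \<le> C" and q_pos: "1 \<le> q"
begin

lemma level_up: "x \<in> G a \<Longrightarrow> a \<le> b \<Longrightarrow> x \<in> G b"
  using level_mono by blast

lemma cost_le: "x \<in> G a \<Longrightarrow> z \<in> G b \<Longrightarrow> a \<le> B \<Longrightarrow> b \<le> B \<Longrightarrow> arith_cost sz x z \<le> C"
  using level_up cost by blast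

lemma zero_level: "0 \<in> G a"
  using level_up[OF level_zero] by simp

lemma one_level: "1 \<in> G a"
  using level_up[OF level_one] by simp

lemma level_diff: "x \<in> G a \<Longrightarrow> z \<in> G b \<Longrightarrow> x - z \<in> G (a + b + 1)"
  using level_add[of x a "- z" b] level_uminus[of z b] by simp

lemma sum_list_level: "set xs \<subseteq> G a \<Longrightarrow> sum_list xs \<in> G (length xs * (a + 1))"
proof (induction xs)
  case (Cons x xs)
  then have "x + sum_list xs \<in> G (a + length xs * (a + 1) + 1)" by (intro level_add) auto
  then show ?case by (simp add: algebra_simps)
qed (simp add: zero_level)

lemma set_map2_mult_level: "set u \<subseteq> G a \<Longrightarrow> set v \<subseteq> G b \<Longrightarrow> set (map2 (*) u v) \<subseteq> G (a + b)"
  by (force elim!: in_set_zipE intro: level_mult)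

lemma inner_level:
  assumes "set u \<subseteq> G a" "set v \<subseteq> G b" "length u \<le> q"
  shows "inner_list u v \<in> G (q * (a + b + 1))"
proof -
  have "inner_list u v \<in> G (length (map2 (*) u v) * (a + b + 1))"
    unfolding inner_list_def by (rule sum_list_level[OF set_map2_mult_level[OF assms(1,2)]])
  moreover have "length (map2 (*) u v) * (a + b + 1) \<le> q * (a + b + 1)"
    using assms by (intro mult_right_mono) auto
  ultimately show ?thesis by (rule level_up)
qed

lemma time_sum_t_le:
  assumes "set xs \<subseteq> G a" "length xs \<le> l" "l * (a + 1) \<le> B"
  shows "time (sum_t sz xs) \<le> (length xs + 1) * (C + 1)"
  using assms(1,2)
proof (induction xs)
  case (Cons x xs)
  have "sum_list xs \<in> G (length xs * (a + 1))" "x \<in> G a"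
    using Cons sum_list_level by auto
  moreover have "length xs * (a + 1) \<le> l * (a + 1)" using Cons by (intro mult_right_mono) auto
  moreover have "1 * (a + 1) \<le> l * (a + 1)" using Cons by (intro mult_right_mono) auto
  then have "1 * (a + 1) \<le> B" using assms(3) by (rule order_trans)
  then have "a \<le> B" by simp
  ultimately have "arith_cost sz x (sum_list xs) \<le> C"
    using assms(3) by (intro cost_le[of x a _ "length xs * (a + 1)"]) linarith+
  then show ?case using Cons by simp
qed simp

lemma time_inner_t_le:
  assumes "set u \<subseteq> G a" "set v \<subseteq> G b" "length u \<le> q" "q * (a + b + 1) \<le> B"
  shows "time (inner_t sz u v) \<le> 10 * q * C"
proof -
  have "1 * (a + b + 1) \<le> q * (a + b + 1)" using q_pos by (intro mult_right_mono) auto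
  then have "arith_cost sz x z \<le> C" if "x \<in> set u" "z \<in> set v" for x z
    using assms that by (intro cost_le[of _ a _ b]) auto
  then have "time (map2_t (mult_t sz) u v) \<le> (length u + 1) * (C + 1)"
    by (intro time_map2_t_le) simp
  also have "\<dots> \<le> (q + 1) * (C + 1)" using assms by (intro mult_right_mono) auto
  finally have 1: "time (map2_t (mult_t sz) u v) \<le> (q + 1) * (C + 1)" .
  have "time (sum_t sz (map2 (*) u v)) \<le> (length (map2 (*) u v) + 1) * (C + 1)"
    using assms by (intro time_sum_t_le[OF set_map2_mult_level]) auto
  also have "\<dots> \<le> (q + 1) * (C + 1)" using assms by (intro mult_right_mono) auto
  finally have 2: "time (sum_t sz (map2 (*) u v)) \<le> (q + 1) * (C + 1)" .
  have "(q + 1) * (C + 1) \<le> (2 * q) * (2 * C)" using q_pos C_pos by (intro mult_mono) auto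
  then have "(q + 1) * (C + 1) \<le> 4 * (q * C)" by simp
  moreover have "1 * 1 \<le> q * C" using q_pos C_pos by (intro mult_mono) auto
  moreover have "time (inner_t sz u v) = 1 + time (map2_t (mult_t sz) u v) + time (sum_t sz (map2 (*) u v))"
    by (simp add: inner_t_def)
  ultimately show ?thesis using 1 2 unfolding mult.assoc by linarith
qed

lemma time_negate_t_le:
  assumes "set u \<subseteq> G B"
  shows "time (negate_t sz u) \<le> 1 + (length u + 1) * (C + 1)"
proof -
  have "time (map_t (sub_t sz 0) u) \<le> (length u + 1) * (C + 1)"
    using assms by (intro time_map_t_le) (auto intro!: cost zero_level)
  then show ?thesis by (simp add: negate_t_def)
qed

lemma set_alternate_level: "set xs \<subseteq> G a \<Longrightarrow> set (alternate xs) \<subseteq> G a"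
  by (induction xs) (auto intro: level_uminus)

lemma time_alternate_t_le:
  assumes "set xs \<subseteq> G B"
  shows "time (alternate_t sz xs) \<le> (length xs + 1) * (length xs + 1) * (2 * C)"
  using assms
proof (induction xs)
  case (Cons x xs)
  have "time (negate_t sz (alternate xs)) \<le> 1 + (length xs + 1) * (C + 1)"
    using time_negate_t_le[of "alternate xs"] set_alternate_level[of xs B] Cons.prems by simp
  also have "\<dots> \<le> 1 + (length xs + 1) * (2 * C)" using C_pos by (intro add_mono mult_left_mono) auto
  finally have "time (alternate_t sz (x # xs)) \<le> 2 + (length xs + 1) * (2 * C)
      + (length xs + 1) * (length xs + 1) * (2 * C)"
    using Cons by simp
  also have "\<dots> \<le> (length (x # xs) + 1) * (length (x # xs) + 1) * (2 * C)"
    using C_pos by (simp add: algebra_simps)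
  finally show ?case .
qed (use C_pos in simp)

section \<open>Determinants: size levels and running times\<close>

definition entries_level :: "nat \<Rightarrow> real list list \<Rightarrow> bool" where
  "entries_level a M \<longleftrightarrow> (\<forall>r\<in>set M. set r \<subseteq> G a)"

lemma minor:
  assumes "mat_rows k (Suc k) M" "j < Suc k"
  shows "mat_rows k k (map (\<lambda>r. take j r @ drop (Suc j) r) M)"
    and "entries_level a M \<Longrightarrow> entries_level a (map (\<lambda>r. take j r @ drop (Suc j) r) M)"
  using assms by (auto simp: mat_rows_def min_def entries_level_def dest!: in_set_takeD in_set_dropD)

lemma cofactors_level_step:
  assumes "\<And>M. mat_rows k k M \<Longrightarrow> entries_level a M \<Longrightarrow> det (rows_mat k M) \<in> G b"
    and "mat_rows k (Suc k) M" "entries_level a M"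
  shows "set (cofactors (Suc k) M) \<subseteq> G b"
proof -
  have "det (rows_mat k (map (\<lambda>r. take j r @ drop (Suc j) r) M)) \<in> G b" if "j < Suc k" for j
    using assms minor that by blast
  then show ?thesis unfolding cofactors_def by (intro set_alternate_level) (force simp del: upt_Suc)
qed

text \<open>One Laplace step is an inner product of at most q terms between entries and smaller
  determinants. As a + 1 is at most the level of the latter, the level grows by a factor of at most
  \<open>2 * q\<close>.\<close>

lemma det_level:
  "mat_rows k k M \<Longrightarrow> entries_level a M \<Longrightarrow> k \<le> q \<Longrightarrow>
    det (rows_mat k M) \<in> G ((a + 1) * (2 * q) ^ k)"
proof (induction k arbitrary: M)
  case 0
  then show ?case by (simp add: one_level)
next
  case (Suc k)
  obtain r M' where M: "M = r # M'" "length r = Suc k" "mat_rows k (Suc k) M'"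
    using Suc.prems by (auto simp: mat_rows_def length_Suc_conv)
  let ?D = "(a + 1) * (2 * q) ^ k"
  have "set (cofactors (Suc k) M') \<subseteq> G ?D"
    using Suc.IH Suc.prems M by (intro cofactors_level_step[of k a]) (auto simp: entries_level_def)
  then have "inner_list r (cofactors (Suc k) M') \<in> G (q * (a + ?D + 1))"
    using Suc.prems M by (intro inner_level) (auto simp: entries_level_def)
  then have "det (rows_mat (Suc k) M) \<in> G (q * (a + ?D + 1))"
    using inner_cofactors[OF M(3,2)] M(1) by simp
  moreover have "(a + 1) * 1 \<le> ?D" using q_pos by (intro mult_left_mono) auto
  then have "q * (a + ?D + 1) \<le> q * (?D + ?D)" by (intro mult_left_mono) auto
  ultimately show ?case by (elim level_up) (simp add: algebra_simps)
qed

lemma cofactors_level: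
  assumes "mat_rows k (Suc k) M" "entries_level a M" "k \<le> q"
  shows "set (cofactors (Suc k) M) \<subseteq> G ((a + 1) * (2 * q) ^ k)"
  using cofactors_level_step det_level assms by blast

text \<open>There are at most q minors; the bound for \<open>map_t\<close> charges one more round
  for the end of the list, and q + 1 \<le> 2 * q gives the factor in front of T. The rest pays for
  building the minors and flipping the signs.\<close>

lemma time_cofactors_t_step:
  assumes T: "\<And>M. mat_rows k k M \<Longrightarrow> entries_level a M \<Longrightarrow> time (det_t sz k M) \<le> T"
    and M: "mat_rows k (Suc k) M" "entries_level a M" and k: "Suc k \<le> q" and B: "(a + 1) * (2 * q) ^ k \<le> B"
  shows "time (cofactors_t sz (det_t sz k) (Suc k) M) \<le> 2 * q * T + 21 * q ^ 3 * C"
proof -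
  let ?minor = "\<lambda>j. map (\<lambda>r. take j r @ drop (Suc j) r) M"
  have q1: "1 \<le> q" "1 \<le> q * q" "q \<le> q * q" "q * q \<le> q * q * q" using q_pos by auto
  have upto: "time (upto_t (Suc k)) \<le> 4 * (q * q)"
    using time_upto_t_le[of "Suc k"] k mult_mono[of "Suc k + 1" "2 * q" "Suc k + 1" "2 * q"] q1(1) by simp
  have del: "time (map_t (delete_t j) M) \<le> q * (q + 2)" for j
  proof -
    have "time (map_t (delete_t j) M) \<le> (length M + 1) * (Suc k + 1 + 1)"
      using M by (intro time_map_t_le) (metis mat_rows_def time_delete_t_le)
    also have "\<dots> \<le> q * (q + 2)" using M k by (intro mult_mono) (auto simp: mat_rows_def)
    finally show ?thesis .
  qed
  have "time (do { M' \<leftarrow> map_t (delete_t j) M; det_t sz k M' }) \<le> q * (q + 2) + T" if j: "j \<in> set [0..<Suc k]" for j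
  proof -
    have "time (det_t sz k (?minor j)) \<le> T" using j M by (intro T minor) auto
    then show ?thesis using del[of j] by (simp only: time_bind val_map_t val_delete_t add_mono)
  qed
  then have "time (map_t (\<lambda>j. do { M' \<leftarrow> map_t (delete_t j) M; det_t sz k M' }) [0..<Suc k])
      \<le> (length [0..<Suc k] + 1) * (q * (q + 2) + T + 1)"
    by (rule time_map_t_le)
  also have "\<dots> \<le> (2 * q) * (q * (q + 2) + T + 1)"
    using k q1(1) by (intro mult_right_mono) auto
  finally have map: "time (map_t (\<lambda>j. do { M' \<leftarrow> map_t (delete_t j) M; det_t sz k M' }) [0..<Suc k])
      \<le> 2 * q * T + 2 * (q * q * q) + 4 * (q * q) + 2 * q" by (simp add: algebra_simps)
  let ?ms = "map (\<lambda>j. det (rows_mat k (?minor j))) [0..<Suc k]"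
  have ms: "val (map_t (\<lambda>j. do { M' \<leftarrow> map_t (delete_t j) M; det_t sz k M' }) [0..<Suc k]) = ?ms"
    using minor[OF M(1)] by (auto simp: val_det_t simp del: upt_Suc)
  have "det (rows_mat k (?minor j)) \<in> G B" if "j < Suc k" for j
    using det_level[OF minor(1)[OF M(1) that] minor(2)[OF M(1) that M(2)]] k B level_up by auto
  then have "time (alternate_t sz ?ms) \<le> (length ?ms + 1) * (length ?ms + 1) * (2 * C)"
    by (intro time_alternate_t_le) (auto simp del: upt_Suc)
  also have "\<dots> \<le> (2 * q) * (2 * q) * (2 * C)"
    using k q1(1) by (intro mult_mono) auto
  finally have alt: "time (alternate_t sz ?ms) \<le> 8 * (q * q * C)" by simp
  have "time (cofactors_t sz (det_t sz k) (Suc k) M) \<le>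
      1 + 4 * (q * q) + (2 * q * T + 2 * (q * q * q) + 4 * (q * q) + 2 * q) + 8 * (q * q * C)"
    unfolding cofactors_t_def time_tick time_bind val_upto_t ms using upto map alt by linarith
  also have "\<dots> \<le> 2 * q * T + 13 * (q * q * q) + 8 * (q * q * C)"
    using q1 by linarith
  also have "\<dots> \<le> 2 * q * T + 13 * (q * q * q * C) + 8 * (q * q * q * C)"
    using C_pos q1 by (intro add_mono mult_left_mono mult_right_mono) auto
  finally show ?thesis by (simp add: power3_eq_cube algebra_simps)
qed

text \<open>The recursion is T(k + 1) \<le> 2 q T(k) + 32 q^3 C, where 32 = 21 + 10 + 1 covers
  cofactors, inner product and call. The same 32 q^3 C as initial value makes the added term at most
  q T(k), whence the factor \<open>3 * q\<close> per step.\<close>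

lemma time_det_t_le:
  assumes "mat_rows k k M" "entries_level a M" "k \<le> q" "(a + 1) * (2 * q) ^ k \<le> B"
  shows "time (det_t sz k M) \<le> 32 * q ^ 3 * (3 * q) ^ k * C"
  using assms
proof (induction k arbitrary: M)
  case 0
  have "1 * 1 \<le> q ^ 3 * C" using q_pos C_pos by (intro mult_mono) auto
  then show ?case by simp
next
  case (Suc k)
  obtain r M' where M: "M = r # M'" "length r = Suc k" "mat_rows k (Suc k) M'" "entries_level a M'" "set r \<subseteq> G a"
    using Suc.prems by (auto simp: mat_rows_def length_Suc_conv entries_level_def)
  let ?T = "32 * q ^ 3 * (3 * q) ^ k * C" and ?D = "(a + 1) * (2 * q) ^ k"
  have D: "?D \<le> (a + 1) * (2 * q) ^ Suc k" using q_pos by (intro mult_left_mono power_increasing) auto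
  have cof: "time (cofactors_t sz (det_t sz k) (Suc k) M') \<le> 2 * q * ?T + 21 * (q ^ 3 * C)"
    using time_cofactors_t_step[of k a ?T M'] Suc.IH Suc.prems M D by (simp add: mult.assoc)
  have "(a + 1) * 1 \<le> ?D" using q_pos by (intro mult_left_mono) auto
  then have "q * (a + ?D + 1) \<le> q * (?D + ?D)" by (intro mult_left_mono) auto
  also have "\<dots> \<le> B" using Suc.prems by (simp add: algebra_simps)
  finally have "time (inner_t sz r (cofactors (Suc k) M')) \<le> 10 * q * C"
    using M Suc.prems cofactors_level[OF M(3,4)] by (intro time_inner_t_le) auto
  moreover have "q * C \<le> q ^ 3 * C" using q_pos by (intro mult_right_mono) (auto simp: power3_eq_cube)
  moreover have "1 * 1 \<le> q ^ 3 * C" using q_pos C_pos by (intro mult_mono) auto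
  ultimately have "time (det_t sz (Suc k) M) \<le> 2 * q * ?T + 32 * (q ^ 3 * C)"
    using cof unfolding M(1) det_t.simps list.case time_tick time_bind val_cofactors_t[OF M(3)] mult.assoc
    by linarith
  also have "\<dots> \<le> 2 * q * ?T + q * ?T"
  proof -
    have "1 * (32 * (q ^ 3 * C)) \<le> (q * (3 * q) ^ k) * (32 * (q ^ 3 * C))" using q_pos by (intro mult_right_mono) auto
    then show ?thesis by (simp add: algebra_simps)
  qed
  finally show ?case by (simp add: algebra_simps)
qed

lemma time_cofactors_t_le:
  assumes "mat_rows k (Suc k) M" "entries_level a M" "Suc k \<le> q" "(a + 1) * (2 * q) ^ k \<le> B"
  shows "time (cofactors_t sz (det_t sz k) (Suc k) M) \<le> 32 * q ^ 3 * (3 * q) ^ Suc k * C"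
proof -
  let ?T = "32 * q ^ 3 * (3 * q) ^ k * C"
  have "time (cofactors_t sz (det_t sz k) (Suc k) M) \<le> 2 * q * ?T + 21 * q ^ 3 * C"
    using time_det_t_le assms by (intro time_cofactors_t_step[where a = a]) auto
  also have "\<dots> \<le> 2 * q * ?T + q * ?T"
  proof -
    have "1 * (21 * (q ^ 3 * C)) \<le> (q * (3 * q) ^ k) * (32 * (q ^ 3 * C))" using q_pos by (intro mult_mono) auto
    then show ?thesis by (simp add: algebra_simps)
  qed
  finally show ?thesis by (simp add: algebra_simps)
qed

lemma time_min_t_le:
  "set (x # xs) \<subseteq> G B \<Longrightarrow> time (min_t sz x xs) \<le> (length xs + 1) * (C + 1)"
proof (induction xs arbitrary: x)
  case (Cons z xs)
  then have "arith_cost sz x z \<le> C" by (intro cost) auto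
  moreover have "time (min_t sz (if x \<le> z then x else z) xs) \<le> (length xs + 1) * (C + 1)"
    using Cons by (intro Cons.IH) auto
  ultimately show ?case by simp
qed simp

lemma time_max_t_le:
  "set (x # xs) \<subseteq> G B \<Longrightarrow> time (max_t sz x xs) \<le> (length xs + 1) * (C + 1)"
proof (induction xs arbitrary: x)
  case (Cons z xs)
  then have "arith_cost sz x z \<le> C" by (intro cost) auto
  moreover have "time (max_t sz (if x \<le> z then z else x) xs) \<le> (length xs + 1) * (C + 1)"
    using Cons by (intro Cons.IH) auto
  ultimately show ?case by simp
qed simp

lemma time_insort_t_le:
  "set (x # xs) \<subseteq> G B \<Longrightarrow> time (insort_t sz x xs) \<le> (length xs + 1) * (C + 1)"
proof (induction xs)
  case (Cons z xs)
  then have "arith_cost sz x z \<le> C" by (intro cost) auto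
  moreover have "time (insort_t sz x xs) \<le> (length xs + 1) * (C + 1)"
    using Cons by (intro Cons.IH) auto
  ultimately show ?case by simp
qed simp

lemma time_sort_t_le:
  "set xs \<subseteq> G B \<Longrightarrow> time (sort_t sz xs) \<le> (length xs + 1) * (length xs + 1) * (C + 1)"
proof (induction xs)
  case (Cons z xs)
  have "time (insort_t sz z (sort xs)) \<le> (length xs + 1) * (C + 1)"
    using Cons.prems time_insort_t_le[of z "sort xs"] by simp
  then show ?case using Cons by (simp add: algebra_simps)
qed simp

end

text \<open>In the application, \<open>Y = (n + 2) ^ (d + 1)\<^sup>2\<close>. All counts and times are bounded by powers of Y
  (times C), so that a sum of up to 16 terms only costs one more factor Y.\<close>

locale program_cost = size_model +
  fixes Y k a :: nat and ps :: "real list list" and y :: "real list"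
  assumes q_def: "q = k + 2" and Y16: "16 \<le> Y" and Yq: "q + 1 \<le> Y" and Yn: "length ps + 2 \<le> Y"
    and Yd: "(3 * q) ^ q \<le> Y ^ 2" and Yg: "(length ps * length ps + k + 3) ^ (k + 1) \<le> Y ^ 4"
    and Yh: "(2 * ((length ps * length ps + k + 1) choose k) + 2) ^ q \<le> Y ^ 3"
    and lenps: "\<forall>p\<in>set ps. length p = Suc k" and leny: "length y < Suc k"
    and ps_level: "\<forall>p\<in>set ps. set p \<subseteq> G a" and y_level: "set y \<subseteq> G a"
    and B_bound: "q * ((2 * a + 2) * (2 * q) ^ q
      + 2 * ((2 * (q * ((2 * a + 2) * (2 * q) ^ q + a + 1)) + 2) * (2 * q) ^ q) + 1) \<le> B"
begin

text \<open>The levels along the program: normals are determinants with entries of level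
  \<open>2 * a + 1\<close>, thresholds are values of normals on data of level a, the slice subtracts
  one more such value from the threshold, and vertices are quotients of two determinants of the
  resulting systems. B must also admit the inner product of a normal with a vertex, taken in the
  feasibility test.\<close>

definition normal_level :: nat where "normal_level = (2 * a + 2) * (2 * q) ^ q"
definition value_level :: nat where "value_level = q * (normal_level + a + 1)"
definition system_level :: nat where "system_level = 2 * value_level + 1"
definition vertex_level :: nat where "vertex_level = 2 * ((system_level + 1) * (2 * q) ^ q)"

lemma pow_q: "i \<le> q \<Longrightarrow> (2 * q) ^ i \<le> (2 * q) ^ q"
  using q_pos by (intro power_increasing) auto

lemma levels:
  "2 * a + 1 \<le> normal_level" "normal_level \<le> value_level" "value_level \<le> system_level"
  "system_level \<le> vertex_level" "(system_level + 1) * (2 * q) ^ q \<le> vertex_level"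
  "q * (normal_level + vertex_level + 1) \<le> B" "vertex_level \<le> B"
proof -
  have one: "1 \<le> (2 * q) ^ q" using q_pos by simp
  show "2 * a + 1 \<le> normal_level"
    using mult_left_mono[OF one, of "2 * a + 2"] by (simp add: normal_level_def)
  have q_mult: "x \<le> q * x" for x using q_pos by simp
  show "normal_level \<le> value_level"
    using q_mult[of "normal_level + a + 1"] by (simp add: value_level_def)
  show "value_level \<le> system_level" by (simp add: system_level_def)
  show "system_level \<le> vertex_level"
    using mult_left_mono[OF one, of "system_level + 1"] by (simp add: vertex_level_def)
  show "(system_level + 1) * (2 * q) ^ q \<le> vertex_level" by (simp add: vertex_level_def)
  have "system_level + 1 = 2 * (q * ((2 * a + 2) * (2 * q) ^ q + a + 1)) + 2"
    by (simp add: system_level_def value_level_def normal_level_def)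
  then show *: "q * (normal_level + vertex_level + 1) \<le> B"
    using B_bound by (simp only: vertex_level_def normal_level_def)
  then show "vertex_level \<le> B"
    using q_mult[of "normal_level + vertex_level + 1"] by linarith
qed

section \<open>Calculus of bounds by powers of Y\<close>

text \<open>Only the exponent of Y needs to be tracked: costs are added or multiplied by repetition
  counts, never by each other, so C stays linear.\<close>

definition bnd :: "nat \<Rightarrow> nat \<Rightarrow> bool" where
  "bnd e x \<longleftrightarrow> x \<le> Y ^ e * C"

lemma Y_pos: "1 \<le> Y"
  using Y16 by simp

lemma bnd_le: "bnd e x \<Longrightarrow> z \<le> x \<Longrightarrow> bnd e z"
  by (simp add: bnd_def)

lemma Y_power_mono: "e \<le> e' \<Longrightarrow> Y ^ e \<le> Y ^ e'"
  using Y_pos by (intro power_increasing) auto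

lemma bnd_up: "bnd e x \<Longrightarrow> e \<le> e' \<Longrightarrow> bnd e' x"
  unfolding bnd_def using Y_power_mono[of e e'] mult_right_mono[of "Y ^ e" "Y ^ e'" C] by linarith

lemma bnd_nat: "x \<le> Y ^ e \<Longrightarrow> bnd e x"
  unfolding bnd_def using C_pos mult_mono[of x "Y ^ e" 1 C] by simp

lemma bnd_C: "x \<le> C \<Longrightarrow> bnd e x"
  using bnd_up[of 0 x e] by (simp add: bnd_def)

lemma bnd_one: "bnd e 1"
  using Y_pos by (intro bnd_nat) simp

lemma bnd_16:
  assumes "x \<le> 16 * (Y ^ e * C)"
  shows "bnd (Suc e) x"
proof -
  have "16 * (Y ^ e * C) \<le> Y * (Y ^ e * C)" using Y16 by (rule mult_right_mono) simp
  then have "x \<le> Y * (Y ^ e * C)" using assms by linarith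
  then show ?thesis by (simp only: bnd_def power_Suc mult.assoc)
qed

lemma bnd_add: "bnd e x \<Longrightarrow> bnd e z \<Longrightarrow> bnd (Suc e) (x + z)"
  by (rule bnd_16) (simp add: bnd_def)

lemma bnd_mult: "m \<le> Y ^ i \<Longrightarrow> bnd j x \<Longrightarrow> bnd (i + j) (m * x)"
  unfolding bnd_def using mult_mono[of m "Y ^ i" x "Y ^ j * C"] by (simp add: power_add mult.assoc)

lemma bnd_list:
  assumes "length xs + 1 \<le> Y ^ i"
  shows "bnd (i + j + 1) ((length xs + 1) * (Y ^ j * C + 1))"
proof -
  have "bnd (Suc j) (Y ^ j * C + 1)" using bnd_add[of j "Y ^ j * C" 1] bnd_one by (simp add: bnd_def)
  then have "bnd (i + Suc j) ((length xs + 1) * (Y ^ j * C + 1))" by (rule bnd_mult[OF assms])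
  then show ?thesis by (simp only: Suc_eq_plus1 add.assoc)
qed

lemma bnd_map_t:
  assumes "length xs + 1 \<le> Y ^ i" "\<And>x. x \<in> set xs \<Longrightarrow> bnd j (time (f x))"
  shows "bnd (i + j + 1) (time (map_t f xs))"
  by (rule bnd_le[OF bnd_list[OF assms(1)] time_map_t_le]) (use assms(2) in \<open>simp add: bnd_def\<close>)

lemma bnd_C_list:
  assumes "length xs + 1 \<le> Y ^ i"
  shows "bnd (i + 1) ((length xs + 1) * (C + 1))"
  using bnd_list[OF assms, of 0] by simp

lemma Y_dominates: "q \<le> Y" "k + 3 \<le> Y" "length ps + 1 \<le> Y" "length ps \<le> Y" "length y + 1 \<le> Y" "10 * q * C \<le> Y ^ 2 * C"
  "32 * q ^ 3 * (3 * q) ^ q * C \<le> Y ^ 7 * C"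
proof -
  show q: "q \<le> Y" "k + 3 \<le> Y" "length ps + 1 \<le> Y" "length ps \<le> Y" "length y + 1 \<le> Y"
    using Yq Yn q_def leny by auto
  have "10 * q \<le> Y * Y" using q Y16 by (intro mult_mono) auto
  then show "10 * q * C \<le> Y ^ 2 * C" by (simp add: power2_eq_square)
  \<comment> \<open>The exponent 7 for a determinant is 2 + 3 + 2, from the factors 32,
    \<open>q ^ 3\<close> and \<open>(3 * q) ^ q\<close>.\<close>
  have "32 \<le> Y ^ 2" using power_mono[of 16 Y 2] Y16 by simp
  then have "32 * q ^ 3 * (3 * q) ^ q \<le> Y ^ 2 * Y ^ 3 * Y ^ 2"
    using q Yd by (intro mult_mono power_mono) auto
  also have "\<dots> = Y ^ 7" by (simp flip: power_add)
  finally show "32 * q ^ 3 * (3 * q) ^ q * C \<le> Y ^ 7 * C" by simp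
qed

lemma bnd_inner_t:
  assumes "set u \<subseteq> G b" "set v \<subseteq> G c" "length u \<le> q" "q * (b + c + 1) \<le> B"
  shows "bnd 2 (time (inner_t sz u v))"
  unfolding bnd_def using time_inner_t_le[OF assms] Y_dominates(6) by linarith

lemma pow3_q: "i \<le> q \<Longrightarrow> 32 * q ^ 3 * (3 * q) ^ i * C \<le> 32 * q ^ 3 * (3 * q) ^ q * C"
  using q_pos by (intro mult_right_mono mult_left_mono power_increasing) auto

lemma bnd_det_t:
  assumes "mat_rows i i M" "entries_level b M" "i \<le> q" "(b + 1) * (2 * q) ^ q \<le> B"
  shows "bnd 7 (time (det_t sz i M))"
proof -
  have "(b + 1) * (2 * q) ^ i \<le> (b + 1) * (2 * q) ^ q" using pow_q[OF assms(3)] by (rule mult_left_mono) simp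
  then have "time (det_t sz i M) \<le> 32 * q ^ 3 * (3 * q) ^ i * C"
    using assms by (intro time_det_t_le) auto
  then show ?thesis unfolding bnd_def using Y_dominates(7) pow3_q[OF assms(3)] by linarith
qed

lemma bnd_cofactors_t:
  assumes "mat_rows k (Suc k) M" "entries_level b M" "(b + 1) * (2 * q) ^ q \<le> B"
  shows "bnd 7 (time (cofactors_t sz (det_t sz k) (Suc k) M))"
proof -
  have kq: "Suc k \<le> q" "k \<le> q" using q_def by auto
  have "(b + 1) * (2 * q) ^ k \<le> (b + 1) * (2 * q) ^ q" using pow_q[OF kq(2)] by (rule mult_left_mono) simp
  then have "time (cofactors_t sz (det_t sz k) (Suc k) M) \<le> 32 * q ^ 3 * (3 * q) ^ Suc k * C"
    using assms kq by (intro time_cofactors_t_le) auto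
  then show ?thesis unfolding bnd_def using Y_dominates(7) pow3_q[OF kq(1)] by linarith
qed

section \<open>Running times of the stages of the procedure\<close>

lemma entries_level_directions: "entries_level (2 * a + 1) (directions (Suc k) ps)"
proof -
  have "set (map2 (-) p r) \<subseteq> G (2 * a + 1)" if "p \<in> set ps" "r \<in> set ps" for p r
  proof -
    have "x - z \<in> G (2 * a + 1)" if "x \<in> set p" "z \<in> set r" for x z
      using level_diff[of x a z a] that ps_level \<open>p \<in> set ps\<close> \<open>r \<in> set ps\<close> by (auto simp: mult_2)
    then show ?thesis by (auto elim!: in_set_zipE)
  qed
  moreover have "set (unit_list (Suc k) j) \<subseteq> G (2 * a + 1)" for j
    using set_update_subset_insert[of "replicate (Suc k) 0" j "1::real"] zero_level one_level
    by (auto simp: unit_list_def)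
  moreover have "r \<in> {map2 (-) p r' |p r'. p \<in> set ps \<and> r' \<in> set ps} \<union> range (unit_list (Suc k))"
    if "r \<in> set (directions (Suc k) ps)" for r
    using that by (auto simp: directions_def simp del: upt_Suc)
  ultimately show ?thesis unfolding entries_level_def by blast
qed

lemma length_directions_list: "length (directions (Suc k) ps) = length ps * length ps + k + 1"
  by (simp add: directions_def length_concat comp_def sum_list_triv)

lemma subset_level: "entries_level b M \<Longrightarrow> set M' \<subseteq> set M \<Longrightarrow> entries_level b M'"
  by (auto simp: entries_level_def)

lemma k_sublists_level:
  "entries_level b M \<Longrightarrow> M' \<in> set (k_sublists M i) \<Longrightarrow> entries_level b M'"
  using set_nths_subset by (fastforce simp: set_k_sublists intro: subset_level)

lemma normals_level: "u \<in> set (normals (Suc k) ps) \<Longrightarrow> set u \<subseteq> G normal_level"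
proof -
  have "set (cofactors (Suc k) M) \<subseteq> G normal_level" if "M \<in> set (k_sublists (directions (Suc k) ps) k)" for M
  proof -
    have "set (cofactors (Suc k) M) \<subseteq> G ((2 * a + 1 + 1) * (2 * q) ^ k)"
      using mat_rows_directions[OF lenps that] k_sublists_level[OF entries_level_directions that] q_def
      by (intro cofactors_level) auto
    moreover have "(2 * a + 1 + 1) * (2 * q) ^ k \<le> normal_level"
      unfolding normal_level_def using pow_q[of k] q_def by (intro mult_mono) auto
    ultimately show ?thesis using level_mono by blast
  qed
  moreover assume "u \<in> set (normals (Suc k) ps)"
  then obtain M where "M \<in> set (k_sublists (directions (Suc k) ps) k)"
      "u = cofactors (Suc k) M \<or> u = map uminus (cofactors (Suc k) M)"
    by (auto simp: normals_def Let_def)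
  ultimately show ?thesis using level_uminus by fastforce
qed

lemma choose_le: "((length ps * length ps + k + 1) choose k) + 1 \<le> Y ^ 4"
proof -
  let ?N = "length ps * length ps + k + 1"
  have "(?N choose k) + 1 \<le> (?N + 1) ^ k + (?N + 1) ^ k"
    using binomial_le_power[of ?N k] by (intro add_mono) auto
  also have "\<dots> \<le> (?N + 2) * (?N + 2) ^ k"
  proof -
    have "2 * (?N + 1) ^ k \<le> (?N + 2) * (?N + 2) ^ k" by (intro mult_mono power_mono) auto
    then show ?thesis by simp
  qed
  also have "\<dots> = (length ps * length ps + k + 3) ^ (k + 1)" by (simp add: numeral_3_eq_3)
  finally show ?thesis using Yg by linarith
qed

text \<open>The cross products dominate: fewer than \<open>Y ^ 4\<close> of them at
  \<open>Y ^ 7 * C\<close> each, with one more power for the map and one for the final sum.\<close>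

lemma bnd_normals_t: "bnd 13 (time (normals_t sz (Suc k) ps))"
proof -
  let ?g = "directions (Suc k) ps"
  let ?N = "length ps * length ps + k + 1"
  have lev: "a \<le> B" "normal_level \<le> B" using levels by linarith+
  have dirlev: "(2 * a + 1 + 1) * (2 * q) ^ q \<le> B" using lev(2) by (simp add: normal_level_def)
  have 1: "bnd 7 (time (differences_t sz ps))"
  proof -
    have "bnd 2 (time (map2_t (sub_t sz) p r))" if "p \<in> set ps" "r \<in> set ps" for p r
    proof -
      have "time (map2_t (sub_t sz) p r) \<le> (length p + 1) * (C + 1)"
        using that ps_level lev by (intro time_map2_t_le) (auto intro!: cost_le[of _ a _ a])
      moreover have "bnd (1 + 1) ((length p + 1) * (C + 1))"
        using that lenps Y_dominates by (intro bnd_C_list) auto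
      ultimately show ?thesis using bnd_le by (metis nat_1_add_1)
    qed
    then have "bnd (1 + (1 + 2 + 1) + 1) (time (map_t (\<lambda>p. map_t (\<lambda>r. map2_t (sub_t sz) p r) ps) ps))"
      using Y_dominates by (intro bnd_map_t) auto
    then have "bnd 6 (time (map_t (\<lambda>p. map_t (\<lambda>r. map2_t (sub_t sz) p r) ps) ps))" by (rule bnd_up) simp
    moreover have "bnd 2 (time (concat_t (map (\<lambda>p. map (\<lambda>r. map2 (-) p r) ps) ps)))"
    proof -
      have "time (concat_t (map (\<lambda>p. map (\<lambda>r. map2 (-) p r) ps) ps))
          \<le> (length (map (\<lambda>p. map (\<lambda>r. map2 (-) p r) ps) ps) + 1) * (length ps + 2)"
        by (intro time_concat_t_le) auto
      also have "\<dots> \<le> Y * Y" using Yn by (intro mult_mono) auto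
      finally show ?thesis by (intro bnd_nat) (simp add: power2_eq_square)
    qed
    then have "bnd 6 (time (concat_t (map (\<lambda>p. map (\<lambda>r. map2 (-) p r) ps) ps)))" by (rule bnd_up) simp
    ultimately have "bnd (Suc 6) (1 + time (map_t (\<lambda>p. map_t (\<lambda>r. map2_t (sub_t sz) p r) ps) ps) +
        time (concat_t (map (\<lambda>p. map (\<lambda>r. map2 (-) p r) ps) ps)))"
      using bnd_one[of 6] unfolding bnd_def[of 6] by (intro bnd_16) linarith
    then show ?thesis by (simp add: differences_t_def)
  qed
  have 2: "bnd 5 (time (unit_vectors_t (Suc k)))"
  proof -
    have "bnd 2 (time (do { zs \<leftarrow> replicate_t (Suc k) 0; update_t j (1::real) zs }))" for j
    proof -
      have "time (do { zs \<leftarrow> replicate_t (Suc k) 0; update_t j (1::real) zs }) \<le> 2 * (Suc k + 1)"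
        using time_update_t_le[of j 1 "replicate (Suc k) (0::real)"]
        by (simp add: time_replicate_t del: replicate_t.simps replicate_Suc)
      also have "\<dots> \<le> Y * Y" using Y_dominates Y16 by (intro mult_mono) auto
      finally show ?thesis by (intro bnd_nat) (simp add: power2_eq_square)
    qed
    then have "bnd (1 + 2 + 1) (time (map_t (\<lambda>j. do { zs \<leftarrow> replicate_t (Suc k) 0; update_t j (1::real) zs }) [0..<Suc k]))"
      using Y_dominates by (intro bnd_map_t) auto
    then have "bnd 4 (time (map_t (\<lambda>j. do { zs \<leftarrow> replicate_t (Suc k) 0; update_t j (1::real) zs }) [0..<Suc k]))"
      by (rule bnd_up) simp
    moreover have "bnd 4 (time (upto_t (Suc k)))"
    proof -
      have "time (upto_t (Suc k)) \<le> (Suc k + 1) * (Suc k + 1)" by (rule time_upto_t_le)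
      also have "\<dots> \<le> Y * Y" using Y_dominates by (intro mult_mono) auto
      finally have "bnd 2 (time (upto_t (Suc k)))" by (intro bnd_nat) (simp add: power2_eq_square)
      then show ?thesis by (rule bnd_up) simp
    qed
    ultimately have "bnd (Suc 4) (1 + time (upto_t (Suc k)) +
       time (map_t (\<lambda>j. do { zs \<leftarrow> replicate_t (Suc k) 0; update_t j (1::real) zs }) [0..<Suc k]))"
      using bnd_one[of 4] unfolding bnd_def[of 4] by (intro bnd_16) linarith
    then show ?thesis unfolding unit_vectors_t_def time_tick time_bind val_upto_t
      by (simp add: add.assoc del: upt_Suc upto_t.simps replicate_t.simps)
  qed
  let ?Ms = "k_sublists ?g k"
  have lenMs: "length ?Ms + 1 \<le> Y ^ 4"
    using choose_le by (simp add: length_k_sublists length_directions_list)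
  have 3: "bnd 5 (time (sublists_t ?g k))"
  proof -
    have "time (sublists_t ?g k) \<le> 4 * (length ps * length ps + k + 3) ^ (k + 1)"
      using time_sublists_t_le[of ?g k] by (simp add: length_directions_list numeral_3_eq_3)
    also have "\<dots> \<le> Y * Y ^ 4" using Yg Y16 by (intro mult_mono) auto
    also have "\<dots> = Y ^ 5" by (simp add: eval_nat_numeral)
    finally show ?thesis by (rule bnd_nat)
  qed
  have 4: "bnd (4 + 7 + 1) (time (map_t (cofactors_t sz (det_t sz k) (Suc k)) ?Ms))"
    using lenMs mat_rows_directions[OF lenps] k_sublists_level[OF entries_level_directions] dirlev
    by (intro bnd_map_t bnd_cofactors_t) auto
  let ?us = "map (cofactors (Suc k)) ?Ms"
  have us: "map (\<lambda>M. val (cofactors_t sz (det_t sz k) (Suc k) M)) ?Ms = ?us"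
    using mat_rows_directions[OF lenps] by (intro map_cong refl val_cofactors_t)
  have neg: "bnd 3 (time (negate_t sz u))" if "u \<in> set ?us" for u
  proof -
    have u: "set u \<subseteq> G B" "length u = Suc k"
      using that normals_level[of u] lev level_mono[of normal_level B] by (auto simp: normals_def Let_def)
    have "bnd (1 + 1) ((length u + 1) * (C + 1))" using u Y_dominates by (intro bnd_C_list) auto
    then have "bnd 3 (1 + (length u + 1) * (C + 1))"
      using bnd_add[OF bnd_one, of 2] by (simp add: numeral_3_eq_3 numeral_2_eq_2)
    then show ?thesis by (rule bnd_le) (rule time_negate_t_le[OF u(1)])
  qed
  have 5: "bnd (4 + 3 + 1) (time (map_t (negate_t sz) ?us))"
    using lenMs neg by (intro bnd_map_t) auto
  have 6: "bnd 4 (time (append_t ?us (map (map uminus) ?us)))"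
    using lenMs by (intro bnd_nat) (simp add: time_append_t)
  let ?ds = "concat (map (\<lambda>p. map (\<lambda>r. map2 (-) p r) ps) ps)"
  have 7: "bnd 2 (time (append_t ?ds (map (unit_list (Suc k)) [0..<Suc k])))"
  proof -
    have "length ps * length ps + 1 \<le> (length ps + 1) * (length ps + 1)" by simp
    also have "\<dots> \<le> Y * Y" using Y_dominates by (intro mult_mono) auto
    finally show ?thesis
      by (intro bnd_nat) (simp add: time_append_t length_concat comp_def sum_list_triv power2_eq_square)
  qed
  have "time (normals_t sz (Suc k) ps) = 1 + time (differences_t sz ps) + time (unit_vectors_t (Suc k)) +
      time (append_t ?ds (map (unit_list (Suc k)) [0..<Suc k])) + time (sublists_t ?g k) +
      time (map_t (cofactors_t sz (det_t sz k) (Suc k)) ?Ms) + time (map_t (negate_t sz) ?us) +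
      time (append_t ?us (map (map uminus) ?us))"
    unfolding normals_t_def time_tick time_bind val_bind val_differences_t val_unit_vectors_t val_append_t
      directions_def[symmetric] val_sublists_t val_map_t diff_Suc_1 us val_negate_t
    by simp
  moreover have "bnd 12 (time (differences_t sz ps))" "bnd 12 (time (unit_vectors_t (Suc k)))"
      "bnd 12 (time (append_t ?ds (map (unit_list (Suc k)) [0..<Suc k])))" "bnd 12 (time (sublists_t ?g k))"
      "bnd 12 (time (map_t (cofactors_t sz (det_t sz k) (Suc k)) ?Ms))" "bnd 12 (time (map_t (negate_t sz) ?us))"
      "bnd 12 (time (append_t ?us (map (map uminus) ?us)))"
    using 1 2 3 4 5 6 7 by (auto intro: bnd_up)
  ultimately have "bnd (Suc 12) (time (normals_t sz (Suc k) ps))"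
    using bnd_one[of 12] unfolding bnd_def[of 12] by (intro bnd_16) linarith
  then show ?thesis by simp
qed

end

context program_cost
begin

lemma length_normals_list: "length (normals (Suc k) ps) = 2 * ((length ps * length ps + k + 1) choose k)"
  by (simp add: normals_def Let_def length_k_sublists length_directions_list)

text \<open>The q-th power is what the vertex enumeration consumes: listing all systems of m
  halfspaces takes time of order \<open>(length hs + 2) ^ (m + 1)\<close> with m + 1 \<le>
  q.\<close>

lemma length_normals_le: "length (normals (Suc k) ps) + 1 \<le> Y ^ 3" "(length (normals (Suc k) ps) + 2) ^ q \<le> Y ^ 3"
proof -
  show *: "(length (normals (Suc k) ps) + 2) ^ q \<le> Y ^ 3"
    using Yh by (simp add: length_normals_list)
  have "length (normals (Suc k) ps) + 2 \<le> (length (normals (Suc k) ps) + 2) ^ q"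
    using q_pos by (intro self_le_power) auto
  then show "length (normals (Suc k) ps) + 1 \<le> Y ^ 3" using * by linarith
qed

lemma level_bounds:
  "Suc k \<le> q" "length y \<le> q" "normal_level \<le> B" "value_level \<le> B" "system_level \<le> B"
  "q * (normal_level + a + 1) = value_level" "q * (a + normal_level + 1) = value_level"
proof -
  show "Suc k \<le> q" "length y \<le> q" using q_def leny by simp_all
  show "normal_level \<le> B" "value_level \<le> B" "system_level \<le> B" using levels by linarith+
  show "q * (normal_level + a + 1) = value_level" "q * (a + normal_level + 1) = value_level"
    by (simp_all only: value_level_def add.commute[of a])
qed

lemma inner_normal_level:
  assumes "u \<in> set (normals (Suc k) ps)" "p \<in> set ps"
  shows "inner_list u p \<in> G value_level"
  using inner_level[OF normals_level[OF assms(1)], of p a] length_normals[OF assms(1)] ps_level assms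
  by (simp only: level_bounds)

lemma order_stat_level:
  assumes "u \<in> set (normals (Suc k) ps)" "1 \<le> \<kappa>" "\<kappa> \<le> length ps"
  shows "order_stat ps \<kappa> u \<in> G value_level"
proof -
  have "order_stat ps \<kappa> u \<in> set (map (inner_list u) ps)"
    unfolding order_stat_def
    using assms nth_mem[of "\<kappa> - 1" "sort (map (inner_list u) ps)"] by simp
  then show ?thesis using inner_normal_level[OF assms(1)] by auto
qed

lemma bnd_depth_region_t:
  assumes "1 \<le> \<kappa>" "\<kappa> \<le> length ps"
  shows "bnd 14 (time (depth_region_t sz (Suc k) ps \<kappa>))"
proof -
  let ?f = "\<lambda>u. do { ts \<leftarrow> map_t (inner_t sz u) ps; ss \<leftarrow> sort_t sz ts; t \<leftarrow> nth_t ss (\<kappa> - 1); ret (u, t) }"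
  have "bnd 5 (time (?f u))" if u: "u \<in> set (normals (Suc k) ps)" for u
  proof -
    have "bnd 2 (time (inner_t sz u p))" if "p \<in> set ps" for p
      by (rule bnd_inner_t[OF normals_level[OF u], of _ a])
        (use that ps_level length_normals[OF u] in \<open>simp_all only: level_bounds\<close>)
    then have "bnd (1 + 2 + 1) (time (map_t (inner_t sz u) ps))" using Y_dominates by (intro bnd_map_t) auto
    then have 1: "bnd 4 (time (map_t (inner_t sz u) ps))" by (rule bnd_up) simp
    let ?ts = "map (inner_list u) ps"
    have "set ?ts \<subseteq> G B" using inner_normal_level[OF u] levels level_up[of _ value_level B] by auto
    then have "time (sort_t sz ?ts) \<le> (length ?ts + 1) * (length ?ts + 1) * (C + 1)" by (rule time_sort_t_le)
    moreover have "bnd (1 + (1 + 1)) ((length ps + 1) * ((length ps + 1) * (C + 1)))"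
      using Y_dominates by (intro bnd_mult bnd_C_list) auto
    ultimately have "bnd (1 + (1 + 1)) (time (sort_t sz ?ts))"
      by (elim bnd_le) (simp only: length_map mult.assoc)
    then have 2: "bnd 4 (time (sort_t sz ?ts))" by (rule bnd_up) simp
    have "time (nth_t (sort ?ts) (\<kappa> - 1)) \<le> Y ^ 1" using time_nth_t_le[of "sort ?ts" "\<kappa> - 1"] Y_dominates by simp
    then have 3: "bnd 4 (time (nth_t (sort ?ts) (\<kappa> - 1)))" by (intro bnd_up[OF bnd_nat[of _ 1]]) auto
    have "time (?f u) = time (map_t (inner_t sz u) ps) + time (sort_t sz ?ts) + time (nth_t (sort ?ts) (\<kappa> - 1))"
      by simp
    then have "bnd (Suc 4) (time (?f u))"
      using 1 2 3 unfolding bnd_def[of 4] by (intro bnd_16) linarith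
    then show ?thesis by simp
  qed
  then have "bnd (3 + 5 + 1) (time (map_t ?f (normals (Suc k) ps)))"
    using length_normals_le by (intro bnd_map_t) auto
  then have "bnd 13 (time (map_t ?f (normals (Suc k) ps)))" by (rule bnd_up) simp
  then have "bnd (Suc 13) (1 + time (normals_t sz (Suc k) ps) + time (map_t ?f (normals (Suc k) ps)))"
    using bnd_normals_t bnd_one[of 13] unfolding bnd_def[of 13] by (intro bnd_16) linarith
  then show ?thesis
    unfolding depth_region_t_def time_tick time_bind val_normals_t[OF lenps] by simp
qed

lemma bnd_intersect_t:
  assumes "1 \<le> \<kappa>" "\<kappa> \<le> length ps"
  defines "hs \<equiv> val (depth_region_t sz (Suc k) ps \<kappa>)"
  shows "bnd 10 (time (intersect_t sz y hs))"
    and "\<forall>(u, t)\<in>set (val (intersect_t sz y hs)). length u = Suc k - length y \<and>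
      set u \<subseteq> G normal_level \<and> t \<in> G system_level"
    and "length (val (intersect_t sz y hs)) = length (normals (Suc k) ps)"
proof -
  have hs: "hs = map (\<lambda>u. (u, order_stat ps \<kappa> u)) (normals (Suc k) ps)"
    unfolding hs_def by (rule val_depth_region_t[OF lenps assms(1,2)])
  have yu: "inner_list y u \<in> G value_level" if "u \<in> set (normals (Suc k) ps)" for u
    using inner_level[OF y_level normals_level[OF that]] by (simp only: level_bounds)
  let ?f = "\<lambda>(u, t). do { s \<leftarrow> inner_t sz y u; t' \<leftarrow> sub_t sz t s; u' \<leftarrow> drop_t (length y) u; ret (u', t') }"
  have f: "bnd 3 (time (?f h))" if "h \<in> set hs" for h
  proof -
    obtain u t where h: "h = (u, t)" by (cases h)
    have u: "u \<in> set (normals (Suc k) ps)" and t: "t \<in> G value_level"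
    proof -
      show "u \<in> set (normals (Suc k) ps)" using that by (auto simp: hs h)
      then show "t \<in> G value_level"
        using that order_stat_level[OF _ assms(1,2)] by (auto simp: hs h)
    qed
    have 1: "bnd 2 (time (inner_t sz y u))"
      by (rule bnd_inner_t[OF y_level normals_level[OF u]])
        (simp_all only: level_bounds)
    have "arith_cost sz t (inner_list y u) \<le> C"
      using t yu[OF u] levels by (intro cost_le[of _ value_level _ value_level]) auto
    then have 2: "bnd 2 (arith_cost sz t (inner_list y u))" by (rule bnd_C)
    have "time (drop_t (length y) u) \<le> Y ^ 1"
      using time_drop_t_le[of "length y" u] length_normals[OF u] Y_dominates(2) by simp
    then have 3: "bnd 2 (time (drop_t (length y) u))" by (intro bnd_up[OF bnd_nat[of _ 1]]) auto
    have "time (?f (u, t)) = time (inner_t sz y u) + arith_cost sz t (inner_list y u) + time (drop_t (length y) u)"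
      by simp
    then have "bnd (Suc 2) (time (?f (u, t)))"
      using 1 2 3 unfolding bnd_def[of 2] by (intro bnd_16) linarith
    then show ?thesis by (simp add: h)
  qed
  have "length hs + 1 \<le> Y ^ 3" using length_normals_le(1) by (simp add: hs)
  then have "bnd (3 + 3 + 1) (time (map_t ?f hs))" using f by (rule bnd_map_t)
  then have 1: "bnd 9 (time (map_t ?f hs))" by (rule bnd_up) simp
  have "bnd 1 (time (length_t y))" using Y_dominates by (intro bnd_nat) (simp add: time_length_t)
  then have 2: "bnd 9 (time (length_t y))" by (rule bnd_up) simp
  have "time (intersect_t sz y hs) = 1 + time (length_t y) + time (map_t ?f hs)"
    by (simp add: intersect_t_def)
  then have "bnd (Suc 9) (time (intersect_t sz y hs))"
    using 1 2 bnd_one[of 9] unfolding bnd_def[of 9] by (intro bnd_16) linarith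
  then show "bnd 10 (time (intersect_t sz y hs))" by simp
  show "length (val (intersect_t sz y hs)) = length (normals (Suc k) ps)"
    by (simp add: val_intersect_t hs)
  show "\<forall>(u, t)\<in>set (val (intersect_t sz y hs)). length u = Suc k - length y \<and>
      set u \<subseteq> G normal_level \<and> t \<in> G system_level"
  proof (rule ballI, clarify)
    fix v t assume "(v, t) \<in> set (val (intersect_t sz y hs))"
    then obtain u where u: "u \<in> set (normals (Suc k) ps)" "v = drop (length y) u"
        "t = order_stat ps \<kappa> u - inner_list y u"
      unfolding val_intersect_t hs by force
    have "t \<in> G system_level"
      using level_diff[OF order_stat_level[OF u(1) assms(1,2)] yu[OF u(1)]]
      by (simp only: u system_level_def mult_2)
    moreover have "set v \<subseteq> G normal_level"
      using normals_level[OF u(1)] set_drop_subset[of "length y" u] by (simp add: u)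
    ultimately show "length v = Suc k - length y \<and> set v \<subseteq> G normal_level \<and> t \<in> G system_level"
      by (simp add: u length_normals[OF u(1)])
  qed
qed

context
  fixes m :: nat and hs :: "(real list \<times> real) list"
  assumes m: "m \<le> Suc k"
    and hs: "\<forall>(u, t)\<in>set hs. length u = m \<and> set u \<subseteq> G normal_level \<and> t \<in> G system_level"
    and lenhs: "length hs = length (normals (Suc k) ps)"
begin

lemma det_level_B: "(system_level + 1) * (2 * q) ^ q \<le> B"
  using levels by linarith

lemma m_bounds: "m \<le> q" "m + 1 \<le> q" "m + 1 \<le> Y ^ 1"
  using m q_def Y_dominates(2) by simp_all

lemma system_rows:
  assumes "S \<in> set (k_sublists hs m)"
  shows "length S = m" "mat_rows m m (map fst S)" "entries_level system_level (map fst S)"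
    and "mat_rows m m (map (\<lambda>(u, t). u[j := t]) S)" "entries_level system_level (map (\<lambda>(u, t). u[j := t]) S)"
proof -
  have S: "length S = m" "\<forall>(u, t)\<in>set S. length u = m \<and> set u \<subseteq> G normal_level \<and> t \<in> G system_level"
    using assms hs set_nths_subset[of hs] by (fastforce simp: set_k_sublists)+
  have le: "normal_level \<le> system_level" using levels by linarith
  show "length S = m" by (rule S(1))
  show "mat_rows m m (map fst S)" using S by (auto simp: mat_rows_def)
  show "entries_level system_level (map fst S)"
    using S level_mono[OF le] by (fastforce simp: entries_level_def)
  show "mat_rows m m (map (\<lambda>(u, t). u[j := t]) S)" using S by (auto simp: mat_rows_def)
  have "set (u[j := t]) \<subseteq> G system_level" if "(u, t) \<in> set S" for u t
    using S that level_mono[OF le] set_update_subset_insert[of u j t] by blast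
  then show "entries_level system_level (map (\<lambda>(u, t). u[j := t]) S)"
    by (auto simp: entries_level_def)
qed

lemma system_det_level:
  assumes "S \<in> set (k_sublists hs m)"
  shows "det (rows_mat m (map fst S)) \<in> G ((system_level + 1) * (2 * q) ^ q)"
    "det (rows_mat m (map (\<lambda>(u, t). u[j := t]) S)) \<in> G ((system_level + 1) * (2 * q) ^ q)"
proof -
  have le: "(system_level + 1) * (2 * q) ^ m \<le> (system_level + 1) * (2 * q) ^ q"
    using pow_q[OF m_bounds(1)] by (rule mult_left_mono) simp
  show "det (rows_mat m (map fst S)) \<in> G ((system_level + 1) * (2 * q) ^ q)"
    "det (rows_mat m (map (\<lambda>(u, t). u[j := t]) S)) \<in> G ((system_level + 1) * (2 * q) ^ q)"
    using det_level[OF system_rows(2,3)[OF assms] m_bounds(1)] det_level[OF system_rows(4,5)[OF assms] m_bounds(1)]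
      level_up[OF _ le] by blast+
qed

lemma solution_level:
  assumes S: "S \<in> set (k_sublists hs m)" and x: "val (solve_t sz m S) = Some x"
  shows "length x = m" "set x \<subseteq> G vertex_level"
proof -
  have "\<forall>(u, t)\<in>set S. length u = m" using system_rows(2)[OF S] by (auto simp: mat_rows_def)
  then have eq: "x = map (\<lambda>j. det (rows_mat m (map (\<lambda>(u, t). u[j := t]) S)) / det (rows_mat m (map fst S))) [0..<m]"
    using x system_rows(1)[OF S] by (simp add: val_solve_t split: if_splits)
  have "det (rows_mat m (map (\<lambda>(u, t). u[j := t]) S)) / det (rows_mat m (map fst S)) \<in> G vertex_level" for j
    using level_div[OF system_det_level(2)[OF S] system_det_level(1)[OF S]]
    by (simp only: vertex_level_def mult_2)
  then show "length x = m" "set x \<subseteq> G vertex_level" by (auto simp: eq)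
qed

lemma bnd_solve_t:
  assumes S: "S \<in> set (k_sublists hs m)"
  shows "bnd 12 (time (solve_t sz m S))"
proof -
  let ?A' = "\<lambda>j. map (\<lambda>(u, t). u[j := t]) S"
  let ?D = "det (rows_mat m (map fst S))"
  have D: "val (det_t sz m (map fst S)) = ?D" using system_rows(2)[OF S] by (rule val_det_t)
  have D': "val (det_t sz m (?A' j)) = det (rows_mat m (?A' j))" for j using system_rows(4)[OF S] by (rule val_det_t)
  have lS: "length S + 1 \<le> Y ^ 1" using system_rows(1)[OF S] m_bounds by simp
  have lev: "(system_level + 1) * (2 * q) ^ q \<le> B" by (rule det_level_B)
  have 1: "bnd 11 (time (map_t (\<lambda>(u, t). ret u) S))"
    by (rule bnd_up[OF bnd_map_t[OF lS, of 0]]) (auto simp: bnd_def)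
  have 2: "bnd 11 (time (det_t sz m (map fst S)))"
    using bnd_det_t[OF system_rows(2,3)[OF S] m_bounds(1) lev] by (rule bnd_up) simp
  have 3: "bnd 11 (arith_cost sz ?D 0)"
    using cost_le[OF system_det_level(1)[OF S] zero_level[of 0] lev]
    by (intro bnd_C) simp
  have "time (upto_t m) \<le> (m + 1) * (m + 1)" by (rule time_upto_t_le)
  also have "\<dots> \<le> Y * Y" using m_bounds by (intro mult_mono) auto
  finally have "bnd 2 (time (upto_t m))" by (intro bnd_nat) (simp add: power2_eq_square)
  then have 4: "bnd 11 (time (upto_t m))" by (rule bnd_up) simp
  let ?f = "\<lambda>j. do { A' \<leftarrow> map_t (\<lambda>(u, t). update_t j t u) S; D' \<leftarrow> det_t sz m A'; div_t sz D' ?D }"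
  have "bnd 8 (time (?f j))" for j
  proof -
    have "bnd 1 (time (update_t j t u))" if "(u, t) \<in> set S" for u t
    proof -
      have "length u = m" using that system_rows(2)[OF S] by (auto simp: mat_rows_def)
      then show ?thesis using time_update_t_le[of j t u] m_bounds by (intro bnd_nat) simp
    qed
    then have "bnd (1 + 1 + 1) (time (map_t (\<lambda>(u, t). update_t j t u) S))"
      by (intro bnd_map_t[OF lS]) auto
    then have "bnd 7 (time (map_t (\<lambda>(u, t). update_t j t u) S))" by (rule bnd_up) simp
    moreover have "bnd 7 (time (det_t sz m (?A' j)))"
      by (rule bnd_det_t[OF system_rows(4,5)[OF S] m_bounds(1) lev])
    moreover have "bnd 7 (arith_cost sz (det (rows_mat m (?A' j))) ?D)"
      using cost_le[OF system_det_level(2)[OF S] system_det_level(1)[OF S] lev lev] by (rule bnd_C)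
    moreover have "time (?f j) = time (map_t (\<lambda>(u, t). update_t j t u) S) + time (det_t sz m (?A' j)) +
        arith_cost sz (det (rows_mat m (?A' j))) ?D"
      by (simp add: D' case_prod_unfold D'[unfolded case_prod_unfold])
    ultimately have "bnd (Suc 7) (time (?f j))" unfolding bnd_def[of 7] by (intro bnd_16) linarith
    then show ?thesis by simp
  qed
  then have 5: "bnd 11 (time (map_t ?f [0..<m]))"
    using m_bounds by (intro bnd_up[OF bnd_map_t[of _ 1 8]]) auto
  have "time (solve_t sz m S) \<le> 1 + time (map_t (\<lambda>(u, t). ret u) S) + time (det_t sz m (map fst S)) +
      arith_cost sz ?D 0 + time (upto_t m) + time (map_t ?f [0..<m])"
  proof -
    have A: "val (map_t (\<lambda>(u, t). ret u) S) = map fst S" by (auto simp: case_prod_unfold)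
    show ?thesis
      unfolding solve_t_def time_tick time_bind A D val_arith time_arith by (simp del: val_map_t)
  qed
  then have "bnd (Suc 11) (time (solve_t sz m S))"
    using 1 2 3 4 5 bnd_one[of 11] unfolding bnd_def[of 11] by (intro bnd_16) linarith
  then show ?thesis by simp
qed

lemma bnd_feasible_t:
  assumes "length x = m" "set x \<subseteq> G vertex_level"
  shows "bnd 8 (time (feasible_t sz hs x))"
proof -
  let ?p = "\<lambda>(u, t). do { s \<leftarrow> inner_t sz u x; le_t sz t s }"
  have "bnd 3 (time (?p h))" if h: "h \<in> set hs" for h
  proof -
    obtain u t where ut: "h = (u, t)" by (cases h)
    have u: "length u \<le> q" "set u \<subseteq> G normal_level" "t \<in> G system_level" using h ut hs m_bounds(1) by auto
    have 1: "bnd 2 (time (inner_t sz u x))"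
      by (rule bnd_inner_t[OF u(2) assms(2) u(1) levels(6)])
    have "arith_cost sz t (inner_list u x) \<le> C"
      by (rule cost_le[OF u(3) inner_level[OF u(2) assms(2) u(1)] level_bounds(5) levels(6)])
    then have 2: "bnd 2 (arith_cost sz t (inner_list u x))" by (rule bnd_C)
    show ?thesis using bnd_add[OF 1 2] by (simp add: ut numeral_3_eq_3 numeral_2_eq_2)
  qed
  then have "time (all_t ?p hs) \<le> (length hs + 1) * (Y ^ 3 * C + 1)"
    by (intro time_all_t_le) (simp add: bnd_def)
  moreover have "bnd (3 + 3 + 1) ((length hs + 1) * (Y ^ 3 * C + 1))"
    using length_normals_le lenhs by (intro bnd_list) auto
  ultimately have "bnd (3 + 3 + 1) (time (all_t ?p hs))" by (rule bnd_le[rotated])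
  then have "bnd 7 (time (all_t ?p hs))" by simp
  then have "bnd (Suc 7) (1 + time (all_t ?p hs))" by (intro bnd_add bnd_one)
  then show ?thesis by (simp add: feasible_t_def)
qed

lemma time_collect_feasible_t_le:
  assumes "\<And>x. Some x \<in> set cs \<Longrightarrow> time (feasible_t sz hs x) \<le> T"
  shows "time (collect_feasible_t sz hs cs) \<le> (length cs + 1) * (T + 1)"
  using assms
proof (induction cs)
  case (Cons c cs)
  have IH: "time (collect_feasible_t sz hs cs) \<le> (length cs + 1) * (T + 1)"
    using Cons by auto
  show ?case
  proof (cases c)
    case None
    then show ?thesis using IH by simp
  next
    case (Some x)
    then have "time (feasible_t sz hs x) \<le> T" using Cons.prems by auto
    then show ?thesis using IH Some by simp
  qed
qed simp

lemma length_collect_feasible_t: "length (val (collect_feasible_t sz hs cs)) \<le> length cs"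
  by (induction cs) (auto split: option.splits)

lemma length_systems: "length (k_sublists hs m) + 1 \<le> Y ^ 4"
proof -
  have "(length hs choose m) \<le> (length hs + 2) ^ q"
  proof -
    have "(length hs choose m) \<le> (length hs + 1) ^ m" by (rule binomial_le_power)
    also have "\<dots> \<le> (length hs + 2) ^ m" by (rule power_mono) auto
    also have "\<dots> \<le> (length hs + 2) ^ q" using m_bounds by (intro power_increasing) auto
    finally show ?thesis .
  qed
  then have "(length hs choose m) + 1 \<le> Y ^ 3 + Y ^ 3" using length_normals_le lenhs Y_pos by (intro add_mono) auto
  also have "\<dots> = 2 * Y ^ 3" by simp
  also have "\<dots> \<le> Y * Y ^ 3" using Y16 by (intro mult_right_mono) auto
  finally show ?thesis by (simp add: length_k_sublists eval_nat_numeral)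
qed

text \<open>The most expensive part is solving fewer than \<open>Y ^ 4\<close> systems at
  \<open>Y ^ 12 * C\<close> each. The other two claims bound the number and the size of the points
  passed on.\<close>

lemma bnd_vertices_t:
  "bnd 18 (time (vertices_t sz m hs))"
  "length (val (vertices_t sz m hs)) + 1 \<le> Y ^ 4"
  "v \<in> set (val (vertices_t sz m hs)) \<Longrightarrow> length v = m \<and> set v \<subseteq> G vertex_level"
proof -
  let ?Ss = "k_sublists hs m" and ?cs = "map (\<lambda>S. val (solve_t sz m S)) (k_sublists hs m)"
  have cs: "length x = m \<and> set x \<subseteq> G vertex_level" if x: "Some x \<in> set ?cs" for x
  proof -
    obtain S where "S \<in> set ?Ss" "val (solve_t sz m S) = Some x"
      using x unfolding set_map by (auto dest: sym)
    then show ?thesis using solution_level by blast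
  qed
  have "4 * (length hs + 2) ^ (m + 1) \<le> Y * Y ^ 3"
  proof -
    have "(length hs + 2) ^ (m + 1) \<le> (length hs + 2) ^ q" using m_bounds by (intro power_increasing) auto
    then show ?thesis using length_normals_le lenhs Y16 by (intro mult_mono) auto
  qed
  then have "time (sublists_t hs m) \<le> Y ^ 4" using time_sublists_t_le[of hs m] by (simp add: eval_nat_numeral)
  then have 1: "bnd 17 (time (sublists_t hs m))" by (intro bnd_up[OF bnd_nat[of _ 4]]) auto
  have "bnd (4 + 12 + 1) (time (map_t (solve_t sz m) ?Ss))"
    using length_systems bnd_solve_t by (intro bnd_map_t) auto
  then have 2: "bnd 17 (time (map_t (solve_t sz m) ?Ss))" by simp
  have "time (collect_feasible_t sz hs ?cs) \<le> (length ?cs + 1) * (Y ^ 8 * C + 1)"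
    using bnd_feasible_t cs by (intro time_collect_feasible_t_le) (simp add: bnd_def)
  moreover have "bnd (4 + 8 + 1) ((length ?cs + 1) * (Y ^ 8 * C + 1))"
    using length_systems by (intro bnd_list) simp
  ultimately have "bnd (4 + 8 + 1) (time (collect_feasible_t sz hs ?cs))" by (rule bnd_le[rotated])
  then have 3: "bnd 17 (time (collect_feasible_t sz hs ?cs))" by (rule bnd_up) simp
  have "time (vertices_t sz m hs) = 1 + time (sublists_t hs m) + time (map_t (solve_t sz m) ?Ss) +
      time (collect_feasible_t sz hs ?cs)"
    by (simp add: vertices_t_def)
  then have "bnd (Suc 17) (time (vertices_t sz m hs))"
    using 1 2 3 bnd_one[of 17] unfolding bnd_def[of 17] by (intro bnd_16) linarith
  then show "bnd 18 (time (vertices_t sz m hs))" by simp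
  have "length (val (vertices_t sz m hs)) \<le> length ?Ss"
    using length_collect_feasible_t[of ?cs] by (simp add: vertices_t_def)
  then show "length (val (vertices_t sz m hs)) + 1 \<le> Y ^ 4" using length_systems by linarith
  show "v \<in> set (val (vertices_t sz m hs)) \<Longrightarrow> length v = m \<and> set v \<subseteq> G vertex_level"
    using cs by (auto simp: vertices_t_def set_val_collect_feasible_t)
qed

lemma bnd_range_t:
  assumes "0 < m"
  shows "bnd 19 (time (range_t sz m hs))"
proof -
  let ?vs = "val (vertices_t sz m hs)"
  have nth: "val (nth_t v 0) \<in> G B" if "v \<in> set ?vs" for v
  proof -
    have v: "0 < length v" "set v \<subseteq> G vertex_level" using bnd_vertices_t(3)[OF that] assms by auto
    then have "v ! 0 \<in> G vertex_level" using nth_mem by blast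
    then show ?thesis using v(1) level_up levels(7) by simp
  qed
  have "bnd 1 (time (nth_t v 0))" if "v \<in> set ?vs" for v
    using bnd_vertices_t(3)[OF that] time_nth_t_le[of v 0] m_bounds by (intro bnd_nat) auto
  then have "bnd (4 + 1 + 1) (time (map_t (\<lambda>v. nth_t v 0) ?vs))"
    using bnd_vertices_t(2) by (intro bnd_map_t) auto
  then have 1: "bnd 18 (time (map_t (\<lambda>v. nth_t v 0) ?vs))" by (rule bnd_up) simp
  show ?thesis
  proof (cases "map (\<lambda>v. val (nth_t v 0)) ?vs")
    case Nil
    then have "time (range_t sz m hs) = 1 + time (vertices_t sz m hs) + time (map_t (\<lambda>v. nth_t v 0) ?vs)"
      by (simp add: range_t_def)
    then have "bnd (Suc 18) (time (range_t sz m hs))"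
      using 1 bnd_vertices_t(1) bnd_one[of 18] unfolding bnd_def[of 18] by (intro bnd_16) linarith
    then show ?thesis by simp
  next
    case (Cons t ts)
    have "set (t # ts) \<subseteq> G B" using nth unfolding Cons[symmetric] by auto
    then have "time (min_t sz t ts) \<le> (length ts + 1) * (C + 1)" "time (max_t sz t ts) \<le> (length ts + 1) * (C + 1)"
      by (rule time_min_t_le, rule time_max_t_le)
    moreover have "length ts + 1 \<le> Y ^ 4"
      using bnd_vertices_t(2) arg_cong[OF Cons, of length] by simp
    then have "bnd (4 + 1) ((length ts + 1) * (C + 1))" by (rule bnd_C_list)
    then have "bnd 18 ((length ts + 1) * (C + 1))" by (rule bnd_up) simp
    ultimately have 2: "bnd 18 (time (min_t sz t ts))" "bnd 18 (time (max_t sz t ts))"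
      using bnd_le by blast+
    have "time (range_t sz m hs) = 1 + time (vertices_t sz m hs) + time (map_t (\<lambda>v. nth_t v 0) ?vs) +
        time (min_t sz t ts) + time (max_t sz t ts)"
      using Cons by (simp add: range_t_def)
    then have "bnd (Suc 18) (time (range_t sz m hs))"
      using 1 2 bnd_vertices_t(1) bnd_one[of 18] unfolding bnd_def[of 18] by (intro bnd_16) linarith
    then show ?thesis by simp
  qed
qed

end

text \<open>The condition on \<kappa> and r keeps every \<kappa> within n. The thresholds are then
  genuine order statistics of known level, whereas \<open>nth_t\<close> past the end of the list
  would return \<open>undefined\<close>.\<close>

lemma time_loop_t_le:
  "1 \<le> \<kappa> \<Longrightarrow> \<kappa> + r \<le> (length ps + 1) div 2 + 1 \<Longrightarrow>
    time (loop_t sz r \<kappa> (Suc k) ps y) \<le> (r + 1) * (Y ^ 20 * C + 1)"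
proof (induction r arbitrary: \<kappa>)
  case (Suc r)
  have \<kappa>: "1 \<le> \<kappa>" "\<kappa> \<le> length ps" using Suc.prems by linarith+
  let ?hs = "val (depth_region_t sz (Suc k) ps \<kappa>)"
  let ?hs' = "val (intersect_t sz y ?hs)"
  let ?J = "val (range_t sz (Suc k - length y) ?hs')"
  have IH: "time (loop_t sz r (\<kappa> + 1) (Suc k) ps y) \<le> (r + 1) * (Y ^ 20 * C + 1)"
    using Suc by (intro Suc.IH) auto
  have 1: "bnd 19 (time (depth_region_t sz (Suc k) ps \<kappa>))" "bnd 19 (time (intersect_t sz y ?hs))"
    by (rule bnd_up[OF bnd_depth_region_t[OF \<kappa>]], simp) (rule bnd_up[OF bnd_intersect_t(1)[OF \<kappa>]], simp)
  have 2: "bnd 19 (time (range_t sz (Suc k - length y) ?hs'))"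
    using leny bnd_intersect_t(2,3)[OF \<kappa>] by (intro bnd_range_t) auto
  have "bnd 1 (time (length_t y))" using Y_dominates by (intro bnd_nat) (simp add: time_length_t)
  then have 3: "bnd 19 (time (length_t y))" by (rule bnd_up) simp
  have "time (loop_t sz (Suc r) \<kappa> (Suc k) ps y) \<le> 1 + time (depth_region_t sz (Suc k) ps \<kappa>) +
      time (intersect_t sz y ?hs) + time (length_t y) + time (range_t sz (Suc k - length y) ?hs') +
      time (loop_t sz r (\<kappa> + 1) (Suc k) ps y)"
    by (cases ?J) auto
  moreover have "bnd (Suc 19) (1 + time (depth_region_t sz (Suc k) ps \<kappa>) +
      time (intersect_t sz y ?hs) + time (length_t y) + time (range_t sz (Suc k - length y) ?hs'))"
    using 1 2 3 bnd_one[of 19] unfolding bnd_def[of 19] by (intro bnd_16) linarith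
  ultimately have "time (loop_t sz (Suc r) \<kappa> (Suc k) ps y) \<le> Y ^ 20 * C + (r + 1) * (Y ^ 20 * C + 1)"
    using IH by (simp add: bnd_def)
  then show ?case by simp
qed simp

text \<open>The exponent 23 is 20 for one round, 2 for repeating it, and 1 for adding the
  computation of n.\<close>

lemma time_nested_intervals_t_le: "time (nested_intervals_t sz (Suc k) ps y) \<le> Y ^ 23 * C"
proof -
  let ?r = "(length ps + 1) div 2"
  have "time (loop_t sz ?r 1 (Suc k) ps y) \<le> (?r + 1) * (Y ^ 20 * C + 1)"
    by (rule time_loop_t_le) auto
  also have "\<dots> \<le> (length ps + 1) * (Y ^ 20 * C + 1)" by (intro mult_right_mono) auto
  finally have "bnd (1 + 20 + 1) (time (loop_t sz ?r 1 (Suc k) ps y))"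
    by (rule bnd_le[OF bnd_list, rotated]) (use Y_dominates(3) in simp)
  then have 1: "bnd 22 (time (loop_t sz ?r 1 (Suc k) ps y))" by simp
  have "bnd 1 (time (length_t ps))" using Y_dominates by (intro bnd_nat) (simp add: time_length_t)
  then have 2: "bnd 22 (time (length_t ps))" by (rule bnd_up) simp
  have "time (nested_intervals_t sz (Suc k) ps y) = 1 + time (length_t ps) + time (loop_t sz ?r 1 (Suc k) ps y)"
    by (simp add: nested_intervals_t_def)
  then have "bnd (Suc 22) (time (nested_intervals_t sz (Suc k) ps y))"
    using 1 2 bnd_one[of 22] unfolding bnd_def[of 22] by (intro bnd_16) linarith
  then show ?thesis by (simp add: bnd_def)
qed

end

section \<open>Bit sizes\<close>

text \<open>The fraction p / r need not be in lowest terms.\<close>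

definition height_at_most :: "nat \<Rightarrow> real set" where
  "height_at_most b = {x. \<exists>p r::int. x = of_int p / of_int r \<and> 0 < r \<and> \<bar>p\<bar> \<le> 2 ^ b \<and> r \<le> 2 ^ b}"

lemma height_at_mostI:
  "x = of_int p / of_int r \<Longrightarrow> 0 < r \<Longrightarrow> \<bar>p\<bar> \<le> 2 ^ b \<Longrightarrow> r \<le> 2 ^ b \<Longrightarrow> x \<in> height_at_most b"
  unfolding height_at_most_def by blast

lemma height_at_most_mono: "a \<le> b \<Longrightarrow> height_at_most a \<subseteq> height_at_most b"
proof
  fix x assume "a \<le> b" and "x \<in> height_at_most a"
  then obtain p r where "x = of_int p / of_int r" "0 < r" "\<bar>p\<bar> \<le> 2 ^ a" "r \<le> 2 ^ a"
    by (auto simp: height_at_most_def)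
  moreover have "(2::int) ^ a \<le> 2 ^ b" using \<open>a \<le> b\<close> by (intro power_increasing) auto
  ultimately show "x \<in> height_at_most b" by (intro height_at_mostI[of x p r]) linarith+
qed

text \<open>The product of the denominators is used as it stands; the extra bit is for the sum of
  two products in the numerator.\<close>

lemma height_add:
  assumes "x \<in> height_at_most a" "z \<in> height_at_most b"
  shows "x + z \<in> height_at_most (a + b + 1)"
proof -
  obtain p r where x: "x = of_int p / of_int r" "0 < r" "\<bar>p\<bar> \<le> 2 ^ a" "r \<le> 2 ^ a"
    using assms(1) by (auto simp: height_at_most_def)
  obtain p' r' where z: "z = of_int p' / of_int r'" "0 < r'" "\<bar>p'\<bar> \<le> 2 ^ b" "r' \<le> 2 ^ b"
    using assms(2) by (auto simp: height_at_most_def)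
  show ?thesis
  proof (rule height_at_mostI)
    show "x + z = of_int (p * r' + p' * r) / of_int (r * r')"
      using x z by (simp add: add_frac_eq)
    have pow: "(2::int) ^ (a + b + 1) = 2 * (2 ^ a * 2 ^ b)" by (simp add: power_add)
    have "\<bar>p\<bar> * r' \<le> 2 ^ a * 2 ^ b" "r * \<bar>p'\<bar> \<le> 2 ^ a * 2 ^ b"
      using x z by (intro mult_mono; simp)+
    moreover have "\<bar>p * r' + p' * r\<bar> \<le> \<bar>p\<bar> * r' + r * \<bar>p'\<bar>"
      using abs_triangle_ineq[of "p * r'" "p' * r"] x z by (simp add: abs_mult mult.commute[of r])
    ultimately show "\<bar>p * r' + p' * r\<bar> \<le> 2 ^ (a + b + 1)" unfolding pow by linarith
    have "r * r' \<le> 2 ^ a * 2 ^ b" using x z by (intro mult_mono) auto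
    moreover have "(0::int) \<le> 2 ^ a * 2 ^ b" by simp
    ultimately show "r * r' \<le> 2 ^ (a + b + 1)" unfolding pow by linarith
  qed (use x z in auto)
qed

lemma height_mult:
  assumes "x \<in> height_at_most a" "z \<in> height_at_most b"
  shows "x * z \<in> height_at_most (a + b)"
proof -
  obtain p r where x: "x = of_int p / of_int r" "0 < r" "\<bar>p\<bar> \<le> 2 ^ a" "r \<le> 2 ^ a"
    using assms(1) by (auto simp: height_at_most_def)
  obtain p' r' where z: "z = of_int p' / of_int r'" "0 < r'" "\<bar>p'\<bar> \<le> 2 ^ b" "r' \<le> 2 ^ b"
    using assms(2) by (auto simp: height_at_most_def)
  show ?thesis
    by (rule height_at_mostI[of _ "p * p'" "r * r'"])
      (use x z in \<open>auto simp: abs_mult power_add intro: mult_mono\<close>)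
qed

lemma height_inverse:
  assumes "x \<in> height_at_most a"
  shows "1 / x \<in> height_at_most a"
proof -
  obtain p r where x: "x = of_int p / of_int r" "0 < r" "\<bar>p\<bar> \<le> 2 ^ a" "r \<le> 2 ^ a"
    using assms by (auto simp: height_at_most_def)
  consider "p = 0" | "p > 0" | "p < 0" by linarith
  then show ?thesis
  proof cases
    \<comment> \<open>By convention 1 / 0 = 0, so zero stays at the same level.\<close>
    case 1
    then show ?thesis using x by (intro height_at_mostI[of _ 0 1]) auto
  next
    case 2
    then show ?thesis using x by (intro height_at_mostI[of _ r p]) auto
  next
    case 3
    then show ?thesis using x by (intro height_at_mostI[of _ "- r" "- p"]) auto
  qed
qed

lemma height_uminus: "x \<in> height_at_most a \<Longrightarrow> - x \<in> height_at_most a"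
  unfolding height_at_most_def by (force intro: exI[of _ "- _"])

lemma bit_size_of_rat:
  assumes "quotient_of r = (p, s)"
  shows "bit_size (of_rat r) = nat (bitlen \<bar>p\<bar>) + nat (bitlen s)"
proof -
  have "inv_into UNIV real_of_rat (real_of_rat r) = r" by (rule inv_f_f) (auto intro: injI)
  then show ?thesis using assms by (simp add: bit_size_def)
qed

lemma bitlen_le: "0 \<le> p \<Longrightarrow> p \<le> 2 ^ b \<Longrightarrow> nat (bitlen p) \<le> b + 1"
proof -
  assume p: "0 \<le> p" "p \<le> 2 ^ b"
  have "(2::int) ^ b < 2 ^ (b + 1)" by simp
  then have "p < 2 ^ (b + 1)" using p by linarith
  then have "bitlen p \<le> int (b + 1)" by (subst bitlen_le_iff_power) (simp_all only: nat_int of_nat_0_le_iff)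
  then show ?thesis by simp
qed

text \<open>Passing to lowest terms p' / r' does not increase either part: from p r' = p' r and
  coprimality, r' divides r and p' divides p. The case p = 0 is separate because everything divides
  0. A number equal to 2^b has b + 1 bits.\<close>

lemma bit_size_le:
  assumes "x \<in> height_at_most b"
  shows "bit_size x \<le> 2 * (b + 1)"
proof -
  obtain p r where x: "x = of_int p / of_int r" "0 < r" "\<bar>p\<bar> \<le> 2 ^ b" "r \<le> 2 ^ b"
    using assms by (auto simp: height_at_most_def)
  define w where "w = Rat.Fract p r"
  have xw: "x = of_rat w" using x by (simp add: w_def of_rat_rat)
  obtain p' r' where q: "quotient_of w = (p', r')" by (cases "quotient_of w")
  have r': "0 < r'" "coprime p' r'" "w = Rat.Fract p' r'"
    using quotient_of_denom_pos[OF q] quotient_of_coprime[OF q] Fract_of_int_quotient quotient_of_div[OF q] by auto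
  have eq: "p * r' = p' * r" using r' x by (simp add: w_def eq_rat)
  have "r' dvd r" using eq r' by (metis coprime_commute coprime_dvd_mult_right_iff dvd_triv_right)
  then have "r' \<le> 2 ^ b" using x zdvd_imp_le[of r' r] by linarith
  moreover have "\<bar>p'\<bar> \<le> 2 ^ b"
  proof (cases "p = 0")
    case True
    then show ?thesis using eq x by simp
  next
    case False
    have "p' dvd p" using eq r' by (metis coprime_dvd_mult_left_iff dvd_triv_left)
    then have "\<bar>p'\<bar> \<le> \<bar>p\<bar>" using False by (simp add: dvd_imp_le_int)
    then show ?thesis using x by linarith
  qed
  ultimately have "nat (bitlen r') \<le> b + 1" "nat (bitlen \<bar>p'\<bar>) \<le> b + 1"
    using r' bitlen_le[of r' b] bitlen_le[of "\<bar>p'\<bar>" b] by simp_all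
  then show ?thesis using bit_size_of_rat[OF q] xw by simp
qed

lemma height_of_bit_size:
  assumes "x \<in> \<rat>" "bit_size x \<le> s"
  shows "x \<in> height_at_most s"
proof -
  obtain w where w: "x = of_rat w" using assms(1) by (auto simp: Rats_def)
  obtain p r where q: "quotient_of w = (p, r)" by (cases "quotient_of w")
  have r: "0 < r" "x = of_int p / of_int r"
    using quotient_of_denom_pos[OF q] quotient_of_div[OF q] w by (auto simp: of_rat_divide)
  have "nat (bitlen \<bar>p\<bar>) \<le> s" "nat (bitlen r) \<le> s"
    using assms(2) bit_size_of_rat[OF q] w by auto
  then have "bitlen \<bar>p\<bar> \<le> int s" "bitlen r \<le> int s" by auto
  then have "\<bar>p\<bar> < 2 ^ s" "r < 2 ^ s" using r by (simp_all add: bitlen_le_iff_power)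
  then show ?thesis using r by (intro height_at_mostI) auto
qed

lemma grid_height: "grid \<upsilon> \<subseteq> height_at_most \<upsilon>"
proof
  fix x assume "x \<in> grid \<upsilon>"
  then obtain k where "x = real k / 2 ^ \<upsilon>" "k \<le> 2 ^ \<upsilon>" by (auto simp: grid_def)
  moreover from this have "int k \<le> 2 ^ \<upsilon>" by (metis of_nat_le_iff of_nat_numeral of_nat_power)
  ultimately show "x \<in> height_at_most \<upsilon>" by (intro height_at_mostI[of _ "int k" "2 ^ \<upsilon>"]) auto
qed

lemma size_model_real_ram: "1 \<le> q \<Longrightarrow> size_model (\<lambda>_. 0) (\<lambda>_. UNIV) B 1 q"
  by unfold_locales (auto simp: arith_cost_def)

text \<open>A number of level B has bit size at most \<open>2 * (B + 1)\<close>, and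
  \<open>4 * B + 5\<close> is 1 plus the bit sizes of two such numbers.\<close>

lemma size_model_bits:
  assumes "1 \<le> q"
  shows "size_model bit_size height_at_most B ((4 * B + 5)\<^sup>2) q"
proof
  fix x z :: real assume "x \<in> height_at_most B" "z \<in> height_at_most B"
  then have "1 + bit_size x + bit_size z \<le> 4 * B + 5"
    using bit_size_le[of x B] bit_size_le[of z B] by simp
  then show "arith_cost bit_size x z \<le> (4 * B + 5)\<^sup>2"
    unfolding arith_cost_def by (rule power_mono) simp
next
  fix x z :: real and a b assume "x \<in> height_at_most a" "z \<in> height_at_most b"
  then show "x / z \<in> height_at_most (a + b)"
    using height_mult[OF _ height_inverse, of x a z b] by simp
next
  show "1 \<le> (4 * B + 5)\<^sup>2" by (simp add: power2_eq_square)
  show "0 \<in> height_at_most 0" by (rule height_at_mostI[of _ 0 1]) auto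
  show "1 \<in> height_at_most 0" by (rule height_at_mostI[of _ 1 1]) auto
qed (use assms height_at_most_mono height_add height_mult height_uminus in auto)

section \<open>Numerical estimates and the final bounds\<close>

text \<open>Each unit of b is one use of Pascal's rule, which at most doubles the bound. Applied
  with b = k + 1, this keeps k out of the base of the power: the q-th power of the number of
  halfspaces then has an exponent of order \<open>q * q\<close>, without a factor such as
  \<open>q ^ (q * q)\<close>.\<close>

lemma choose_add_le: "((a + b) choose r) \<le> 2 ^ b * (a + 1) ^ r"
proof (induction b arbitrary: r)
  case 0
  then show ?case using binomial_le_power by simp
next
  case (Suc b)
  show ?case
  proof (cases r)
    case (Suc r')
    have "(a + Suc b) choose r = ((a + b) choose r') + ((a + b) choose r)" by (simp add: Suc)
    also have "\<dots> \<le> 2 ^ b * (a + 1) ^ r' + 2 ^ b * (a + 1) ^ r" by (intro add_mono Suc.IH)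
    also have "\<dots> \<le> 2 ^ b * (a + 1) ^ r + 2 ^ b * (a + 1) ^ r"
      by (intro add_mono mult_left_mono power_increasing) (auto simp: Suc)
    finally show ?thesis by simp
  qed simp
qed

text \<open>With N = n + 2 \<ge> 2 and q = k + 2, everything is compared as a power of N: constants
  are bounded by powers of 2, and a factor q is traded for \<open>N ^ q\<close> by q \<le> 2^q. The
  exponent \<open>q * q\<close> in Y is dictated by the last claim, where the number of halfspaces
  is at most \<open>N ^ (3 * q)\<close> and is raised to the power q.\<close>

lemma Y_bounds:
  fixes n k :: nat
  defines "Y \<equiv> (n + 2) ^ ((k + 2)\<^sup>2)"
  shows "16 \<le> Y" "k + 2 + 1 \<le> Y" "n + 2 \<le> Y" "(3 * (k + 2)) ^ (k + 2) \<le> Y ^ 2"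
    "(n * n + k + 3) ^ (k + 1) \<le> Y ^ 4" "(2 * ((n * n + k + 1) choose k) + 2) ^ (k + 2) \<le> Y ^ 3"
proof -
  define N q where "N = n + 2" and "q = k + 2"
  have N: "2 \<le> N" "n + 2 = N" and q: "2 \<le> q" "k + 2 = q" "k + 1 \<le> q" by (simp_all add: N_def q_def)
  have Ypow: "N ^ (i * (q * q)) = Y ^ i" for i
    unfolding Y_def N q power2_eq_square by (simp only: mult.commute[of i] power_mult)
  have two: "2 ^ i \<le> N ^ i" for i using N by (intro power_mono) auto
  have mono: "i \<le> j \<Longrightarrow> N ^ i \<le> N ^ j" for i j using N by (intro power_increasing) auto
  have qq: "4 \<le> q * q" "q \<le> q * q" using mult_mono[of 2 q 2 q] q by auto
  have "2 ^ 4 \<le> N ^ 4" by (rule two)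
  also have "\<dots> \<le> N ^ (1 * (q * q))" using qq by (intro mono) simp
  finally show "16 \<le> Y" unfolding Ypow by simp
  have exp: "i + 1 \<le> 2 ^ i" for i :: nat using less_exp[of i] by linarith
  have "q + 1 \<le> 2 ^ q" by (rule exp)
  also have "\<dots> \<le> N ^ q" by (rule two)
  also have "\<dots> \<le> N ^ (1 * (q * q))" using qq by (intro mono) simp
  finally show "k + 2 + 1 \<le> Y" unfolding Ypow q by simp
  have "N ^ 1 \<le> N ^ (1 * (q * q))" using qq by (intro mono) linarith
  then show "n + 2 \<le> Y" unfolding Ypow N by simp
  have q2: "q \<le> 2 ^ q" using exp[of q] by linarith
  have "3 * q \<le> 2 ^ q * 2 ^ q"
    using q q2 power_increasing[of 2 q "2::nat"] by (intro mult_mono) auto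
  also have "\<dots> = 2 ^ (2 * q)" by (simp only: power_add mult_2)
  also have "\<dots> \<le> N ^ (2 * q)" by (rule two)
  finally have "(3 * q) ^ q \<le> (N ^ (2 * q)) ^ q" by (rule power_mono) simp
  also have "\<dots> = N ^ (2 * (q * q))" by (simp only: power_mult[symmetric] mult.assoc)
  finally show "(3 * (k + 2)) ^ (k + 2) \<le> Y ^ 2" unfolding Ypow q .
  have "n * n + k + 3 \<le> (N * N) * q" by (simp add: N_def q_def algebra_simps)
  also have "\<dots> \<le> N ^ 2 * N ^ q"
    using le_trans[OF q2 two] by (intro mult_mono) (auto simp: power2_eq_square)
  also have "\<dots> = N ^ (2 + q)" by (simp only: power_add)
  also have "\<dots> \<le> N ^ (2 * q)" using q by (intro mono) simp
  finally have "(n * n + k + 3) ^ (k + 1) \<le> (N ^ (2 * q)) ^ (k + 1)" by (rule power_mono) simp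
  also have "\<dots> = N ^ (2 * q * (k + 1))" by (simp only: power_mult)
  also have "\<dots> \<le> N ^ (4 * (q * q))" using mult_left_mono[OF q(3), of q] by (intro mono) simp
  finally show "(n * n + k + 3) ^ (k + 1) \<le> Y ^ 4" unfolding Ypow .
  have "n * n + 1 \<le> N ^ 2" by (simp add: N_def power2_eq_square)
  then have "2 ^ (k + 1) * (n * n + 1) ^ k \<le> N ^ (k + 1) * (N ^ 2) ^ k"
    using two[of "k + 1"] N(1) by (intro mult_mono power_mono) simp_all
  also have "\<dots> = N ^ (k + 1 + 2 * k)" by (simp only: power_mult power_add)
  finally have choose: "(n * n + k + 1) choose k \<le> N ^ (k + 1 + 2 * k)"
    using choose_add_le[of "n * n" "k + 1" k] by (simp only: add.assoc)
  moreover have "1 \<le> N ^ (k + 1 + 2 * k)" using N by simp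
  ultimately have "2 * ((n * n + k + 1) choose k) + 2 \<le> 4 * N ^ (k + 1 + 2 * k)" by linarith
  also have "\<dots> \<le> N ^ 2 * N ^ (k + 1 + 2 * k)" using two[of 2] by (intro mult_right_mono) auto
  also have "\<dots> = N ^ (2 + (k + 1 + 2 * k))" by (simp only: power_add)
  also have "\<dots> \<le> N ^ (3 * q)" by (intro mono) (simp add: q_def)
  finally have "(2 * ((n * n + k + 1) choose k) + 2) ^ q \<le> (N ^ (3 * q)) ^ q" by (rule power_mono) simp
  also have "\<dots> = N ^ (3 * (q * q))" by (simp only: power_mult[symmetric] mult.assoc)
  finally show "(2 * ((n * n + k + 1) choose k) + 2) ^ (k + 2) \<le> Y ^ 3" unfolding Ypow q .
qed

text \<open>Here \<Lambda> stands for \<open>(2 * q) ^ q\<close>. The nested expression is linear in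
  a, so a + 1 occurs to the first power and only the exponent of Y accumulates.\<close>

lemma B_bound_poly:
  fixes Y q a \<Lambda> :: nat
  assumes Y: "16 \<le> Y" and q: "q \<le> Y" and \<Lambda>: "\<Lambda> \<le> Y ^ 2"
  shows "4 * (q * ((2 * a + 2) * \<Lambda> + 2 * ((2 * (q * ((2 * a + 2) * \<Lambda> + a + 1)) + 2) * \<Lambda>) + 1)) + 5
    \<le> Y ^ 12 * (a + 1)"
proof -
  let ?A = "a + 1"
  have up: "c * (Y ^ i * ?A) \<le> Y ^ Suc i * ?A" if "c \<le> 16" for c i
  proof -
    have "c * (Y ^ i * ?A) \<le> Y * (Y ^ i * ?A)" using that Y by (intro mult_right_mono) auto
    then show ?thesis by (simp only: power_Suc mult.assoc)
  qed
  have one: "?A \<le> Y ^ i * ?A" for i using Y mult_right_mono[of 1 "Y ^ i" ?A] by simp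
  have times: "x * z \<le> Y ^ (i + j) * ?A" if "x \<le> Y ^ i" "z \<le> Y ^ j * ?A" for x z i j
    using mult_mono[OF that] by (simp only: power_add mult.assoc)
  define n1 where "n1 = (2 * a + 2) * \<Lambda>"
  have "n1 = 2 * (\<Lambda> * ?A)" by (simp add: n1_def algebra_simps)
  also have "\<dots> \<le> 2 * (Y ^ 2 * ?A)" using \<Lambda> by (intro mult_left_mono mult_right_mono) auto
  also have "\<dots> \<le> Y ^ Suc 2 * ?A" by (rule up) simp
  finally have n1: "n1 \<le> Y ^ 3 * ?A" by (simp add: numeral_3_eq_3 numeral_2_eq_2)
  have "n1 + a + 1 \<le> 2 * (Y ^ 3 * ?A)" using n1 one[of 3] by linarith
  also have "\<dots> \<le> Y ^ Suc 3 * ?A" by (rule up) simp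
  finally have "q * (n1 + a + 1) \<le> Y ^ (1 + Suc 3) * ?A" using q by (intro times) auto
  then have "2 * (q * (n1 + a + 1)) + 2 \<le> 4 * (Y ^ 5 * ?A)" using one[of 5] by simp
  also have "\<dots> \<le> Y ^ Suc 5 * ?A" by (rule up) simp
  finally have "\<Lambda> * (2 * (q * (n1 + a + 1)) + 2) \<le> Y ^ (2 + Suc 5) * ?A" using \<Lambda> by (intro times)
  then have v: "(2 * (q * (n1 + a + 1)) + 2) * \<Lambda> \<le> Y ^ 8 * ?A" by (simp only: mult.commute[of \<Lambda>]) simp
  have "Y ^ 3 * ?A \<le> Y ^ 8 * ?A" using Y by (intro mult_right_mono power_increasing) auto
  then have "n1 + 2 * ((2 * (q * (n1 + a + 1)) + 2) * \<Lambda>) + 1 \<le> 4 * (Y ^ 8 * ?A)"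
    using n1 v one[of 8] by linarith
  also have "\<dots> \<le> Y ^ Suc 8 * ?A" by (rule up) simp
  finally have "q * (n1 + 2 * ((2 * (q * (n1 + a + 1)) + 2) * \<Lambda>) + 1) \<le> Y ^ (1 + Suc 8) * ?A"
    using q by (intro times) auto
  then have "4 * (q * (n1 + 2 * ((2 * (q * (n1 + a + 1)) + 2) * \<Lambda>) + 1)) + 5 \<le> 9 * (Y ^ 10 * ?A)"
    using one[of 10] by simp
  also have "\<dots> \<le> Y ^ Suc 10 * ?A" by (rule up) simp
  also have "\<dots> \<le> Y ^ 12 * ?A" using Y by (intro mult_right_mono power_increasing) auto
  finally show ?thesis by (simp only: n1_def)
qed

lemma time_bounds:
  fixes k a :: nat
  assumes lenps: "\<forall>p\<in>set ps. length p = Suc k" and leny: "length y < Suc k"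
  defines "Y \<equiv> (length ps + 2) ^ ((k + 2)\<^sup>2)"
  shows "time (nested_intervals_t (\<lambda>_. 0) (Suc k) ps y) \<le> Y ^ 47"
    and "\<lbrakk>\<forall>p\<in>set ps. set p \<subseteq> height_at_most a; set y \<subseteq> height_at_most a\<rbrakk> \<Longrightarrow>
      time (nested_intervals_t bit_size (Suc k) ps y) \<le> Y ^ 47 * (a + 1)\<^sup>2"
proof -
  note Y = Y_bounds[where n = "length ps" and k = k, folded Y_def]
  define B where "B = (k + 2) * ((2 * a + 2) * (2 * (k + 2)) ^ (k + 2)
      + 2 * ((2 * ((k + 2) * ((2 * a + 2) * (2 * (k + 2)) ^ (k + 2) + a + 1)) + 2) * (2 * (k + 2)) ^ (k + 2)) + 1)"
  have q: "1 \<le> k + 2" by simp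
  have B_le: "(k + 2) * ((2 * a + 2) * (2 * (k + 2)) ^ (k + 2)
      + 2 * ((2 * ((k + 2) * ((2 * a + 2) * (2 * (k + 2)) ^ (k + 2) + a + 1)) + 2) * (2 * (k + 2)) ^ (k + 2)) + 1) \<le> B"
    unfolding B_def by (rule order.refl)
  have all_levels: "\<forall>p\<in>set ps. set p \<subseteq> UNIV" "set y \<subseteq> UNIV" by simp_all
  have "program_cost (\<lambda>_. 0) (\<lambda>_. UNIV) B 1 (k + 2) Y k a ps y"
    by (intro program_cost.intro size_model_real_ram q program_cost_axioms.intro refl Y lenps leny
        all_levels B_le)
  then have "time (nested_intervals_t (\<lambda>_. 0) (Suc k) ps y) \<le> Y ^ 23 * 1"
    by (rule program_cost.time_nested_intervals_t_le)
  \<comment> \<open>The exponent is raised so that both cost models share one constant.\<close>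
  also have "\<dots> \<le> Y ^ 47" unfolding mult_1_right using Y(1) by (intro power_increasing) auto
  finally show "time (nested_intervals_t (\<lambda>_. 0) (Suc k) ps y) \<le> Y ^ 47" .
  assume a: "\<forall>p\<in>set ps. set p \<subseteq> height_at_most a" "set y \<subseteq> height_at_most a"
  have "(2 * (k + 2)) ^ (k + 2) \<le> (3 * (k + 2)) ^ (k + 2)" by (rule power_mono) simp_all
  then have "4 * B + 5 \<le> Y ^ 12 * (a + 1)"
    unfolding B_def using Y(1,2,4) by (intro B_bound_poly) linarith+
  then have "(4 * B + 5)\<^sup>2 \<le> (Y ^ 12 * (a + 1))\<^sup>2" by (rule power_mono) simp
  also have "\<dots> = Y ^ 24 * (a + 1)\<^sup>2" by (simp only: power_mult_distrib power_mult[symmetric]) simp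
  finally have C: "(4 * B + 5)\<^sup>2 \<le> Y ^ 24 * (a + 1)\<^sup>2" .
  have "program_cost bit_size height_at_most B ((4 * B + 5)\<^sup>2) (k + 2) Y k a ps y"
    by (intro program_cost.intro size_model_bits q program_cost_axioms.intro refl Y lenps leny a
        B_le)
  then have "time (nested_intervals_t bit_size (Suc k) ps y) \<le> Y ^ 23 * (4 * B + 5)\<^sup>2"
    by (rule program_cost.time_nested_intervals_t_le)
  \<comment> \<open>The origin of 47: 23 powers bound the run relative to the cost of one operation,
    and 24 = 2 * 12 come from that cost, the square of a number of bits at most
    \<open>Y ^ 12 * (a + 1)\<close>.\<close>
  also have "\<dots> \<le> Y ^ 23 * (Y ^ 24 * (a + 1)\<^sup>2)" using C by (rule mult_left_mono) simp
  also have "\<dots> = Y ^ 47 * (a + 1)\<^sup>2" by (simp only: mult.assoc[symmetric] power_add[symmetric]) simp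
  finally show "time (nested_intervals_t bit_size (Suc k) ps y) \<le> Y ^ 47 * (a + 1)\<^sup>2" .
qed

text \<open>Correctness is claimed for every \<open>sz\<close>, since the size function affects
  costs and never values. The exponents reduce to one quantity, as d + 1 = k + 2 makes
  \<open>(n + 2) ^ (d + 1)\<^sup>2\<close> the number Y of the analysis.\<close>

theorem theorem3p3:
  "\<exists>c::nat. \<forall>(\<upsilon>::nat) (d::nat) (n::nat) (i::nat) (P::real list set) (ps::real list list) (y::real list).
     P \<subseteq> grid_points \<upsilon> d \<longrightarrow> card P = n \<longrightarrow> distinct ps \<longrightarrow> set ps = P \<longrightarrow>
     i < d \<longrightarrow> length y = i \<longrightarrow>
       (\<forall>sz::real \<Rightarrow> nat.
          (\<forall>\<kappa>\<in>{1..(n + 1) div 2}.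
             {w. length w = d \<and> (\<forall>(u, t)\<in>set (val (depth_region_t sz d ps \<kappa>)). t \<le> inner_list u w)}
               = depth_region d P \<kappa>) \<and>
          (let Js = val (nested_intervals_t sz d ps y) in
             correct_output d P y Js \<and>
             (\<forall>\<kappa> \<kappa>'. 1 \<le> \<kappa> \<and> \<kappa> < \<kappa>' \<and> \<kappa>' \<le> length Js \<longrightarrow>
                nth_interval Js \<kappa>' \<subseteq> nth_interval Js \<kappa>) \<and>
             (\<forall>I::real set. closed I \<and> is_interval I \<and> I \<noteq> {} \<longrightarrow>
                TDC_interval d P y I =
                  Max (insert 0 {\<kappa>\<in>{1..length Js}. I \<inter> nth_interval Js \<kappa> \<noteq> {}})))) \<and>
       time (nested_intervals_t (\<lambda>_. 0) d ps y) \<le> (n + 2) ^ (c * (d + 1)\<^sup>2) \<and>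
       (\<forall>s::nat. (\<forall>x\<in>set y. x \<in> \<rat> \<and> bit_size x \<le> s) \<longrightarrow>
          time (nested_intervals_t bit_size d ps y) \<le> (n + 2) ^ (c * (d + 1)\<^sup>2) * (\<upsilon> + s + 2) ^ c)"
proof (rule exI[of _ 47], intro allI impI)
  fix \<upsilon> d n i :: nat and P :: "real list set" and ps :: "real list list" and y :: "real list"
  assume P: "P \<subseteq> grid_points \<upsilon> d" and n: "card P = n" and dist: "distinct ps" and ps: "set ps = P"
    and i: "i < d" "length y = i"
  obtain k where d: "d = Suc k" using i by (cases d) auto
  have lenps: "\<forall>p\<in>set ps. length p = Suc k" using P ps d by (auto simp: grid_points_def)
  have leny: "length y < Suc k" using i d by simp
  have len: "length ps = n" using n ps dist by (simp add: distinct_card[symmetric])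
  have half: "\<kappa> \<le> length ps" if "1 \<le> \<kappa>" "\<kappa> \<le> (n + 1) div 2" for \<kappa>
    using that len by linarith
  have exp: "(n + 2) ^ (47 * (d + 1)\<^sup>2) = ((length ps + 2) ^ ((k + 2)\<^sup>2)) ^ 47"
  proof -
    have "d + 1 = k + 2" using d by simp
    then show ?thesis by (simp only: len mult.commute[of 47] power_mult)
  qed
  have regions: "{w. length w = d \<and> (\<forall>(u, t)\<in>set (val (depth_region_t sz d ps \<kappa>)). t \<le> inner_list u w)}
      = depth_region d P \<kappa>" if "\<kappa> \<in> {1..(n + 1) div 2}" for sz \<kappa>
    using depth_region_halfspaces[OF dist lenps, of \<kappa> sz] that half[of \<kappa>]
    by (simp add: feasible_def ps d)
  have intervals: "let Js = val (nested_intervals_t sz d ps y) in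
      correct_output d P y Js \<and>
      (\<forall>\<kappa> \<kappa>'. 1 \<le> \<kappa> \<and> \<kappa> < \<kappa>' \<and> \<kappa>' \<le> length Js \<longrightarrow>
         nth_interval Js \<kappa>' \<subseteq> nth_interval Js \<kappa>) \<and>
      (\<forall>I::real set. closed I \<and> is_interval I \<and> I \<noteq> {} \<longrightarrow>
         TDC_interval d P y I =
           Max (insert 0 {\<kappa>\<in>{1..length Js}. I \<inter> nth_interval Js \<kappa> \<noteq> {}}))" for sz
    unfolding Let_def d ps[symmetric]
  proof (intro conjI allI impI; (elim conjE)?)
    note correct = nested_intervals_correct[OF dist lenps leny, where sz = sz]
    let ?Js = "val (nested_intervals_t sz (Suc k) ps y)"
    show "correct_output (Suc k) (set ps) y ?Js" by (rule correct)
    show "nth_interval ?Js \<kappa>' \<subseteq> nth_interval ?Js \<kappa>" if "1 \<le> \<kappa>" "\<kappa> < \<kappa>'" "\<kappa>' \<le> length ?Js" for \<kappa> \<kappa>'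
      using that by (intro correct(2)) simp_all
    show "TDC_interval (Suc k) (set ps) y I =
        Max (insert 0 {\<kappa>\<in>{1..length ?Js}. I \<inter> nth_interval ?Js \<kappa> \<noteq> {}})" if "I \<noteq> {}" for I
      using that by (rule correct(3))
  qed
  have real_ram: "time (nested_intervals_t (\<lambda>_. 0) d ps y) \<le> (n + 2) ^ (47 * (d + 1)\<^sup>2)"
    unfolding exp unfolding d by (rule time_bounds(1)[OF lenps leny])
  have bits: "time (nested_intervals_t bit_size d ps y) \<le> (n + 2) ^ (47 * (d + 1)\<^sup>2) * (\<upsilon> + s + 2) ^ 47"
    if s: "\<forall>x\<in>set y. x \<in> \<rat> \<and> bit_size x \<le> s" for s
  proof -
    \<comment> \<open>A common level for both inputs: the data have level \<upsilon> as grid points,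
      and y has level s.\<close>
    have "set p \<subseteq> height_at_most (\<upsilon> + s)" if "p \<in> set ps" for p
    proof -
      have "set p \<subseteq> grid \<upsilon>" using that P ps by (auto simp: grid_points_def)
      then show ?thesis using grid_height[of \<upsilon>] height_at_most_mono[of \<upsilon> "\<upsilon> + s"] by auto
    qed
    moreover have "set y \<subseteq> height_at_most (\<upsilon> + s)"
      using s height_of_bit_size height_at_most_mono[of s "\<upsilon> + s"] by auto
    ultimately have "time (nested_intervals_t bit_size (Suc k) ps y) \<le>
        ((length ps + 2) ^ ((k + 2)\<^sup>2)) ^ 47 * (\<upsilon> + s + 1)\<^sup>2"
      by (intro time_bounds(2)[OF lenps leny]) auto
    also have "(\<upsilon> + s + 1)\<^sup>2 \<le> (\<upsilon> + s + 2) ^ 47"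
      using power_mono[of "\<upsilon> + s + 1" "\<upsilon> + s + 2" 2] power_increasing[of 2 47 "\<upsilon> + s + 2"] by linarith
    finally show ?thesis unfolding exp unfolding d by (simp only: mult_le_mono2)
  qed
  show "(\<forall>sz::real \<Rightarrow> nat.
          (\<forall>\<kappa>\<in>{1..(n + 1) div 2}.
             {w. length w = d \<and> (\<forall>(u, t)\<in>set (val (depth_region_t sz d ps \<kappa>)). t \<le> inner_list u w)}
               = depth_region d P \<kappa>) \<and>
          (let Js = val (nested_intervals_t sz d ps y) in
             correct_output d P y Js \<and>
             (\<forall>\<kappa> \<kappa>'. 1 \<le> \<kappa> \<and> \<kappa> < \<kappa>' \<and> \<kappa>' \<le> length Js \<longrightarrow>
                nth_interval Js \<kappa>' \<subseteq> nth_interval Js \<kappa>) \<and>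
             (\<forall>I::real set. closed I \<and> is_interval I \<and> I \<noteq> {} \<longrightarrow>
                TDC_interval d P y I =
                  Max (insert 0 {\<kappa>\<in>{1..length Js}. I \<inter> nth_interval Js \<kappa> \<noteq> {}})))) \<and>
       time (nested_intervals_t (\<lambda>_. 0) d ps y) \<le> (n + 2) ^ (47 * (d + 1)\<^sup>2) \<and>
       (\<forall>s::nat. (\<forall>x\<in>set y. x \<in> \<rat> \<and> bit_size x \<le> s) \<longrightarrow>
          time (nested_intervals_t bit_size d ps y) \<le> (n + 2) ^ (47 * (d + 1)\<^sup>2) * (\<upsilon> + s + 2) ^ 47)"
    using regions intervals real_ram bits by blast
qed

end
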